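(* Let $k$ be any field, let $S=k[x,y,z]_{(x,y,z)}$ be the localization of the polynomial ring $k[x,y,z]$ at the maximal ideal $(x,y,z)$, let $$I=(x^2-y^5,\; xy^2+yz^3-z^5)S,$$ and let $R=S/I$. Then $$\operatorname{index}(R)=5<6=\operatorname{g\ell\ell}(R),$$ where $\operatorname{index}(R)$ is the index of $R$ and $\operatorname{g\ell\ell}(R)$ is the generalized Löewy length of $R$.
   Context: Let $(R,\mathfrak m)$ be a commutative Noetherian local ring that is Cohen-Macaulay, of Krull dimension $d$. A finitely generated $R$-module $X$ is maximal Cohen-Macaulay (MCM) if $\operatorname{depth}(X)=\dim(R)$. The free rank $\operatorname{f-rank}(X)$ of a finitely generated module $X$ is the maximal number of copies of $R$ splitting out of $X$, i.e. the largest $m$ such that $X\cong R^m\oplus X'$ for some module $X'$. For a finitely generated $R$-module $M$, the Auslander delta invariant is $$\delta(M)=\min\{\operatorname{f-rank}(X)\mid X \text{ is a (finitely generated) MCM } R\text{-module and there exists a surjection } X\to M\to 0\}.$$ One has $0\le \delta(R/\mathfrak m^n)\le \delta(R/\mathfrak m^{n+1})\le 1$ for all $n\ge 1$. The index of $R$ is $$\operatorname{index}(R)=\inf\{n\ge 1\mid \delta(R/\mathfrak m^n)=1\}.$$ For an $R$-module $N$ of finite length, the Löewy length $\ell\ell(N)$ is the smallest integer $n$ such that $\mathfrak m^nN=0$. The generalized Löewy length of $R$ is $$\operatorname{g\ell\ell}(R)=\min\{\ell\ell(R/(x_1,\ldots,x_d))\mid x_1,\ldots,x_d \text{ is a system of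 parameters for } R\}.$$ *)

theory Defs
  imports
    "HOL-Algebra.Algebra"
    "HOL-Algebra.Algebraic_Closure_Type"
    "HOL-Computational_Algebra.Fraction_Field"
    "HOL-Library.Extended_Nat"
begin

section \<open>Modules over a commutative ring\<close>

text \<open>
  The record type of modules extends that of rings, so it carries the fields for a multiplication
  and a unit. They play no role for modules and are left unspecified below.
\<close>

definition module_hom ::
  "('r, 'c) ring_scheme \<Rightarrow> ('r, 'a, 'd) module_scheme \<Rightarrow> ('r, 'b, 'e) module_scheme \<Rightarrow> ('a \<Rightarrow> 'b) set"
  where "module_hom R M N =
    {f \<in> carrier M \<rightarrow> carrier N.
       (\<forall>u\<in>carrier M. \<forall>v\<in>carrier M. f (u \<oplus>\<^bsub>M\<^esub> v) = f u \<oplus>\<^bsub>N\<^esub> f v) \<and>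
       (\<forall>r\<in>carrier R. \<forall>v\<in>carrier M. f (r \<odot>\<^bsub>M\<^esub> v) = r \<odot>\<^bsub>N\<^esub> f v)}"

definition module_isomorphic ::
  "('r, 'c) ring_scheme \<Rightarrow> ('r, 'a, 'd) module_scheme \<Rightarrow> ('r, 'b, 'e) module_scheme \<Rightarrow> bool"
  where "module_isomorphic R M N \<longleftrightarrow>
    (\<exists>f\<in>module_hom R M N. bij_betw f (carrier M) (carrier N))"

definition module_span :: "('r, 'c) ring_scheme \<Rightarrow> ('r, 'a, 'd) module_scheme \<Rightarrow> 'a set \<Rightarrow> 'a set"
  where "module_span R M A = \<Inter>{N. submodule N R M \<and> A \<subseteq> N}"

definition fg_module :: "('r, 'c) ring_scheme \<Rightarrow> ('r, 'a, 'd) module_scheme \<Rightarrow> bool"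
  where "fg_module R M \<longleftrightarrow>
    module R M \<and> (\<exists>A. finite A \<and> A \<subseteq> carrier M \<and> module_span R M A = carrier M)"

text \<open>The submodule \<open>J M\<close> of \<open>M\<close>, for an ideal \<open>J\<close>.\<close>

definition ideal_smult :: "('r, 'c) ring_scheme \<Rightarrow> 'r set \<Rightarrow> ('r, 'a, 'd) module_scheme \<Rightarrow> 'a set"
  where "ideal_smult R J M = module_span R M {a \<odot>\<^bsub>M\<^esub> v | a v. a \<in> J \<and> v \<in> carrier M}"

definition direct_sum_module ::
  "('r, 'a, 'd) module_scheme \<Rightarrow> ('r, 'b, 'e) module_scheme \<Rightarrow> ('r, 'a \<times> 'b) module"
  where "direct_sum_module M N =
    \<lparr>carrier = carrier M \<times> carrier N,
     monoid.mult = undefined, one = undefined,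
     ring.zero = (\<zero>\<^bsub>M\<^esub>, \<zero>\<^bsub>N\<^esub>),
     add = (\<lambda>(u, u') (v, v'). (u \<oplus>\<^bsub>M\<^esub> v, u' \<oplus>\<^bsub>N\<^esub> v')),
     module.smult = (\<lambda>r (v, v'). (r \<odot>\<^bsub>M\<^esub> v, r \<odot>\<^bsub>N\<^esub> v'))\<rparr>"

text \<open>The free module \<open>R\<^sup>m\<close>, with extensional functions on \<open>{..<m}\<close> as elements.\<close>

definition free_module :: "('r, 'c) ring_scheme \<Rightarrow> nat \<Rightarrow> ('r, nat \<Rightarrow> 'r) module"
  where "free_module R m =
    \<lparr>carrier = {..<m} \<rightarrow>\<^sub>E carrier R,
     monoid.mult = undefined, one = undefined,
     ring.zero = (\<lambda>i\<in>{..<m}. \<zero>\<^bsub>R\<^esub>),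
     add = (\<lambda>u v. \<lambda>i\<in>{..<m}. u i \<oplus>\<^bsub>R\<^esub> v i),
     module.smult = (\<lambda>r v. \<lambda>i\<in>{..<m}. r \<otimes>\<^bsub>R\<^esub> v i)\<rparr>"

text \<open>The quotient \<open>R/J\<close> as an \<open>R\<close>-module.\<close>

definition quot_module :: "('r, 'c) ring_scheme \<Rightarrow> 'r set \<Rightarrow> ('r, 'r set) module"
  where "quot_module R J =
    \<lparr>carrier = carrier (R Quot J),
     monoid.mult = monoid.mult (R Quot J), one = one (R Quot J),
     ring.zero = ring.zero (R Quot J), add = ring.add (R Quot J),
     module.smult = (\<lambda>r C. (J +>\<^bsub>R\<^esub> r) \<otimes>\<^bsub>R Quot J\<^esub> C)\<rparr>"


section \<open>Invariants of local rings\<close>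

text \<open>The definitions from here on are meant for a Noetherian local ring \<open>R\<close>.\<close>

definition max_ideal :: "('r, 'c) ring_scheme \<Rightarrow> 'r set"
  where "max_ideal R = (THE \<mm>. maximalideal \<mm> R)"

definition max_ideal_power :: "('r, 'c) ring_scheme \<Rightarrow> nat \<Rightarrow> 'r set"
  where "max_ideal_power R n = max_ideal R [^]\<^bsub>ideals_set R\<^esub> n"

definition krull_dim :: "('r, 'c) ring_scheme \<Rightarrow> enat"
  where "krull_dim R =
    Sup {enat n | n. \<exists>P :: nat \<Rightarrow> 'r set. (\<forall>i\<le>n. primeideal (P i) R) \<and> (\<forall>i<n. P i \<subset> P (Suc i))}"

text \<open>
  \<open>x\<^sub>1, \<dots>, x\<^sub>n\<close> is \<open>M\<close>-regular if each \<open>x\<^sub>i\<close> is a nonzerodivisor on \<open>M / (x\<^sub>1, \<dots>, x\<^sub>i\<^sub>-\<^sub>1) M\<close> and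
  \<open>M \<noteq> (x\<^sub>1, \<dots>, x\<^sub>n) M\<close>. The condition on \<open>x\<^sub>i\<close> is stated in \<open>M\<close> rather than in the quotient.
\<close>

definition regular_sequence ::
  "('r, 'c) ring_scheme \<Rightarrow> ('r, 'a, 'd) module_scheme \<Rightarrow> 'r list \<Rightarrow> bool"
  where "regular_sequence R M xs \<longleftrightarrow>
    set xs \<subseteq> carrier R \<and>
    (\<forall>i<length xs. \<forall>v\<in>carrier M.
       xs ! i \<odot>\<^bsub>M\<^esub> v \<in> ideal_smult R (Idl\<^bsub>R\<^esub> (set (take i xs))) M \<longrightarrow>
       v \<in> ideal_smult R (Idl\<^bsub>R\<^esub> (set (take i xs))) M) \<and>
    ideal_smult R (Idl\<^bsub>R\<^esub> (set xs)) M \<noteq> carrier M"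

text \<open>The zero module has depth \<open>\<infinity>\<close>; in particular, it is not maximal Cohen-Macaulay.\<close>

definition depth :: "('r, 'c) ring_scheme \<Rightarrow> ('r, 'a, 'd) module_scheme \<Rightarrow> enat"
  where "depth R M =
    (if carrier M = {\<zero>\<^bsub>M\<^esub>} then \<infinity>
     else Sup {enat (length xs) | xs. set xs \<subseteq> max_ideal R \<and> regular_sequence R M xs})"

definition MCM :: "('r, 'c) ring_scheme \<Rightarrow> ('r, 'a, 'd) module_scheme \<Rightarrow> bool"
  where "MCM R Y \<longleftrightarrow> fg_module R Y \<and> depth R Y = krull_dim R"

text \<open>
  A complement \<open>Y'\<close> of \<open>R\<^sup>m\<close> in \<open>Y\<close> embeds into \<open>Y\<close>, so nothing is lost by taking its elements
  from the same type as those of \<open>Y\<close>.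
\<close>

definition f_rank :: "('r, 'c) ring_scheme \<Rightarrow> ('r, 'a, 'd) module_scheme \<Rightarrow> enat"
  where "f_rank R Y =
    Sup {enat m | m. \<exists>Y' :: ('r, 'a) module.
       module R Y' \<and> module_isomorphic R Y (direct_sum_module (free_module R m) Y')}"

text \<open>
  Every finitely generated \<open>R\<close>-module is isomorphic to a quotient of some \<open>R\<^sup>n\<close>, whose elements
  are sets of functions \<open>nat \<Rightarrow> 'r\<close>. Hence \<open>Y\<close> below ranges over all finitely generated
  modules up to isomorphism. The infimum is a minimum, as \<open>enat\<close> is well-ordered.
\<close>

definition delta :: "('r, 'c) ring_scheme \<Rightarrow> ('r, 'a, 'd) module_scheme \<Rightarrow> enat"
  where "delta R M =
    Inf {f_rank R Y | Y :: ('r, (nat \<Rightarrow> 'r) set) module.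
       MCM R Y \<and> (\<exists>f\<in>module_hom R Y M. f ` carrier Y = carrier M)}"

definition index :: "('r, 'c) ring_scheme \<Rightarrow> enat"
  where "index R =
    Inf {enat n | n. 1 \<le> n \<and> delta R (quot_module R (max_ideal_power R n)) = 1}"

definition loewy_length :: "('r, 'c) ring_scheme \<Rightarrow> ('r, 'a, 'd) module_scheme \<Rightarrow> enat"
  where "loewy_length R N =
    Inf {enat n | n. ideal_smult R (max_ideal_power R n) N = {\<zero>\<^bsub>N\<^esub>}}"

text \<open>
  A system of parameters consists of \<open>dim R\<close> elements of the maximal ideal that generate an
  ideal containing a power of it.
\<close>

definition system_of_parameters :: "('r, 'c) ring_scheme \<Rightarrow> 'r list \<Rightarrow> bool"
  where "system_of_parameters R xs \<longleftrightarrow>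
    enat (length xs) = krull_dim R \<and> set xs \<subseteq> max_ideal R \<and>
    (\<exists>n. max_ideal_power R n \<subseteq> Idl\<^bsub>R\<^esub> (set xs))"

definition gen_loewy_length :: "('r, 'c) ring_scheme \<Rightarrow> enat"
  where "gen_loewy_length R =
    Inf {loewy_length R (quot_module R (Idl\<^bsub>R\<^esub> (set xs))) | xs. system_of_parameters R xs}"


section \<open>The ring \<open>k[x,y,z]\<^bsub>(x,y,z)\<^esub> / (x\<^sup>2 - y\<^sup>5, x y\<^sup>2 + y z\<^sup>3 - z\<^sup>5)\<close>\<close>

text \<open>The localization of an integral domain at a prime ideal, inside the fraction field.\<close>

definition localization_at :: "'a::idom set \<Rightarrow> 'a fract ring"
  where "localization_at P =
    ring_of_type_algebra \<lparr>carrier := {Fraction_Field.Fract a b | a b. b \<notin> P}\<rparr>"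

text \<open>\<open>k[x,y,z]\<close> is rendered as \<open>k[x][y][z]\<close>.\<close>

type_synonym 'k poly3 = "'k poly poly poly"

definition var_x :: "'k::field poly3" where "var_x = [:[:[:0, 1:]:]:]"
definition var_y :: "'k::field poly3" where "var_y = [:[:0, 1:]:]"
definition var_z :: "'k::field poly3" where "var_z = [:0, 1:]"

definition ring_S :: "'k::field itself \<Rightarrow> 'k poly3 fract ring"
  where "ring_S _ =
    localization_at (Idl\<^bsub>ring_of_type_algebra :: 'k poly3 ring\<^esub> {var_x, var_y, var_z})"

definition ideal_I :: "'k::field itself \<Rightarrow> 'k poly3 fract set"
  where "ideal_I k = Idl\<^bsub>ring_S k\<^esub>
    {Fraction_Field.Fract (var_x ^ 2 - var_y ^ 5) 1,
     Fraction_Field.Fract (var_x * var_y ^ 2 + var_y * var_z ^ 3 - var_z ^ 5) 1}"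

definition ring_R :: "'k::field itself \<Rightarrow> 'k poly3 fract set ring"
  where "ring_R k = ring_S k Quot ideal_I k"

end

theory Submission
  imports Defs
begin

text \<open>
  Write \<open>V = k[z]\<^bsub>(z)\<^esub>\<close>. The ring \<open>R\<close> is free over \<open>V\<close> with basis
  \<open>1, y, \<dots>, y\<^sup>6, x, x y\<close>, and the coefficient of \<open>y\<^sup>6\<close> of a product is a perfect pairing on it.
  The maximal Cohen-Macaulay modules are the nonzero finitely generated \<open>X\<close> on which \<open>z\<close> is
  regular, and by duality such an \<open>X\<close> has a free summand as soon as \<open>y\<^sup>6 X\<close> is not contained in
  \<open>z X\<close>.

  Suppose \<open>y\<^sup>6 X \<subseteq> z X\<close> and \<open>X\<close> maps onto \<open>R/\<mm>\<^sup>5\<close>. Dividing \<open>y\<^sup>6 v\<close> by \<open>z\<close>, for \<open>v\<close> over \<open>1\<close>, gives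
  an \<open>r\<close> with \<open>y\<^sup>6 - z r\<close> and \<open>y r - (x z\<^sup>4 - x y z\<^sup>2)\<close> in \<open>\<mm>\<^sup>5\<close>, because
  \<open>y\<^sup>7 = z (x z\<^sup>4 - x y z\<^sup>2)\<close> in \<open>R\<close>; comparing coefficients shows that there is no such \<open>r\<close>. On the
  other hand the ideal \<open>(z, y\<^sup>6)\<close> is not principal, so it has no free summand, and it maps onto
  \<open>R/\<mm>\<^sup>4\<close>. Hence the index is 5.

  For a parameter \<open>t = t\<^sub>1 x + t\<^sub>2 y + t\<^sub>3 z\<close> the element
  \<open>\<Delta> = t\<^sub>1 y\<^sup>4 z\<^sup>4 + t\<^sub>2 x z\<^sup>4 + t\<^sub>3 (x z\<^sup>3 + y\<^sup>6)\<close> satisfies \<open>z \<Delta> = t (x z\<^sup>3 + y\<^sup>6)\<close>, which forces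
  \<open>\<Delta> \<notin> t R\<close>, whereas \<open>\<mm>\<^sup>5 \<subseteq> t R\<close> would give \<open>\<Delta> \<in> t R\<close>. Since \<open>\<mm>\<^sup>6 \<subseteq> (y - z) R\<close>, the
  generalized Loewy length is 6.
\<close>

section \<open>A ring with a finite basis over a discrete valuation ring\<close>

text \<open>Modulo \<open>z\<close> the relations become \<open>x^2 = y^5\<close> and
  \<open>x y^2 = 0\<close>; the nine basis elements are the monomials that survive there, and
  \<open>y^6\<close> spans the socle of \<open>R/zR\<close>, which is why it serves as the test
  element for free summands. The threshold between 4 and 5 is due to one monomial:
  \<open>x y z^2\<close> lies outside \<open>\<mm>^5\<close>, although \<open>z\<close> times it
  equals \<open>x z^5 - y^7\<close>, which lies in \<open>\<mm>^6\<close>. The lifting obstruction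
  and the map from \<open>(z, y^6)\<close> both meet exactly this element.

  The obstacle is that elements of \<open>R\<close> are classes of fractions, so neither spanning
  nor independence of the basis can be read off polynomials. Spanning needs the
  \<open>V\<close>-span of the monomials to be closed under inverses, which comes from Nakayama's
  lemma; independence is tested after the substitution \<open>x = w^5\<close>,
  \<open>y = w^2\<close>. From then on everything is linear algebra over \<open>V\<close>: dimension
  and depth are bounded through a relation \<open>a^j (z^n + a w) = 0\<close> satisfied by every
  element \<open>a\<close>, and linear maps to \<open>R\<close> are produced from functionals with
  values in \<open>V\<close>.\<close>

lemma radical_add:
  fixes S J :: "'f::comm_ring_1 set"
  assumes S1: "1 \<in> S" and Sadd: "\<And>s t. s \<in> S \<Longrightarrow> t \<in> S \<Longrightarrow> s + t \<in> S"
    and S0: "0 \<in> S"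
    and Smult: "\<And>s t. s \<in> S \<Longrightarrow> t \<in> S \<Longrightarrow> s * t \<in> S"
    and J0: "0 \<in> J" and Jadd: "\<And>s t. s \<in> J \<Longrightarrow> t \<in> J \<Longrightarrow> s + t \<in> J"
    and Jmult: "\<And>s t. s \<in> S \<Longrightarrow> t \<in> J \<Longrightarrow> s * t \<in> J"
    and ab: "a \<in> S" "b \<in> S" "a ^ m \<in> J" "b ^ n \<in> J"
  shows "(a + b) ^ (m + n) \<in> J"
proof -
  have pow: "s ^ k \<in> S" if "s \<in> S" for s k
    using that by (induction k) (auto intro: S1 Smult)
  have nat: "of_nat k \<in> S" for k
    by (induction k) (auto intro: S0 S1 Sadd)
  have summand: "of_nat ((m + n) choose k) * a ^ k * b ^ (m + n - k) \<in> J" if "k \<le> m + n" for k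
  proof (cases "k \<ge> m")
    case True
    have "of_nat ((m + n) choose k) * a ^ k * b ^ (m + n - k)
        = (of_nat ((m + n) choose k) * a ^ (k - m) * b ^ (m + n - k)) * a ^ m"
      using True power_add[of a "k - m" m] by (simp add: mult_ac)
    then show ?thesis using Jmult Smult pow nat ab by metis
  next
    case False
    then have "m + n - k = (m - k) + n" by simp
    then have "of_nat ((m + n) choose k) * a ^ k * b ^ (m + n - k)
        = (of_nat ((m + n) choose k) * a ^ k * b ^ (m - k)) * b ^ n"
      by (simp add: mult_ac power_add)
    then show ?thesis using Jmult Smult pow nat ab by metis
  qed
  have "(\<Sum>k\<in>A. of_nat ((m + n) choose k) * a ^ k * b ^ (m + n - k)) \<in> J" if "A \<subseteq> {..m + n}" for A
    using finite_subset[OF that finite_atMost] that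
    by (induction A rule: finite_induct) (auto intro!: J0 Jadd summand)
  then show ?thesis by (simp add: binomial_ring)
qed

text \<open>Fraction-free elimination: a vector with nonzero last entry clears that entry in the
  others by cross multiplication, so no division leaves \<open>V\<close>. Absence of zero divisors
  keeps the relation nontrivial.\<close>

lemma linear_dependence:
  fixes V :: "'f::idom set"
  assumes V0: "0 \<in> V" and V1: "1 \<in> V" and Vadd: "\<And>s t. s \<in> V \<Longrightarrow> t \<in> V \<Longrightarrow> s + t \<in> V"
    and Vmult: "\<And>s t. s \<in> V \<Longrightarrow> t \<in> V \<Longrightarrow> s * t \<in> V"
    and Vminus: "\<And>s. s \<in> V \<Longrightarrow> - s \<in> V"
  assumes "finite J" "card J > n" "\<And>j i. j \<in> J \<Longrightarrow> i < n \<Longrightarrow> v j i \<in> V"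
  shows "\<exists>d. (\<forall>j\<in>J. d j \<in> V) \<and> (\<exists>j\<in>J. d j \<noteq> 0) \<and> (\<forall>i<n. (\<Sum>j\<in>J. d j * v j i) = 0)"
  using assms(6-8)
proof (induction n arbitrary: J v)
  case 0
  then obtain j where "j \<in> J" by fastforce
  then show ?case by (intro exI[of _ "\<lambda>_. 1"]) (use V1 in auto)
next
  case (Suc n)
  have sumV: "(\<Sum>j\<in>A. h j) \<in> V" if "\<And>j. j \<in> A \<Longrightarrow> h j \<in> V" for A and h :: "'b \<Rightarrow> 'f"
    using that by (induction A rule: infinite_finite_induct) (auto intro: V0 Vadd)
  show ?case
  proof (cases "\<exists>p\<in>J. v p n \<noteq> 0")
    case False
    have "finite J" "n < card J" "\<And>j i. j \<in> J \<Longrightarrow> i < n \<Longrightarrow> v j i \<in> V"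
      using Suc.prems by auto
    from Suc.IH[of J v, OF this] obtain d where d: "\<forall>j\<in>J. d j \<in> V" "\<exists>j\<in>J. d j \<noteq> 0"
      "\<forall>i<n. (\<Sum>j\<in>J. d j * v j i) = 0" by blast
    then have "\<forall>i<Suc n. (\<Sum>j\<in>J. d j * v j i) = 0"
      using False by (auto simp: less_Suc_eq)
    with d show ?thesis by blast
  next
    case True
    then obtain p where p: "p \<in> J" "v p n \<noteq> 0" by blast
    define w where "w = (\<lambda>j i. v p n * v j i - v j n * v p i)"
    have wV: "w j i \<in> V" if "j \<in> J - {p}" "i < n" for j i
      unfolding w_def diff_conv_add_uminus using that p Suc.prems(3)
      by (intro Vadd Vminus Vmult) auto
    have "card (J - {p}) > n" using Suc.prems p by simp
    from Suc.IH[of "J - {p}" w, OF _ this wV] Suc.prems(1) obtain d where d: "\<forall>j\<in>J-{p}. d j \<in> V"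
      "\<exists>j\<in>J-{p}. d j \<noteq> 0" "\<forall>i<n. (\<Sum>j\<in>J-{p}. d j * w j i) = 0" by auto
    \<comment> \<open>Scaling by the pivot entry turns the relation among the \<open>w j\<close>
      into one among the \<open>v j\<close>; the pivot's own coefficient collects the subtracted
      multiples.\<close>
    define e where "e = (\<lambda>j. if j = p then - (\<Sum>j\<in>J-{p}. d j * v j n) else d j * v p n)"
    have "\<forall>j\<in>J. e j \<in> V"
      using d(1) p Suc.prems(3) unfolding e_def by (auto intro!: Vminus sumV Vmult)
    moreover have "\<exists>j\<in>J. e j \<noteq> 0" using d(2) p unfolding e_def by auto
    moreover have "(\<Sum>j\<in>J. e j * v j i) = 0" if "i < Suc n" for i
    proof -
      have "(\<Sum>j\<in>J. e j * v j i) = e p * v p i + (\<Sum>j\<in>J-{p}. e j * v j i)"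
        using p Suc.prems(1) by (simp add: sum.remove)
      also have "(\<Sum>j\<in>J-{p}. e j * v j i) = (\<Sum>j\<in>J-{p}. d j * v p n * v j i)"
        by (intro sum.cong) (auto simp: e_def)
      also have "e p * v p i + \<dots> = (\<Sum>j\<in>J-{p}. d j * w j i)"
        by (simp add: e_def w_def sum_distrib_right sum_distrib_left right_diff_distrib
            sum_subtractf mult_ac)
      also have "\<dots> = 0"
      proof (cases "i = n")
        case True then show ?thesis by (intro sum.neutral) (auto simp: w_def mult_ac)
      next
        case False with that d(3) show ?thesis by simp
      qed
      finally show ?thesis .
    qed
    ultimately show ?thesis by blast
  qed
qed

lemma cring_of_subset:
  fixes S :: "'a::comm_ring_1 set"
  assumes "1 \<in> S" "\<And>s t. s \<in> S \<Longrightarrow> t \<in> S \<Longrightarrow> s + t \<in> S" "\<And>s t. s \<in> S \<Longrightarrow> t \<in> S \<Longrightarrow> s * t \<in> S"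
    "\<And>s. s \<in> S \<Longrightarrow> - s \<in> S"
  shows "cring \<lparr>carrier = S, monoid.mult = (*), one = 1, ring.zero = 0, add = (+)\<rparr>" (is "cring ?R")
proof (rule cringI)
  have 0: "0 \<in> S" using assms(2)[OF assms(1) assms(4)[OF assms(1)]] by simp
  show "abelian_group ?R"
  proof (rule abelian_groupI)
    fix s assume "s \<in> carrier ?R"
    then show "\<exists>t\<in>carrier ?R. t \<oplus>\<^bsub>?R\<^esub> s = \<zero>\<^bsub>?R\<^esub>" using assms(4) by (intro bexI[of _ "- s"]) auto
  qed (use assms 0 in \<open>auto simp: algebra_simps\<close>)
  show "comm_monoid ?R" by (rule comm_monoidI) (use assms in \<open>auto simp: algebra_simps\<close>)
qed (simp add: algebra_simps)

section \<open>Multiplication tables for the nine monomials\<close>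

definition lin_comb :: "'f::comm_ring_1 \<Rightarrow> 'f \<Rightarrow> (nat \<Rightarrow> 'f) \<Rightarrow> 'f" where
  "lin_comb x y c = c 0 + c 1 * y + c 2 * y^2 + c 3 * y^3 + c 4 * y^4 + c 5 * y^5 + c 6 * y^6
     + c 7 * x + c 8 * (x * y)"

text \<open>Matrix of multiplication by \<open>y\<close>: the products that leave the basis are
  rewritten by \<open>x y^2 = z^5 - y z^3\<close> and \<open>y^7 = z^5 x - z^3 (x y)\<close>.
  Indices 7 and 8 stand for \<open>x\<close> and \<open>x y\<close>.\<close>

definition mult_y :: "'f::comm_ring_1 \<Rightarrow> (nat \<Rightarrow> 'f) \<Rightarrow> nat \<Rightarrow> 'f" where
  "mult_y z c = (\<lambda>_. 0)(0 := c 8 * z^5, 1 := c 0 - c 8 * z^3, 2 := c 1, 3 := c 2, 4 := c 3, 5 := c 4,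
     6 := c 5, 7 := c 6 * z^5, 8 := c 7 - c 6 * z^3)"

text \<open>Here \<open>x y^2 = z^5 - y z^3\<close> rewrites \<open>x y^2, ..., x y^6\<close>, and
  \<open>x^2 = y^5\<close> sends \<open>x\<close> and \<open>x y\<close> to \<open>y^5\<close> and
  \<open>y^6\<close>.\<close>

definition mult_x :: "'f::comm_ring_1 \<Rightarrow> (nat \<Rightarrow> 'f) \<Rightarrow> nat \<Rightarrow> 'f" where
  "mult_x z c = (\<lambda>_. 0)(0 := c 2 * z^5, 1 := c 3 * z^5 - c 2 * z^3, 2 := c 4 * z^5 - c 3 * z^3,
     3 := c 5 * z^5 - c 4 * z^3, 4 := c 6 * z^5 - c 5 * z^3, 5 := c 7 - c 6 * z^3, 6 := c 8,
     7 := c 0, 8 := c 1)"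

text \<open>The remainder is spelled out as a combination of relations, so the identity holds for
  arbitrary ring elements; its membership in the ideal is a separate, later step.\<close>

lemma lin_comb_mult_y: "y * lin_comb x y c = lin_comb x y (mult_y z c)
    + (c 6 * (y^7 - (z^5 * x - z^3 * (x * y))) + c 8 * (x * y^2 + y * z^3 - z^5))"
  by (simp add: lin_comb_def mult_y_def) (simp add: algebra_simps eval_nat_numeral)

lemma lin_comb_mult_x: "x * lin_comb x y c = lin_comb x y (mult_x z c)
    + ((c 7 + c 8 * y) * (x^2 - y^5)
      + (c 2 + c 3 * y + c 4 * y^2 + c 5 * y^3 + c 6 * y^4) * (x * y^2 + y * z^3 - z^5))"
  by (simp add: lin_comb_def mult_x_def) (simp add: algebra_simps eval_nat_numeral)

lemma lin_comb_add: "lin_comb x y (\<lambda>i. c i + d i) = lin_comb x y c + lin_comb x y d"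
  by (simp add: lin_comb_def algebra_simps)
lemma lin_comb_diff: "lin_comb x y (\<lambda>i. c i - d i) = lin_comb x y c - lin_comb x y d"
  by (simp add: lin_comb_def algebra_simps)
lemma lin_comb_scale: "lin_comb x y (\<lambda>i. v * c i) = v * lin_comb x y c"
  by (simp add: lin_comb_def algebra_simps)

text \<open>\<open>S\<close>, \<open>I\<close> and \<open>V\<close> are subsets of one field, so
  that calculations run in field arithmetic rather than in record structures. \<open>V_val\<close>
  makes \<open>V\<close> a discrete valuation ring with uniformizer \<open>z\<close>;
  \<open>local_S\<close> and \<open>proper_S\<close> make \<open>S\<close> local with maximal ideal
  \<open>(x, y, z)\<close>.\<close>

locale curve_base =
  fixes S I V :: "'f::field set" and x y z :: 'f
  assumes S_one [simp]: "1 \<in> S"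
    and S_add [simp]: "\<And>s t. s \<in> S \<Longrightarrow> t \<in> S \<Longrightarrow> s + t \<in> S"
    and S_mult [simp]: "\<And>s t. s \<in> S \<Longrightarrow> t \<in> S \<Longrightarrow> s * t \<in> S"
    and S_uminus [simp]: "\<And>s. s \<in> S \<Longrightarrow> - s \<in> S"
    and V_S: "V \<subseteq> S"
    and V_one [simp]: "1 \<in> V"
    and V_add [simp]: "\<And>s t. s \<in> V \<Longrightarrow> t \<in> V \<Longrightarrow> s + t \<in> V"
    and V_mult [simp]: "\<And>s t. s \<in> V \<Longrightarrow> t \<in> V \<Longrightarrow> s * t \<in> V"
    and V_uminus [simp]: "\<And>s. s \<in> V \<Longrightarrow> - s \<in> V"
    and xS [simp]: "x \<in> S" and yS [simp]: "y \<in> S" and zV [simp]: "z \<in> V"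
    and z_nonzero [simp]: "z \<noteq> 0"
    and I_eq: "I = {(x^2 - y^5) * a + (x * y^2 + y * z^3 - z^5) * b | a b. a \<in> S \<and> b \<in> S}"
    and V_val: "\<And>c. c \<in> V \<Longrightarrow> c \<noteq> 0 \<Longrightarrow> \<exists>n u. u \<in> V \<and> inverse u \<in> V \<and> u \<noteq> 0 \<and> c = z^n * u"
    and local_S: "\<And>s. s \<in> S \<Longrightarrow> (s \<noteq> 0 \<and> inverse s \<in> S) \<or> (\<exists>a\<in>S. \<exists>b\<in>S. \<exists>c\<in>S. s = x * a + y * b + z * c)"
    and proper_S: "\<And>a b c. a \<in> S \<Longrightarrow> b \<in> S \<Longrightarrow> c \<in> S \<Longrightarrow> x * a + y * b + z * c \<noteq> 1"
begin

lemma S_zero [simp]: "0 \<in> S" using S_add[OF S_one S_uminus[OF S_one]] by simp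
lemma V_zero [simp]: "0 \<in> V" using V_add[OF V_one V_uminus[OF V_one]] by simp
lemma S_diff [simp]: "s \<in> S \<Longrightarrow> t \<in> S \<Longrightarrow> s - t \<in> S"
  using S_add[OF _ S_uminus] by fastforce
lemma V_diff [simp]: "s \<in> V \<Longrightarrow> t \<in> V \<Longrightarrow> s - t \<in> V"
  using V_add[OF _ V_uminus] by fastforce
lemma S_power [simp]: "s \<in> S \<Longrightarrow> s ^ n \<in> S" by (induction n) auto
lemma V_power [simp]: "s \<in> V \<Longrightarrow> s ^ n \<in> V" by (induction n) auto
lemma VS [simp]: "c \<in> V \<Longrightarrow> c \<in> S" using V_S by blast
lemma zS: "z \<in> S" by simp
lemma S_sum: "(\<And>i. i \<in> A \<Longrightarrow> h i \<in> S) \<Longrightarrow> sum h A \<in> S"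
  by (induction A rule: infinite_finite_induct) auto

lemma II: "e = (x^2 - y^5) * a + (x * y^2 + y * z^3 - z^5) * b \<Longrightarrow> a \<in> S \<Longrightarrow> b \<in> S \<Longrightarrow> e \<in> I"
  unfolding I_eq by blast

lemma I_S: "e \<in> I \<Longrightarrow> e \<in> S"
  unfolding I_eq by auto
lemma I_zero [simp]: "0 \<in> I" by (rule II[of _ 0 0]) auto
lemma I_add [simp]: "e \<in> I \<Longrightarrow> e' \<in> I \<Longrightarrow> e + e' \<in> I"
proof -
  assume "e \<in> I" "e' \<in> I"
  then obtain a b a' b' where "e = (x^2 - y^5) * a + (x * y^2 + y * z^3 - z^5) * b"
    "e' = (x^2 - y^5) * a' + (x * y^2 + y * z^3 - z^5) * b'" "a \<in> S" "b \<in> S" "a' \<in> S" "b' \<in> S"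
    unfolding I_eq by blast
  then show ?thesis by clarify (rule II[of _ "a + a'" "b + b'"], simp_all add: algebra_simps)
qed
lemma I_mult: "e \<in> I \<Longrightarrow> s \<in> S \<Longrightarrow> s * e \<in> I"
proof -
  assume "e \<in> I" "s \<in> S"
  then obtain a b where "e = (x^2 - y^5) * a + (x * y^2 + y * z^3 - z^5) * b" "a \<in> S" "b \<in> S"
    unfolding I_eq by blast
  then show ?thesis using \<open>s \<in> S\<close> by clarify (rule II[of _ "s * a" "s * b"], simp_all add: algebra_simps)
qed
lemma I_mult2: "e \<in> I \<Longrightarrow> s \<in> S \<Longrightarrow> e * s \<in> I"
  using I_mult by (simp add: mult.commute)
lemma I_uminus [simp]: "e \<in> I \<Longrightarrow> - e \<in> I"
  using I_mult[of e "-1"] by simp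
lemma I_diff [simp]: "e \<in> I \<Longrightarrow> e' \<in> I \<Longrightarrow> e - e' \<in> I"
  using I_add[OF _ I_uminus] by fastforce

text \<open>Modulo the two generators \<open>y^7 = y^2 x^2 = x (x y^2)\<close>; the cofactors
  \<open>- (y^2)\<close> and \<open>x\<close> record these two substitutions.\<close>

lemma y7: "y^7 - (z^5 * x - z^3 * (x * y)) \<in> I"
  by (rule II[of _ "- (y^2)" x]) (auto simp: algebra_simps eval_nat_numeral)

lemma relation_I: "x^2 - y^5 \<in> I" "x * y^2 + y * z^3 - z^5 \<in> I"
  by (rule II[of _ 1 0]; simp) (rule II[of _ 0 1]; simp)

lemma mult_y_V: "(\<And>i. c i \<in> V) \<Longrightarrow> mult_y z c j \<in> V"
  by (simp add: mult_y_def)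
lemma mult_x_V: "(\<And>i. c i \<in> V) \<Longrightarrow> mult_x z c j \<in> V"
  by (simp add: mult_x_def)

lemma mult_y_I: assumes "\<And>i. c i \<in> V" shows "y * lin_comb x y c - lin_comb x y (mult_y z c) \<in> I"
proof -
  have "c 6 * (y^7 - (z^5 * x - z^3 * (x * y))) + c 8 * (x * y^2 + y * z^3 - z^5) \<in> I"
    by (intro I_add I_mult y7 relation_I VS assms)
  then show ?thesis using lin_comb_mult_y[of y x c z] by simp
qed
lemma mult_x_I: assumes "\<And>i. c i \<in> V" shows "x * lin_comb x y c - lin_comb x y (mult_x z c) \<in> I"
proof -
  have "(c 7 + c 8 * y) * (x^2 - y^5)
      + (c 2 + c 3 * y + c 4 * y^2 + c 5 * y^3 + c 6 * y^4) * (x * y^2 + y * z^3 - z^5) \<in> I"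
    using assms by (intro I_add I_mult relation_I) simp_all
  then show ?thesis using lin_comb_mult_x[of x y c z] by simp
qed

lemma one_notin_I: "1 \<notin> I"
proof
  assume "1 \<in> I"
  then obtain a b where "1 = (x^2 - y^5) * a + (x * y^2 + y * z^3 - z^5) * b" "a \<in> S" "b \<in> S"
    unfolding I_eq by blast
  then have "x * (x * a + y^2 * b) + y * (- (y^4) * a + z^3 * b) + z * (- (z^4) * b) = 1"
    by (simp add: algebra_simps eval_nat_numeral)
  then show False using proper_S \<open>a \<in> S\<close> \<open>b \<in> S\<close> by (metis S_add S_mult S_power S_uminus xS yS zS)
qed

text \<open>Below, \<open>nn\<close> is the maximal ideal of \<open>S\<close>, and \<open>Pw n\<close> the preimage in \<open>S\<close> of the \<open>n\<close>-th power of that of \<open>S / I\<close>.\<close>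
definition nn :: "'f set" where "nn = {x * a + y * b + z * c | a b c. a \<in> S \<and> b \<in> S \<and> c \<in> S}"

lemma nnI: "s = x * a + y * b + z * c \<Longrightarrow> a \<in> S \<Longrightarrow> b \<in> S \<Longrightarrow> c \<in> S \<Longrightarrow> s \<in> nn"
  unfolding nn_def by blast
lemma nnE: assumes "s \<in> nn" obtains a b c where "s = x * a + y * b + z * c" "a \<in> S" "b \<in> S" "c \<in> S"
  using assms unfolding nn_def by blast
lemma nn_S: "s \<in> nn \<Longrightarrow> s \<in> S" unfolding nn_def by auto
lemma xyz_nn [simp]: "x \<in> nn" "y \<in> nn" "z \<in> nn"
  using nnI[of x 1 0 0] nnI[of y 0 1 0] nnI[of z 0 0 1] by simp_all
lemma nn_add [simp]: "s \<in> nn \<Longrightarrow> t \<in> nn \<Longrightarrow> s + t \<in> nn"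
proof (elim nnE)
  fix a b c a' b' c' assume "s = x * a + y * b + z * c" "t = x * a' + y * b' + z * c'" 
    and "a \<in> S" "b \<in> S" "c \<in> S" "a' \<in> S" "b' \<in> S" "c' \<in> S"
  then show "s + t \<in> nn" by clarify (rule nnI[of _ "a + a'" "b + b'" "c + c'"], simp_all add: algebra_simps)
qed
lemma nn_mult: "s \<in> nn \<Longrightarrow> t \<in> S \<Longrightarrow> t * s \<in> nn"
proof (elim nnE)
  fix a b c assume "s = x * a + y * b + z * c" "a \<in> S" "b \<in> S" "c \<in> S" "t \<in> S"
  then show "t * s \<in> nn" by clarify (rule nnI[of _ "t * a" "t * b" "t * c"], simp_all add: algebra_simps)
qed
lemma nn_mult2: "s \<in> nn \<Longrightarrow> t \<in> S \<Longrightarrow> s * t \<in> nn"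
  using nn_mult by (simp add: mult.commute)
lemma nn_uminus [simp]: "s \<in> nn \<Longrightarrow> - s \<in> nn" using nn_mult[of s "-1"] by simp
lemma one_nn: "1 \<notin> nn" using proper_S by (auto elim!: nnE)
lemma unitI: "s \<in> S \<Longrightarrow> s \<notin> nn \<Longrightarrow> s \<noteq> 0 \<and> inverse s \<in> S"
  using local_S[of s] nnI by blast
lemma I_nn: "e \<in> I \<Longrightarrow> e \<in> nn"
proof -
  assume "e \<in> I"
  then obtain a b where "e = (x^2 - y^5) * a + (x * y^2 + y * z^3 - z^5) * b" "a \<in> S" "b \<in> S"
    unfolding I_eq by blast
  then show ?thesis
    by clarify (rule nnI[of _ "x * a + y^2 * b" "- (y^4) * a + z^3 * b" "- (z^4) * b"],
       simp_all add: algebra_simps eval_nat_numeral)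
qed

end

text \<open>\<open>span\<close> is assumed in a second locale because, for the concrete ring, it is
  derived from closure properties proved inside \<open>curve_base\<close>.\<close>

locale curve = curve_base S I V x y z for S I V :: "'f::field set" and x y z :: 'f +
  assumes span: "\<And>s. s \<in> S \<Longrightarrow> \<exists>c. (\<forall>i. c i \<in> V) \<and> s - lin_comb x y c \<in> I"
    and indep: "\<And>c. (\<forall>i. c i \<in> V) \<Longrightarrow> lin_comb x y c \<in> I \<Longrightarrow> \<forall>i<9. c i = 0"
begin

section \<open>Powers of the maximal ideal, ideals above I, and coordinates\<close>

fun Pw :: "nat \<Rightarrow> 'f set" where
  "Pw 0 = S"
| "Pw (Suc n) = {x * a + y * b + z * c + e | a b c e. a \<in> Pw n \<and> b \<in> Pw n \<and> c \<in> Pw n \<and> e \<in> I}"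

lemma PwI: "s = x * a + y * b + z * c + e \<Longrightarrow> a \<in> Pw n \<Longrightarrow> b \<in> Pw n \<Longrightarrow> c \<in> Pw n \<Longrightarrow> e \<in> I \<Longrightarrow> s \<in> Pw (Suc n)"
  by auto
lemma Pw_I: "e \<in> I \<Longrightarrow> e \<in> Pw n"
proof (induction n arbitrary: e)
  case (Suc n) then show ?case using Suc.IH[of 0] by (intro PwI[of _ 0 0 0 e]) auto
qed (auto simp: I_S)
lemma Pw_add: "s \<in> Pw n \<Longrightarrow> t \<in> Pw n \<Longrightarrow> s + t \<in> Pw n"
proof (induction n arbitrary: s t)
  case (Suc n)
  from Suc.prems obtain a b c e a' b' c' e' where "s = x * a + y * b + z * c + e" "t = x * a' + y * b' + z * c' + e'"
    "a \<in> Pw n" "b \<in> Pw n" "c \<in> Pw n" "e \<in> I" "a' \<in> Pw n" "b' \<in> Pw n" "c' \<in> Pw n" "e' \<in> I" by auto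
  then show ?case
    by clarify (rule PwI[of _ "a + a'" "b + b'" "c + c'" "e + e'"], simp_all add: algebra_simps Suc.IH)
qed auto
lemma Pw_mult: "s \<in> Pw n \<Longrightarrow> t \<in> S \<Longrightarrow> t * s \<in> Pw n"
proof (induction n arbitrary: s t)
  case (Suc n)
  from Suc.prems obtain a b c e where "s = x * a + y * b + z * c + e"
    "a \<in> Pw n" "b \<in> Pw n" "c \<in> Pw n" "e \<in> I" by auto
  then show ?case using Suc.prems(2)
    by clarify (rule PwI[of _ "t * a" "t * b" "t * c" "t * e"], simp add: algebra_simps, (simp add: Suc.IH I_mult)+)
qed auto
lemma Pw_uminus: "s \<in> Pw n \<Longrightarrow> - s \<in> Pw n" using Pw_mult[of s n "-1"] by simp
lemma Pw_diff: "s \<in> Pw n \<Longrightarrow> t \<in> Pw n \<Longrightarrow> s - t \<in> Pw n"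
  using Pw_add[OF _ Pw_uminus] by fastforce
lemma Pw_Suc: "Pw (Suc n) \<subseteq> Pw n"
proof
  fix s assume "s \<in> Pw (Suc n)"
  then obtain a b c e where s: "s = x * a + y * b + z * c + e" "a \<in> Pw n" "b \<in> Pw n" "c \<in> Pw n" "e \<in> I" by auto
  show "s \<in> Pw n" unfolding s(1) using s(2-5) by (simp add: Pw_add Pw_mult Pw_I)
qed
lemma Pw_antimono: "m \<le> n \<Longrightarrow> Pw n \<subseteq> Pw m"
  using lift_Suc_antimono_le[of Pw] Pw_Suc by blast
lemma Pw_S: "Pw n \<subseteq> S" using Pw_antimono[of 0 n] by simp
lemma Pw_step: assumes "s \<in> Pw n" shows "x * s \<in> Pw (Suc n)" "y * s \<in> Pw (Suc n)" "z * s \<in> Pw (Suc n)"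
  using assms Pw_I[OF I_zero, of n] PwI[of _ s 0 0 0 n] PwI[of _ 0 s 0 0 n] PwI[of _ 0 0 s 0 n]
  by (simp_all del: Pw.simps)
lemma Pw_nn: assumes "s \<in> Pw n" "t \<in> nn" shows "s * t \<in> Pw (Suc n)"
proof -
  from assms(2) obtain a b c where "t = x * a + y * b + z * c" "a \<in> S" "b \<in> S" "c \<in> S" by (elim nnE)
  then show ?thesis using assms(1)
    by clarify (rule PwI[of _ "a * s" "b * s" "c * s" 0], simp add: algebra_simps, (simp add: Pw_mult)+)
qed
lemma Pw_monom: assumes "n \<le> i + j + l" shows "x^i * y^j * z^l \<in> Pw n"
proof -
  have z: "z^l \<in> Pw l" by (induction l) (auto intro: Pw_step simp del: Pw.simps(2))
  have y: "y^j * z^l \<in> Pw (j + l)"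
    by (induction j) (use z Pw_step in \<open>auto simp: mult.assoc simp del: Pw.simps(2)\<close>)
  have "x^i * (y^j * z^l) \<in> Pw (i + (j + l))"
    by (induction i) (use y Pw_step in \<open>auto simp: mult.assoc simp del: Pw.simps(2)\<close>)
  then show ?thesis using Pw_antimono[OF assms] by (auto simp: mult.assoc add.assoc)
qed
lemma Pw_monom': assumes "s = x^i * y^j * z^l * t" "t \<in> S" "n \<le> i + j + l" shows "s \<in> Pw n"
  using Pw_mult[OF Pw_monom[OF assms(3)] assms(2)] assms(1) by (simp add: mult.commute)
text \<open>Upper bounds for the powers are obtained by guessing a filtration \<open>Q\<close> that
  absorbs multiplication by the three generators. The bound \<open>N\<close> restricts that check to
  the degrees of interest.\<close>

lemma Pw_least:
  assumes "S \<subseteq> Q 0" "\<And>n. I \<subseteq> Q n" "\<And>n s t. s \<in> Q n \<Longrightarrow> t \<in> Q n \<Longrightarrow> s + t \<in> Q n"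
    and "\<And>n s. n < N \<Longrightarrow> s \<in> Q n \<Longrightarrow> x * s \<in> Q (Suc n) \<and> y * s \<in> Q (Suc n) \<and> z * s \<in> Q (Suc n)"
  shows "n \<le> N \<Longrightarrow> Pw n \<subseteq> Q n"
proof (induction n)
  case (Suc n)
  then have IH: "Pw n \<subseteq> Q n" "n < N" by auto
  show ?case
  proof
    fix s assume "s \<in> Pw (Suc n)"
    then obtain a b c e where "s = x * a + y * b + z * c + e" "a \<in> Pw n" "b \<in> Pw n" "c \<in> Pw n" "e \<in> I" by auto
    moreover from this IH have "x * a \<in> Q (Suc n)" "y * b \<in> Q (Suc n)" "z * c \<in> Q (Suc n)" "e \<in> Q (Suc n)"
      using assms(2)[of "Suc n"] assms(4)[of n a] assms(4)[of n b] assms(4)[of n c] by auto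
    ultimately show "s \<in> Q (Suc n)" by (simp add: assms(3))
  qed
qed (use assms in auto)

text \<open>The ideals of \<open>S\<close> above \<open>I\<close>, in bijection with the ideals of
  the quotient; \<open>ideal_res\<close> and \<open>res_mem_iff\<close> carry them across.\<close>

definition sideal :: "'f set \<Rightarrow> bool" where
  "sideal A \<longleftrightarrow> A \<subseteq> S \<and> I \<subseteq> A \<and> (\<forall>s\<in>A. \<forall>t\<in>A. s + t \<in> A) \<and> (\<forall>s\<in>A. \<forall>t\<in>S. t * s \<in> A)"

lemma sidealI:
  "A \<subseteq> S \<Longrightarrow> I \<subseteq> A \<Longrightarrow> (\<And>s t. s \<in> A \<Longrightarrow> t \<in> A \<Longrightarrow> s + t \<in> A) \<Longrightarrow>
    (\<And>s t. s \<in> A \<Longrightarrow> t \<in> S \<Longrightarrow> t * s \<in> A) \<Longrightarrow> sideal A"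
  unfolding sideal_def by blast

lemma sidealD:
  assumes "sideal A"
  shows "s \<in> A \<Longrightarrow> s \<in> S" "s \<in> I \<Longrightarrow> s \<in> A" "s \<in> A \<Longrightarrow> t \<in> A \<Longrightarrow> s + t \<in> A"
    "s \<in> A \<Longrightarrow> t \<in> S \<Longrightarrow> t * s \<in> A"
  using assms unfolding sideal_def by blast+

lemma sideal_S: "sideal S" by (rule sidealI) (auto simp: I_S)
lemma sideal_nn: "sideal nn" by (rule sidealI) (auto simp: nn_S I_nn nn_mult)
lemma sideal_Pw: "sideal (Pw n)" by (rule sidealI) (use Pw_S Pw_I Pw_add Pw_mult in auto)

text \<open>A choice is made because only the values below 9 are determined, these being the ones
  that \<open>lin_comb\<close> reads; hence the bound \<open>i < 9\<close> in the rules that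
  follow.\<close>

definition coord :: "'f \<Rightarrow> nat \<Rightarrow> 'f" where
  "coord s = (SOME c. (\<forall>i. c i \<in> V) \<and> s - lin_comb x y c \<in> I)"

lemma coord: assumes "s \<in> S" shows "coord s i \<in> V" "s - lin_comb x y (coord s) \<in> I"
  using someI_ex[OF span[OF assms]] unfolding coord_def by auto

lemma coord_eqI:
  assumes "s \<in> S" "\<And>i. c i \<in> V" "s - lin_comb x y c \<in> I" "i < 9"
  shows "coord s i = c i"
proof -
  have "lin_comb x y (\<lambda>i. coord s i - c i) = (s - lin_comb x y c) - (s - lin_comb x y (coord s))"
    by (simp add: lin_comb_diff)
  also have "\<dots> \<in> I" by (rule I_diff[OF assms(3) coord(2)[OF assms(1)]])
  finally have diff: "lin_comb x y (\<lambda>i. coord s i - c i) \<in> I" .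
  have "\<forall>i<9. coord s i - c i = 0"
    by (rule indep[OF _ diff]) (intro allI V_diff coord(1)[OF assms(1)] assms(2))
  then show ?thesis using assms(4) by simp
qed

lemma coord_cong:
  assumes "s \<in> S" "t \<in> S" "s - t \<in> I" "i < 9" shows "coord s i = coord t i"
proof (rule coord_eqI)
  have "s - lin_comb x y (coord t) = (s - t) + (t - lin_comb x y (coord t))" by simp
  then show "s - lin_comb x y (coord t) \<in> I" using assms coord by (metis I_add)
qed (use assms coord in auto)

lemma coord_I: "s \<in> S \<Longrightarrow> s \<in> I \<longleftrightarrow> (\<forall>i<9. coord s i = 0)"
proof
  assume s: "s \<in> S" and "\<forall>i<9. coord s i = 0"
  then have "lin_comb x y (coord s) = 0" by (simp add: lin_comb_def)
  then show "s \<in> I" using coord(2)[OF s] by simp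
next
  assume "s \<in> S" "s \<in> I"
  then show "\<forall>i<9. coord s i = 0"
    using coord_eqI[of s "\<lambda>_. 0"] by (auto simp: lin_comb_def)
qed

lemma coord_add: assumes "s \<in> S" "t \<in> S" "i < 9" shows "coord (s + t) i = coord s i + coord t i"
proof (rule coord_eqI)
  have eq: "s + t - lin_comb x y (\<lambda>i. coord s i + coord t i)
     = (s - lin_comb x y (coord s)) + (t - lin_comb x y (coord t))"
    by (simp add: lin_comb_def algebra_simps)
  show "s + t - lin_comb x y (\<lambda>i. coord s i + coord t i) \<in> I"
    unfolding eq by (intro I_add coord assms)
qed (use assms coord in auto)

lemma coord_scale: assumes "s \<in> S" "v \<in> V" "i < 9" shows "coord (v * s) i = v * coord s i"
proof (rule coord_eqI)
  have "v * s - lin_comb x y (\<lambda>i. v * coord s i) = v * (s - lin_comb x y (coord s))"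
    by (simp add: lin_comb_def algebra_simps)
  then show "v * s - lin_comb x y (\<lambda>i. v * coord s i) \<in> I" using assms coord by (simp add: I_mult)
qed (use assms coord in auto)

lemma coord_diff: assumes "s \<in> S" "t \<in> S" "i < 9" shows "coord (s - t) i = coord s i - coord t i"
  using coord_add[of s "-1 * t" i] coord_scale[of t "-1" i] assms by simp

lemma coord_y: assumes "s \<in> S" "i < 9" shows "coord (y * s) i = mult_y z (coord s) i"
proof (rule coord_eqI)
  let ?c = "coord s"
  have eq: "y * s - lin_comb x y (mult_y z ?c) = y * (s - lin_comb x y ?c)
      + (y * lin_comb x y ?c - lin_comb x y (mult_y z ?c))" by (simp add: algebra_simps)
  show "y * s - lin_comb x y (mult_y z ?c) \<in> I" unfolding eq
    by (intro I_add I_mult coord(2) mult_y_I coord(1) assms yS)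
qed (use assms coord(1)[OF assms(1)] mult_y_V in auto)

lemma coord_x: assumes "s \<in> S" "i < 9" shows "coord (x * s) i = mult_x z (coord s) i"
proof (rule coord_eqI)
  let ?c = "coord s"
  have eq: "x * s - lin_comb x y (mult_x z ?c) = x * (s - lin_comb x y ?c)
      + (x * lin_comb x y ?c - lin_comb x y (mult_x z ?c))" by (simp add: algebra_simps)
  show "x * s - lin_comb x y (mult_x z ?c) \<in> I" unfolding eq
    by (intro I_add I_mult coord(2) mult_x_I coord(1) assms xS)
qed (use assms coord(1)[OF assms(1)] mult_x_V in auto)

lemma z_unit_V: "v \<in> V \<Longrightarrow> z * v \<noteq> 1"
  using proper_S[of 0 0 v] by simp

text \<open>Multiplication by \<open>z^n\<close> scales all nine coordinates by a nonzero field
  element: freeness over \<open>V\<close> gives torsion-freeness.\<close>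

lemma z_power_cancel: "s \<in> S \<Longrightarrow> z^n * s \<in> I \<Longrightarrow> s \<in> I"
  using coord_I[of "z^n * s"] coord_I[of s] coord_scale[of s "z^n"] by auto

lemma z_cancel: "s \<in> S \<Longrightarrow> z * s \<in> I \<Longrightarrow> s \<in> I"
  using z_power_cancel[of s 1] by simp

lemma y6_coord: "coord (y^6) i = (if i = 6 then 1 else 0)" if "i < 9"
  using that by (intro coord_eqI) (auto simp: lin_comb_def)

text \<open>The coordinate of \<open>z * s\<close> at \<open>y^6\<close> is a multiple of
  \<open>z\<close>, that of \<open>y^6\<close> is 1. The contradictions about free summands,
  parameters and the ideal \<open>(z, y^6)\<close> all end here.\<close>

lemma y6_not_zS: assumes "s \<in> S" shows "y^6 - z * s \<notin> I"
proof
  assume "y^6 - z * s \<in> I"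
  then have "coord (y^6) 6 = coord (z * s) 6" using assms by (intro coord_cong) auto
  then have "1 = z * coord s 6" using y6_coord[of 6] coord_scale[of s z 6] assms by simp
  then show False using z_unit_V coord(1)[OF assms] by metis
qed

end

section \<open>Spanning: the V-span of the monomials is closed under inverses\<close>

lemma lin_comb_sum:
  "lin_comb x y c = (\<Sum>i<9. c i * lin_comb x y (\<lambda>j. if j = i then 1 else 0))"
  by (simp add: lin_comb_def eval_nat_numeral lessThan_Suc add_ac)

context curve_base
begin

text \<open>The goal is \<open>M = S\<close> for the concrete ring: \<open>M\<close> contains
  \<open>V\<close>, \<open>x\<close>, \<open>y\<close>, is a ring by the multiplication tables, and
  contains the inverses of those of its elements that are units of \<open>S\<close>.\<close>

definition M :: "'f set" where "M = {lin_comb x y c + e | c e. (\<forall>i. c i \<in> V) \<and> e \<in> I}"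

lemma MI: "s = lin_comb x y c + e \<Longrightarrow> (\<And>i. c i \<in> V) \<Longrightarrow> e \<in> I \<Longrightarrow> s \<in> M"
  unfolding M_def by blast
lemma ME: assumes "s \<in> M" obtains c e where "s = lin_comb x y c + e" "\<And>i. c i \<in> V" "e \<in> I"
  using assms unfolding M_def by blast
lemma lin_comb_M: "(\<And>i. c i \<in> V) \<Longrightarrow> lin_comb x y c \<in> M" by (rule MI[of _ c 0]) auto
lemma lin_comb_S: "(\<And>i. c i \<in> V) \<Longrightarrow> lin_comb x y c \<in> S" by (simp add: lin_comb_def)
lemma M_S: "s \<in> M \<Longrightarrow> s \<in> S" using I_S lin_comb_S by (auto elim!: ME)
lemma M_I: "e \<in> I \<Longrightarrow> e \<in> M" by (rule MI[of _ "\<lambda>_. 0" e]) (auto simp: lin_comb_def)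
lemma M_add [simp]: assumes "s \<in> M" "t \<in> M" shows "s + t \<in> M"
proof -
  obtain c e where s: "s = lin_comb x y c + e" "\<And>i. c i \<in> V" "e \<in> I" using assms(1) by (rule ME) blast
  obtain d e' where t: "t = lin_comb x y d + e'" "\<And>i. d i \<in> V" "e' \<in> I" using assms(2) by (rule ME) blast
  show ?thesis
    by (rule MI[of _ "\<lambda>i. c i + d i" "e + e'"]) (use s(2,3) t(2,3) in \<open>auto simp: s(1) t(1) lin_comb_add\<close>)
qed
lemma M_scale: assumes "s \<in> M" "v \<in> V" shows "v * s \<in> M"
proof -
  obtain c e where s: "s = lin_comb x y c + e" "\<And>i. c i \<in> V" "e \<in> I" using assms(1) by (rule ME) blast
  show ?thesis
    by (rule MI[of _ "\<lambda>i. v * c i" "v * e"])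
       (use s(2,3) assms(2) in \<open>auto simp: s(1) lin_comb_scale distrib_left I_mult\<close>)
qed
lemma M_V [simp]: "v \<in> V \<Longrightarrow> v \<in> M"
  by (rule MI[of _ "(\<lambda>_. 0)(0 := v)" 0]) (auto simp: lin_comb_def)
lemma M_y: assumes "s \<in> M" shows "y * s \<in> M"
proof -
  obtain c e where s: "s = lin_comb x y c + e" "\<And>i. c i \<in> V" "e \<in> I" using assms(1) by (rule ME) blast
  have eq: "y * s = lin_comb x y (mult_y z c) + ((y * lin_comb x y c - lin_comb x y (mult_y z c)) + y * e)"
    by (simp add: s(1) algebra_simps)
  show ?thesis using s(2,3) by (intro MI[OF eq] mult_y_V I_add mult_y_I I_mult) simp_all
qed
lemma M_x: assumes "s \<in> M" shows "x * s \<in> M"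
proof -
  obtain c e where s: "s = lin_comb x y c + e" "\<And>i. c i \<in> V" "e \<in> I" using assms(1) by (rule ME) blast
  have eq: "x * s = lin_comb x y (mult_x z c) + ((x * lin_comb x y c - lin_comb x y (mult_x z c)) + x * e)"
    by (simp add: s(1) algebra_simps)
  show ?thesis using s(2,3) by (intro MI[OF eq] mult_x_V I_add mult_x_I I_mult) simp_all
qed
lemma M_yn: "s \<in> M \<Longrightarrow> y ^ n * s \<in> M"
  by (induction n) (use M_y in \<open>simp_all add: mult.assoc\<close>)
lemma M_xy [simp]: "x \<in> M" "y \<in> M" using M_x[of 1] M_y[of 1] by simp_all
lemma M_mult [simp]: assumes "s \<in> M" "t \<in> M" shows "s * t \<in> M"
proof -
  obtain c e where s: "s = lin_comb x y c + e" "\<And>i. c i \<in> V" "e \<in> I" using assms(1) by (rule ME) blast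
  have eq: "s * t = c 0 * t + c 1 * (y * t) + c 2 * (y^2 * t) + c 3 * (y^3 * t) + c 4 * (y^4 * t) + c 5 * (y^5 * t)
      + c 6 * (y^6 * t) + c 7 * (x * t) + c 8 * (x * (y * t)) + t * e"
    by (simp add: s(1) lin_comb_def algebra_simps)
  show ?thesis unfolding eq
    by (intro M_add M_scale s(2) M_yn M_y M_x assms(2) M_I[OF I_mult[OF s(3) M_S[OF assms(2)]]])
qed
lemma M_power [simp]: "s \<in> M \<Longrightarrow> s ^ n \<in> M" by (induction n) auto
lemma M_uminus [simp]: "s \<in> M \<Longrightarrow> - s \<in> M" using M_scale[of s "-1"] by simp
lemma M_sum: "(\<And>i. i \<in> A \<Longrightarrow> h i \<in> M) \<Longrightarrow> sum h A \<in> M"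
  by (induction A rule: infinite_finite_induct) auto

text \<open>In the quotient of \<open>M\<close> by \<open>z M + I\<close> both \<open>x\<close> and
  \<open>y\<close> are nilpotent, because \<open>y^7\<close> is there a multiple of \<open>z\<close>
  and \<open>x^4\<close> equals \<open>y^10\<close>. The coefficients are taken in \<open>M\<close>
  since its equality with \<open>S\<close> is not yet available.\<close>

lemma M_nilpotent_mod_z: assumes "p \<in> M" "q \<in> M" "r \<in> M" "e \<in> I"
  shows "\<exists>n w. w \<in> M \<and> (x * p + y * q + z * r + e) ^ n - z * w \<in> I"
proof -
  define J where "J = {z * w + e | w e. w \<in> M \<and> e \<in> I}"
  have JI: "z * w + e \<in> J" if "w \<in> M" "e \<in> I" for w e using that unfolding J_def by blast
  have Jadd: "u + v \<in> J" if "u \<in> J" "v \<in> J" for u v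
  proof -
    from that obtain w e w' e' where "u = z * w + e" "v = z * w' + e'" "w \<in> M" "e \<in> I" "w' \<in> M" "e' \<in> I"
      unfolding J_def by blast
    then show ?thesis using JI[of "w + w'" "e + e'"] by (simp add: algebra_simps)
  qed
  have Jmult: "a * u \<in> J" if "a \<in> M" "u \<in> J" for a u
  proof -
    from that obtain w e where "u = z * w + e" "w \<in> M" "e \<in> I" unfolding J_def by blast
    then show ?thesis using JI[of "a * w" "a * e"] that(1) I_mult[OF _ M_S[OF that(1)], of e]
      by (simp add: algebra_simps)
  qed
  have J0: "e \<in> J" if "e \<in> I" for e using JI[of 0 e] that by simp
  have rad_add: "\<exists>n. (a + b) ^ n \<in> J" if "\<exists>n. a ^ n \<in> J" "\<exists>n. b ^ n \<in> J" "a \<in> M" "b \<in> M" for a b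
  proof -
    from that obtain m n where "a ^ m \<in> J" "b ^ n \<in> J" by blast
    with that have "(a + b) ^ (m + n) \<in> J"
      by (intro radical_add[of M J a b m n]) (simp_all add: Jadd Jmult J0)
    then show ?thesis by blast
  qed
  have rad_mult: "\<exists>n. (a * b) ^ n \<in> J" if "a ^ n \<in> J" "b \<in> M" for a b n
  proof -
    from that have "(a * b) ^ n \<in> J" using Jmult[of "b ^ n" "a ^ n"] by (simp add: power_mult_distrib mult.commute)
    then show ?thesis by blast
  qed
  have "y ^ 7 = z * (z^4 * x - z^2 * (x * y)) + (y^7 - (z^5 * x - z^3 * (x * y)))"
    by (simp add: algebra_simps eval_nat_numeral)
  also have "\<dots> \<in> J" using M_add[OF _ M_uminus, of "z^4 * x" "z^2 * (x * y)"] by (intro JI y7) simp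
  finally have y7: "y ^ 7 \<in> J" .
  have "x ^ 4 = (x^2 + y^5) * (x^2 - y^5) + y^3 * y^7" by (simp add: algebra_simps eval_nat_numeral)
  also have "\<dots> \<in> J" by (intro Jadd Jmult y7 J0[OF relation_I(1)]) simp_all
  finally have x4: "x ^ 4 \<in> J" .
  have z1: "z ^ 1 \<in> J" using JI[of 1 0] by simp
  have "\<exists>n. e ^ n \<in> J" using J0[OF assms(4)] by (intro exI[of _ 1]) simp
  then have "\<exists>n. (x * p + y * q + z * r + e) ^ n \<in> J"
    using rad_mult[OF x4] rad_mult[OF y7] rad_mult[OF z1] assms M_I by (intro rad_add) simp_all
  then obtain n w e' where "w \<in> M" "e' \<in> I" "(x * p + y * q + z * r + e) ^ n = z * w + e'"
    unfolding J_def by blast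
  then show ?thesis by (metis add_diff_cancel_left')
qed

text \<open>Generators are eliminated one at a time: the coefficient \<open>1 - z c\<close> of
  \<open>g p\<close> is a unit of \<open>V\<close>, so \<open>g p\<close> can be expressed modulo
  \<open>N\<close> by the other generators, still with a factor \<open>z\<close>.\<close>

lemma nakayama:
  assumes N0: "0 \<in> N" and Nadd: "\<And>s t. s \<in> N \<Longrightarrow> t \<in> N \<Longrightarrow> s + t \<in> N"
    and Nscale: "\<And>v s. v \<in> V \<Longrightarrow> s \<in> N \<Longrightarrow> v * s \<in> N"
    and "finite J" "\<And>j. j \<in> J \<Longrightarrow> \<exists>c. (\<forall>i. c i \<in> V) \<and> g j - z * (\<Sum>i\<in>J. c i * g i) \<in> N"
  shows "\<forall>j\<in>J. g j \<in> N"
  using assms(4,5)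
proof (induction J rule: finite_induct)
  case (insert p J)
  from insert.prems[of p] obtain c where c: "\<And>i. c i \<in> V" "g p - z * (\<Sum>i\<in>insert p J. c i * g i) \<in> N" by auto
  define u where "u = 1 - z * c p"
  have uV: "u \<in> V" unfolding u_def using c by simp
  have u0: "u \<noteq> 0" using proper_S[of 0 0 "c p"] c unfolding u_def by auto
  obtain n u' where u': "u' \<in> V" "inverse u' \<in> V" "u' \<noteq> 0" "u = z ^ n * u'" using V_val[OF uV u0] by blast
  have "n = 0"
  proof (rule ccontr)
    assume "n \<noteq> 0"
    then obtain m where "n = Suc m" by (cases n) auto
    with u' have "z * (c p + z ^ m * u') = 1" by (simp add: u_def algebra_simps)
    then show False using proper_S[of 0 0 "c p + z ^ m * u'"] c u' by simp
  qed
  with u' have iu: "inverse u \<in> V" by simp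
  have "inverse u * (g p - z * (\<Sum>i\<in>insert p J. c i * g i)) \<in> N" using Nscale[OF iu c(2)] .
  also have "inverse u * (g p - z * (\<Sum>i\<in>insert p J. c i * g i))
     = inverse u * (u * g p) - z * (\<Sum>i\<in>J. inverse u * c i * g i)"
    using insert.hyps by (simp add: u_def algebra_simps sum_distrib_left)
  finally have p: "g p - z * (\<Sum>i\<in>J. inverse u * c i * g i) \<in> N" using u0 by (simp add: mult.assoc[symmetric])
  have gN: "\<forall>j\<in>J. g j \<in> N"
  proof (rule insert.IH)
    fix j assume "j \<in> J"
    with insert.prems[of j] obtain d where d: "\<And>i. d i \<in> V" "g j - z * (\<Sum>i\<in>insert p J. d i * g i) \<in> N" by auto
    \<comment> \<open>Adding \<open>z * d p\<close> times the relation for \<open>g p\<close>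
      removes \<open>g p\<close> from the relation for \<open>g j\<close>.\<close>
    have "(g j - z * (\<Sum>i\<in>insert p J. d i * g i)) + (z * d p) * (g p - z * (\<Sum>i\<in>J. inverse u * c i * g i)) \<in> N"
      by (intro Nadd Nscale p d) (use d in simp)
    also have "(g j - z * (\<Sum>i\<in>insert p J. d i * g i)) + (z * d p) * (g p - z * (\<Sum>i\<in>J. inverse u * c i * g i))
      = g j - z * (\<Sum>i\<in>J. (d i + z * d p * inverse u * c i) * g i)"
      using insert.hyps by (simp add: algebra_simps sum_distrib_left sum.distrib)
    finally show "\<exists>c. (\<forall>i. c i \<in> V) \<and> g j - z * (\<Sum>i\<in>J. c i * g i) \<in> N"
      using c d iu by (intro exI[of _ "\<lambda>i. d i + z * d p * inverse u * c i"]) simp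
  qed
  have "(\<Sum>i\<in>A. inverse u * c i * g i) \<in> N" if "A \<subseteq> J" for A
    using finite_subset[OF that insert.hyps(1)] that
    by (induction A rule: finite_induct) (use c iu gN in \<open>auto intro!: N0 Nadd Nscale\<close>)
  then have "(g p - z * (\<Sum>i\<in>J. inverse u * c i * g i)) + z * (\<Sum>i\<in>J. inverse u * c i * g i) \<in> N"
    by (intro Nadd Nscale p) auto
  with gN show ?case by simp
qed simp

text \<open>The constant coefficient of \<open>b\<close> is a unit \<open>u\<close> of
  \<open>V\<close>, and \<open>inverse u * b = 1 - m\<close> with \<open>m\<close> nilpotent only
  modulo \<open>z\<close>. The geometric series therefore inverts \<open>1 - m\<close> up to a
  factor \<open>1 - z w\<close>, and Nakayama inverts that factor on the finite
  \<open>V\<close>-module \<open>M/I\<close>.\<close>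

lemma M_inverse: assumes "b \<in> M" "b \<noteq> 0" "inverse b \<in> S" shows "inverse b \<in> M"
proof -
  obtain c e where b: "b = lin_comb x y c + e" "\<And>i. c i \<in> V" "e \<in> I" using assms(1) by (rule ME) blast
  have bnn: "b \<notin> nn" using nn_mult[of b "inverse b"] assms one_nn by auto
  have beq: "b = c 0 + (y * (c 1 + c 2 * y + c 3 * y^2 + c 4 * y^3 + c 5 * y^4 + c 6 * y^5)
     + x * (c 7 + c 8 * y) + e)"
    by (simp add: b(1) lin_comb_def algebra_simps eval_nat_numeral)
  have tail: "y * (c 1 + c 2 * y + c 3 * y^2 + c 4 * y^3 + c 5 * y^4 + c 6 * y^5)
     + x * (c 7 + c 8 * y) + e \<in> nn"
    using b(2,3) by (intro nn_add nn_mult2 xyz_nn I_nn) simp_all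
  have c0: "c 0 \<notin> nn" using bnn tail nn_add beq by metis
  then have "c 0 \<noteq> 0" using nn_mult[of x 0] by auto
  then obtain n u where u: "u \<in> V" "inverse u \<in> V" "u \<noteq> 0" "c 0 = z ^ n * u" using V_val b(2) by blast
  have "n = 0"
  proof (rule ccontr)
    assume "n \<noteq> 0"
    then obtain m where "n = Suc m" by (cases n) auto
    then have "c 0 = z * (z ^ m * u)" using u by simp
    then show False using c0 nn_mult2[of z "z ^ m * u"] u by (simp add: mult.assoc)
  qed
  with u have cu: "c 0 = u" by simp
  define p where "p = - (inverse u * (c 7 + c 8 * y))"
  define q where "q = - (inverse u * (c 1 + c 2 * y + c 3 * y^2 + c 4 * y^3 + c 5 * y^4 + c 6 * y^5))"
  define e' where "e' = - (inverse u * e)"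
  define m where "m = x * p + y * q + z * 0 + e'"
  have pq: "p \<in> M" "q \<in> M" "e' \<in> I" unfolding p_def q_def e'_def using b u by (simp_all add: I_mult)
  then have mM: "m \<in> M" unfolding m_def using M_I by simp
  have "inverse u * b = inverse u * u - m" unfolding beq m_def p_def q_def e'_def cu by (simp add: algebra_simps)
  then have bu: "inverse u * b = 1 - m" using u by simp
  obtain n w where w: "w \<in> M" "m ^ n - z * w \<in> I" using M_nilpotent_mod_z[OF pq(1,2) _ pq(3), of 0] unfolding m_def by auto
  define g where "g = (\<Sum>i<n. m ^ i)"
  have gM: "g \<in> M" unfolding g_def using mM by (intro M_sum) simp
  have mg: "(1 - m) * g = 1 - m ^ n" unfolding g_def by (simp add: one_diff_power_eq)
  \<comment> \<open>Image of multiplication by \<open>1 - z * w\<close> on \<open>M/I\<close>;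
    showing that it contains the nine generators gives \<open>1\<close> a preimage
    \<open>v\<close>.\<close>
  define N where "N = {(1 - z * w) * v + e | v e. v \<in> M \<and> e \<in> I}"
  have NI: "(1 - z * w) * v + e \<in> N" if "v \<in> M" "e \<in> I" for v e using that unfolding N_def by blast
  have Nadd: "s + t \<in> N" if "s \<in> N" "t \<in> N" for s t
  proof -
    from that obtain v e v' e' where st: "s = (1 - z * w) * v + e" "t = (1 - z * w) * v' + e'"
      and ve: "v \<in> M" "e \<in> I" "v' \<in> M" "e' \<in> I"
      unfolding N_def by blast
    have "s + t = (1 - z * w) * (v + v') + (e + e')" unfolding st by (simp add: algebra_simps)
    then show ?thesis using NI[of "v + v'" "e + e'"] ve by simp
  qed
  have Nscale: "a * s \<in> N" if "a \<in> V" "s \<in> N" for a s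
  proof -
    from that obtain v e where s: "s = (1 - z * w) * v + e" "v \<in> M" "e \<in> I" unfolding N_def by blast
    have "a * s = (1 - z * w) * (a * v) + a * e" unfolding s(1) by (simp add: algebra_simps)
    then show ?thesis using NI[of "a * v" "a * e"] that(1) s by (simp add: I_mult M_scale)
  qed
  define B where "B i = lin_comb x y (\<lambda>j. if j = i then 1 else 0)" for i :: nat
  have BM: "B i \<in> M" for i unfolding B_def by (intro lin_comb_M) auto
  have "\<forall>j\<in>{..<9}. B j \<in> N"
  proof (rule nakayama)
    fix j :: nat assume "j \<in> {..<9}"
    obtain d f where d: "w * B j = lin_comb x y d + f" "\<And>i. d i \<in> V" "f \<in> I" using M_mult[OF w(1) BM[of j]] by (rule ME) blast
    have "B j - z * (\<Sum>i<9. d i * B i) = B j - z * lin_comb x y d"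
      unfolding B_def lin_comb_sum[of x y d] ..
    also have "\<dots> = (B j - z * (w * B j)) + z * f" unfolding d(1) by (simp add: algebra_simps)
    also have "\<dots> = (1 - z * w) * B j + z * f" by (simp add: algebra_simps)
    also have "\<dots> \<in> N" using BM d by (intro NI) (simp_all add: I_mult)
    finally show "\<exists>c. (\<forall>i. c i \<in> V) \<and> B j - z * (\<Sum>i<9. c i * B i) \<in> N" using d by blast
  qed (use NI[of 0 0] Nadd Nscale in auto)
  then have "B 0 \<in> N" by simp
  moreover have "B 0 = 1" unfolding B_def lin_comb_def by simp
  ultimately obtain v f where v: "v \<in> M" "f \<in> I" "1 = (1 - z * w) * v + f" unfolding N_def by auto
  have "b * (inverse u * g * v) = (inverse u * b) * g * v" by (simp add: mult_ac)
  also have "\<dots> = (1 - m ^ n) * v" by (simp add: bu mg)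
  also have "\<dots> = 1 - (f + (m ^ n - z * w) * v)" using v(3) by (simp add: algebra_simps)
  finally have inv: "b * (inverse u * g * v) = 1 - (f + (m ^ n - z * w) * v)" .
  have I': "f + (m ^ n - z * w) * v \<in> I" using v w M_S by (simp add: I_mult2)
  \<comment> \<open>The inverse found so far is one modulo \<open>I\<close>; since
    \<open>inverse b\<close> lies in \<open>S\<close>, the error times \<open>inverse b\<close>
    stays in \<open>I\<close>, hence in \<open>M\<close>.\<close>
  have "inverse b = inverse b * (b * (inverse u * g * v)) + inverse b * (f + (m ^ n - z * w) * v)"
    unfolding inv by (simp add: algebra_simps)
  also have "inverse b * (b * (inverse u * g * v)) = inverse u * g * v" using assms(2) by (simp add: mult.assoc[symmetric])
  finally have "inverse b = inverse u * g * v + inverse b * (f + (m ^ n - z * w) * v)" .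
  also have "\<dots> \<in> M" by (intro M_add M_mult[OF M_mult[OF M_V[OF u(2)] gM] v(1)] M_I I_mult I' assms(3))
  finally show ?thesis .
qed

end

section \<open>The parametrization \<open>x = w\<^sup>5, y = w\<^sup>2\<close>\<close>

definition rhom :: "('a::comm_ring_1 \<Rightarrow> 'b::comm_ring_1) \<Rightarrow> bool" where
  "rhom h \<longleftrightarrow> h 0 = 0 \<and> h 1 = 1 \<and> (\<forall>a b. h (a + b) = h a + h b) \<and> (\<forall>a b. h (a * b) = h a * h b)"

lemma rhomD: assumes "rhom h"
  shows "h 0 = 0" "h 1 = 1" "h (a + b) = h a + h b" "h (a * b) = h a * h b" "h (- a) = - h a"
    "h (a - b) = h a - h b" "h (a ^ n) = h a ^ n"
proof -
  show *: "h 0 = 0" "h 1 = 1" "h (a + b) = h a + h b" "h (a * b) = h a * h b" for a b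
    using assms unfolding rhom_def by auto
  show m: "h (- a) = - h a" for a using *(3)[of a "- a"] *(1) by (simp add: eq_neg_iff_add_eq_0 add.commute)
  show "h (a - b) = h a - h b" using *(3)[of a "- b"] m by simp
  show "h (a ^ n) = h a ^ n" by (induction n) (simp_all add: *)
qed

text \<open>The universal property of a polynomial ring: coefficients go along \<open>h\<close>, the
  variable goes to \<open>t\<close>. Three nested uses give the substitutions on
  \<open>k[x][y][z]\<close>.\<close>

definition ext :: "('a::comm_ring_1 \<Rightarrow> 'b::comm_ring_1) \<Rightarrow> 'b \<Rightarrow> 'a poly \<Rightarrow> 'b" where
  "ext h t p = poly (map_poly h p) t"

lemma ext_pCons: "rhom h \<Longrightarrow> ext h t (pCons a p) = h a + t * ext h t p"
  by (simp add: ext_def map_poly_pCons rhomD(1))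

lemma ext_0 [simp]: "ext h t 0 = 0" by (simp add: ext_def)

lemma rhom_ext: assumes h: "rhom h" shows "rhom (ext h t)"
proof -
  have add: "ext h t (p + q) = ext h t p + ext h t q" for p q
    by (induction p q rule: poly_induct2) (simp_all add: ext_pCons h rhomD(3)[OF h] algebra_simps)
  have smult: "ext h t (smult a p) = h a * ext h t p" for a p
    by (induction p) (simp_all add: ext_pCons h rhomD(4)[OF h] algebra_simps)
  have "ext h t (p * q) = ext h t p * ext h t q" for p q
    by (induction p) (simp_all add: ext_pCons[OF h] add smult rhomD(1)[OF h] algebra_simps)
  moreover have "ext h t 1 = 1" using ext_pCons[OF h, of t 1 0] rhomD(2)[OF h] by (simp flip: one_pCons)
  ultimately show ?thesis using add by (simp add: rhom_def)
qed

lemma ext_1: "rhom h \<Longrightarrow> ext h t 1 = 1" by (rule rhomD(2)[OF rhom_ext])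

lemma rhom_comp_ext: assumes "rhom h" "rhom g" shows "g (ext h t p) = ext (\<lambda>a. g (h a)) (g t) p"
proof -
  have "rhom (\<lambda>a. g (h a))" using assms by (simp add: rhom_def)
  then show ?thesis
    by (induction p) (simp_all add: ext_pCons assms(1) rhomD[OF assms(2)])
qed

text \<open>Presents coefficientwise application as a substitution, so that \<open>rhom_ext\<close>
  makes it a ring homomorphism.\<close>

lemma ext_map_poly: assumes "rhom h" shows "ext (\<lambda>q. [:h q:]) [:0, 1:] p = map_poly h p"
proof -
  have "rhom (\<lambda>q. [:h q:])" using assms by (simp add: rhom_def one_pCons)
  then show ?thesis by (induction p) (simp_all add: ext_pCons map_poly_pCons rhomD(1)[OF assms])
qed

lemma power_X_dvd_cancel:
  fixes a b :: "'a::idom poly"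
  assumes "[:0, 1:] ^ n dvd a * b" "poly a 0 \<noteq> 0" shows "[:0, 1:] ^ n dvd b"
proof (cases "b = 0")
  case False
  then have ab: "a * b \<noteq> 0" using assms(2) by auto
  have "n \<le> order 0 (a * b)" using assms(1) ab order_divides[of 0 n "a * b"] by simp
  also have "order 0 (a * b) = order 0 b" using order_mult[OF ab, of 0] order_0I[OF assms(2)] by simp
  finally show ?thesis using order_divides[of 0 n b] by simp
qed simp

abbreviation W :: "'k::field poly poly" where "W \<equiv> [:0, 1:]"
abbreviation Zc :: "'k::field poly poly" where "Zc \<equiv> [:[:0, 1:]:]"

definition branch_poly :: "'k::field poly poly" where "branch_poly = W ^ 9 + Zc ^ 3 * W ^ 2 - Zc ^ 5"

text \<open>
  Modulo \<open>z\<close> the divisor becomes \<open>w\<^sup>9\<close>, which is coprime to \<open>b\<close>; so \<open>p\<close> is divisible by every power of \<open>z\<close>.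
\<close>
lemma branch_poly_dvd:
  fixes p :: "'k::field poly poly"
  assumes "b * p = branch_poly * h" "degree p < 9" "poly (poly b 0) 0 \<noteq> 0"
  shows "p = 0"
proof -
  define red :: "'k poly poly \<Rightarrow> 'k poly" where "red = map_poly (\<lambda>q. poly q 0)"
  have ev: "rhom (\<lambda>q. poly q 0 :: 'k)" by (simp add: rhom_def)
  have "rhom (\<lambda>q. [:poly q 0:] :: 'k poly)" by (simp add: rhom_def one_pCons)
  from rhom_ext[OF this, of "[:0, 1:]"] have red: "rhom red" unfolding red_def ext_map_poly[OF ev, abs_def] .
  have redb: "poly (red q) 0 = poly (poly q 0) 0" for q
    by (simp add: red_def poly_0_coeff_0 coeff_map_poly)
  have redp: "red branch_poly = [:0, 1:] ^ 9"
  proof -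
    have "red W = [:0, 1:]" "red Zc = 0" by (simp_all add: red_def map_poly_pCons)
    then show ?thesis by (simp add: branch_poly_def rhomD[OF red])
  qed
  have red0: "red q = 0 \<longleftrightarrow> Zc dvd q" for q :: "'k poly poly"
    by (simp add: red_def const_poly_dvd_iff poly_eq_iff coeff_map_poly dvd_iff_poly_eq_0)
  have divisible: "\<forall>i. [:0, 1:] ^ n dvd coeff p i" if "b * p = branch_poly * h" "degree p < 9" for n p h
    using that
  proof (induction n arbitrary: p h)
    case (Suc n)
    from Suc.prems(1) have "red b * red p = [:0, 1:] ^ 9 * red h" by (metis redp rhomD(4)[OF red])
    then have "[:0, 1:] ^ 9 dvd red b * red p" by (metis dvd_triv_left)
    \<comment> \<open>\<open>red b\<close> has nonzero constant term, so all of \<open>w^9\<close>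
      must divide \<open>red p\<close>, whose degree is below 9.\<close>
    then have "[:0, 1:] ^ 9 dvd red p" by (rule power_X_dvd_cancel) (simp add: redb assms(3))
    moreover have "degree (red p) \<le> degree p"
      by (intro degree_le allI impI) (simp add: red_def coeff_map_poly coeff_eq_0)
    then have "degree (red p) < 9" using Suc.prems(2) by simp
    moreover have "degree ([:0, 1:] ^ 9 :: 'k poly) = 9" by (simp add: degree_power_eq)
    ultimately have rp: "red p = 0" using dvd_imp_degree_le by (metis not_le)
    then have "red b * 0 = [:0, 1:] ^ 9 * red h" using \<open>red b * red p = _\<close> by simp
    then have "red h = 0" by simp
    with rp obtain p' h' where ph: "p = Zc * p'" "h = Zc * h'" unfolding red0 by (auto elim!: dvdE)
    have "Zc * (b * p') = Zc * (branch_poly * h')" using Suc.prems(1) ph by (simp add: mult_ac)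
    then have "b * p' = branch_poly * h'" by (simp only: mult_cancel_left) simp
    moreover have "degree p' < 9" using Suc.prems(2) ph(1) by (simp add: degree_mult_eq split: if_splits)
    ultimately have "\<forall>i. [:0, 1:] ^ n dvd coeff p' i" using Suc.IH by blast
    then have "[:0, 1:] ^ Suc n dvd [:0, 1:] * coeff p' i" for i
      unfolding power_Suc by (intro mult_dvd_mono) auto
    moreover have "coeff p i = [:0, 1:] * coeff p' i" for i by (simp add: ph(1))
    ultimately show ?case by presburger
  qed simp
  have "coeff p i = 0" for i
  proof (rule ccontr)
    assume ne: "coeff p i \<noteq> 0"
    have "[:0, 1:] ^ Suc (degree (coeff p i)) dvd coeff p i" using divisible[OF assms(1,2)] by blast
    from dvd_imp_degree_le[OF this ne] show False by (simp add: degree_power_eq)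
  qed
  then show ?thesis by (simp add: poly_eq_iff)
qed

text \<open>Under \<open>x = w^5\<close>, \<open>y = w^2\<close> only \<open>y^5\<close> and
  \<open>y^6\<close> reach degree 9 or more, as \<open>w^10\<close> and \<open>w^12\<close>;
  subtracting multiples of the branch polynomial by \<open>w\<close> and \<open>w^3\<close> lowers
  them. The left side is in Horner form to match nested polynomial constructors.\<close>

lemma lin_comb_reduce:
  "p 0 + w * (z ^ 5 * p 5 + w * (p 1 + w * (z ^ 5 * p 6 - z ^ 3 * p 5
     + w * (p 2 + w * (p 7 - z ^ 3 * p 6 + w * (p 3 + w * (p 8 + w * p 4)))))))
   = lin_comb (w ^ 5) (w ^ 2) p - (w ^ 9 + z ^ 3 * w ^ 2 - z ^ 5) * (p 5 * w + p 6 * w ^ 3)"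
  for w :: "'a::comm_ring_1"
  by (simp add: lin_comb_def algebra_simps eval_nat_numeral)

definition ev0 :: "'k::field poly3 \<Rightarrow> 'k" where "ev0 = ext (ext (ext (\<lambda>c. c) 0) 0) 0"
text \<open>
  The substitution \<open>x = w\<^sup>5, y = w\<^sup>2\<close> parametrizes \<open>x\<^sup>2 = y\<^sup>5\<close>; it takes \<open>x y\<^sup>2 + y z\<^sup>3 - z\<^sup>5\<close> to \<open>branch_poly\<close>.
\<close>
definition psi :: "'k::field poly3 \<Rightarrow> 'k poly poly" where
  "psi = ext (ext (ext (\<lambda>c. [:[:c:]:]) (W ^ 5)) (W ^ 2)) Zc"
definition lift :: "'k::field poly \<Rightarrow> 'k poly3" where "lift = ext (\<lambda>c. [:[:[:c:]:]:]) var_z"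

lemma rhom_basic: "rhom (\<lambda>c::'k::field. c)" "rhom (\<lambda>c::'k. [:[:c:]:])" "rhom (\<lambda>c::'k. [:[:[:c:]:]:])"
  by (simp_all add: rhom_def one_pCons)
lemma rhom_ev0: "rhom ev0" unfolding ev0_def by (intro rhom_ext rhom_basic)
lemma rhom_psi: "rhom psi" unfolding psi_def by (intro rhom_ext rhom_basic)
lemma rhom_lift: "rhom lift" unfolding lift_def by (intro rhom_ext rhom_basic)
lemmas ev0_simps = rhomD[OF rhom_ev0]
lemmas psi_simps = rhomD[OF rhom_psi]
lemmas lift_simps = rhomD[OF rhom_lift]

lemma ev0_var [simp]: "ev0 var_x = 0" "ev0 var_y = 0" "ev0 var_z = 0"
  by (simp_all add: ev0_def var_x_def var_y_def var_z_def ext_pCons rhom_ext rhom_basic rhomD(2)[OF rhom_ext[OF rhom_basic(1)]])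
lemma psi_var: "psi var_x = W ^ 5" "psi var_y = W ^ 2" "psi var_z = Zc"
  by (simp_all add: psi_def var_x_def var_y_def var_z_def ext_pCons ext_1 rhom_ext rhom_basic flip: one_pCons)

lemma lift_var [simp]: "lift [:0, 1:] = var_z" 
  by (simp add: lift_def ext_pCons ext_1 rhom_basic flip: one_pCons)
lemma ev0_const: "ev0 [:[:[:c:]:]:] = c"
  by (simp add: ev0_def ext_pCons rhom_ext rhom_basic)
lemma psi_const: "psi [:[:[:c:]:]:] = [:[:c:]:]"
  by (simp add: psi_def ext_pCons rhom_ext rhom_basic)
lemma lift_const: "lift [:c:] = [:[:[:c:]:]:]"
  by (simp add: lift_def ext_pCons rhom_basic)
lemma lift_pCons: "lift (pCons c p) = [:[:[:c:]:]:] + var_z * lift p"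
  by (simp add: lift_def ext_pCons rhom_basic)
lemma ev0_lift: "ev0 (lift p) = poly p 0"
  by (induction p) (simp_all add: lift_pCons ev0_simps ev0_const lift_simps(1))
lemma psi_lift: "psi (lift p) = [:p:]"
  by (induction p) (simp_all add: lift_pCons psi_simps psi_const psi_var lift_simps(1))
lemma lift_eq_0: "lift p = 0 \<longleftrightarrow> p = 0"
proof
  assume "lift p = 0"
  then have "psi (lift p) = psi 0" by (simp only:)
  then show "p = 0" by (simp add: psi_lift psi_simps(1))
qed (simp add: lift_simps(1))

text \<open>The parametrization sends the origin to the origin, so a denominator that is a unit in
  the localization keeps a nonzero constant term.\<close>

lemma ev_psi:
  fixes a :: "'k::field poly3"
  shows "poly (poly (psi a) 0) 0 = ev0 a"
proof -
  let ?g = "\<lambda>q :: 'k poly poly. poly (poly q 0) 0"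
  have g: "rhom ?g" by (simp add: rhom_def)
  show ?thesis unfolding psi_def ev0_def
    by (subst rhom_comp_ext[OF _ g] | intro rhom_ext rhom_basic)+ simp
qed

lemma poly3_decomp:
  fixes a :: "'k::field poly3"
  obtains c a1 a2 a3 where "a = [:[:[:c:]:]:] + var_x * a1 + var_y * a2 + var_z * a3"
proof -
  obtain p q where a: "a = pCons p q" by (cases a) auto
  obtain r s where p: "p = pCons r s" by (cases p) auto
  obtain c t where r: "r = pCons c t" by (cases r) auto
  show ?thesis by (rule that[of c "[:[:t:]:]" "[:s:]" q]) (simp add: a p r var_x_def var_y_def var_z_def)
qed

text \<open>Identifies the maximal ideal as the kernel of evaluation at the origin, which turns the
  condition on denominators into nonvanishing of \<open>ev0\<close>.\<close>

lemma Idl_vars: "Idl\<^bsub>ring_of_type_algebra :: 'k::field poly3 ring\<^esub> {var_x, var_y, var_z} = {a. ev0 a = 0}"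
proof -
  let ?R = "ring_of_type_algebra :: 'k poly3 ring"
  interpret R: cring ?R by (rule cring_from_type_algebra)
  have simps: "carrier ?R = UNIV" "\<And>a b. a \<otimes>\<^bsub>?R\<^esub> b = a * b" "\<And>a b. a \<oplus>\<^bsub>?R\<^esub> b = a + b" "\<zero>\<^bsub>?R\<^esub> = 0"
    by (simp_all add: ring_of_type_algebra_def)
  have "ideal {a. ev0 a = 0} ?R"
  proof (rule idealI)
    show "subgroup {a :: 'k poly3. ev0 a = 0} (add_monoid ?R)"
    proof (rule R.add.subgroupI)
      fix a :: "'k poly3" assume "a \<in> {a. ev0 a = 0}"
      moreover have "\<ominus>\<^bsub>?R\<^esub> a = - a" by (rule R.minus_equality) (simp_all add: simps)
      ultimately show "\<ominus>\<^bsub>?R\<^esub> a \<in> {a. ev0 a = 0}" by (simp add: ev0_simps)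
    qed (auto simp: simps ev0_simps intro: exI[of _ 0])
  qed (auto simp: simps ev0_simps R.ring_axioms)
  then have "Idl\<^bsub>?R\<^esub> {var_x, var_y, var_z} \<subseteq> {a. ev0 a = 0}" by (intro R.genideal_minimal) auto
  moreover have "a \<in> Idl\<^bsub>?R\<^esub> {var_x, var_y, var_z}" if "ev0 a = 0" for a
  proof -
    interpret J: ideal "Idl\<^bsub>?R\<^esub> {var_x, var_y, var_z}" ?R by (intro R.genideal_ideal) (simp add: simps)
    have vars: "var_x \<in> Idl\<^bsub>?R\<^esub> {var_x, var_y, var_z}" "var_y \<in> Idl\<^bsub>?R\<^esub> {var_x, var_y, var_z}"
      "var_z \<in> Idl\<^bsub>?R\<^esub> {var_x, var_y, var_z}"
      using R.genideal_self[of "{var_x, var_y, var_z}"] by (auto simp: simps)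
    obtain c a1 a2 a3 where a: "a = [:[:[:c:]:]:] + var_x * a1 + var_y * a2 + var_z * a3"
      by (rule poly3_decomp)
    with that have "c = 0" by (simp only: ev0_simps ev0_const ev0_var mult_zero_left add_0_right)
    have m: "v * b \<in> Idl\<^bsub>?R\<^esub> {var_x, var_y, var_z}" if "v \<in> Idl\<^bsub>?R\<^esub> {var_x, var_y, var_z}" for v b
      using J.I_r_closed[OF that, of b] by (simp add: simps)
    have ad: "v + w \<in> Idl\<^bsub>?R\<^esub> {var_x, var_y, var_z}"
      if "v \<in> Idl\<^bsub>?R\<^esub> {var_x, var_y, var_z}" "w \<in> Idl\<^bsub>?R\<^esub> {var_x, var_y, var_z}" for v w
      using J.a_closed[OF that] by (simp add: simps)
    show ?thesis unfolding a \<open>c = 0\<close> by (simp add: m ad vars)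
  qed
  ultimately show ?thesis by blast
qed

section \<open>The concrete localization satisfies the axioms\<close>

definition T :: "'a::idom \<Rightarrow> 'a fract" where "T a = Fraction_Field.Fract a 1"

lemma T_arith: "T 0 = 0" "T 1 = 1" "T (a + b) = T a + T b" "T (a * b) = T a * T b" "T (- a) = - T a"
  "T (a - b) = T a - T b"
  by (simp_all add: T_def fract_collapse)
lemma T_power: "T (a ^ n) = T a ^ n" by (induction n) (simp_all add: T_arith)
lemmas T_simps = T_arith T_power
lemma T_inj: "T a = T b \<longleftrightarrow> a = b" by (simp add: eq_fract T_def)
lemma T_nz: "T a = 0 \<longleftrightarrow> a = 0" using T_inj[of a 0] by (simp add: T_simps)

definition SS :: "'k::field poly3 fract set" where "SS = {T a / T b | a b. ev0 b \<noteq> 0}"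
definition VV :: "'k::field poly3 fract set" where "VV = {T (lift p) / T (lift q) | p q. poly q 0 \<noteq> 0}"
definition curve_ideal where "curve_ideal = {(T var_x ^ 2 - T var_y ^ 5) * a + (T var_x * T var_y ^ 2 + T var_y * T var_z ^ 3 - T var_z ^ 5) * b
   | a b. a \<in> SS \<and> b \<in> SS}"

lemma ring_S_eq: "ring_S k = \<lparr>carrier = SS, monoid.mult = (*), one = 1, ring.zero = 0, add = (+)\<rparr>"
  unfolding ring_S_def localization_at_def Idl_vars by (simp add: ring_of_type_algebra_def SS_def T_def)

lemma ev0_nz: "ev0 b \<noteq> 0 \<Longrightarrow> b \<noteq> 0" using ev0_simps(1) by auto

lemma SSI: "s = T a / T b \<Longrightarrow> ev0 b \<noteq> 0 \<Longrightarrow> s \<in> SS" unfolding SS_def by blast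
lemma SSE: assumes "s \<in> SS" obtains a b where "s = T a / T b" "ev0 b \<noteq> 0" "T b \<noteq> 0"
  using assms ev0_nz T_nz unfolding SS_def by blast
lemma T_SS: "T a \<in> SS" by (rule SSI[of _ a 1]) (simp_all add: T_simps ev0_simps)

lemma SS_closed:
  "1 \<in> SS" "s \<in> SS \<Longrightarrow> t \<in> SS \<Longrightarrow> s + t \<in> SS" "s \<in> SS \<Longrightarrow> t \<in> SS \<Longrightarrow> s * t \<in> SS" "s \<in> SS \<Longrightarrow> - s \<in> SS"
proof -
  show "1 \<in> SS" using T_SS[of 1] by (simp add: T_simps)
  show "s + t \<in> SS" if "s \<in> SS" "t \<in> SS"
  proof -
    from that(1) obtain a b where s: "s = T a / T b" "ev0 b \<noteq> 0" "T b \<noteq> 0" by (rule SSE)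
    from that(2) obtain c d where t: "t = T c / T d" "ev0 d \<noteq> 0" "T d \<noteq> 0" by (rule SSE)
    show ?thesis by (rule SSI[of _ "a * d + c * b" "b * d"]) (use s t in \<open>simp_all add: T_simps ev0_simps add_frac_eq\<close>)
  qed
  show "s * t \<in> SS" if "s \<in> SS" "t \<in> SS"
  proof -
    from that(1) obtain a b where s: "s = T a / T b" "ev0 b \<noteq> 0" "T b \<noteq> 0" by (rule SSE)
    from that(2) obtain c d where t: "t = T c / T d" "ev0 d \<noteq> 0" "T d \<noteq> 0" by (rule SSE)
    show ?thesis by (rule SSI[of _ "a * c" "b * d"]) (use s t in \<open>simp_all add: T_simps ev0_simps\<close>)
  qed
  show "- s \<in> SS" if "s \<in> SS"
  proof -
    from that(1) obtain a b where s: "s = T a / T b" "ev0 b \<noteq> 0" "T b \<noteq> 0" by (rule SSE)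
    show ?thesis by (rule SSI[of _ "- a" b]) (use s in \<open>simp_all add: T_simps\<close>)
  qed
qed

lemma VVI: "s = T (lift p) / T (lift q) \<Longrightarrow> poly q 0 \<noteq> 0 \<Longrightarrow> s \<in> VV" unfolding VV_def by blast
lemma VVE: assumes "s \<in> VV" obtains p q where "s = T (lift p) / T (lift q)" "poly q 0 \<noteq> 0" "T (lift q) \<noteq> 0"
  using assms unfolding VV_def T_nz lift_eq_0 by fastforce
lemma T_VV: "T (lift a) \<in> VV" by (rule VVI[of _ a 1]) (simp_all add: T_simps lift_simps)

lemma VV_closed:
  "1 \<in> VV" "s \<in> VV \<Longrightarrow> t \<in> VV \<Longrightarrow> s + t \<in> VV" "s \<in> VV \<Longrightarrow> t \<in> VV \<Longrightarrow> s * t \<in> VV" "s \<in> VV \<Longrightarrow> - s \<in> VV"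
proof -
  show "1 \<in> VV" using T_VV[of 1] by (simp add: T_simps lift_simps)
  show "s + t \<in> VV" if "s \<in> VV" "t \<in> VV"
  proof -
    from that(1) obtain a b where s: "s = T (lift a) / T (lift b)" "poly b 0 \<noteq> 0" "T (lift b) \<noteq> 0" by (rule VVE)
    from that(2) obtain c d where t: "t = T (lift c) / T (lift d)" "poly d 0 \<noteq> 0" "T (lift d) \<noteq> 0" by (rule VVE)
    show ?thesis by (rule VVI[of _ "a * d + c * b" "b * d"]) (use s t in \<open>simp_all add: T_simps lift_simps add_frac_eq\<close>)
  qed
  show "s * t \<in> VV" if "s \<in> VV" "t \<in> VV"
  proof -
    from that(1) obtain a b where s: "s = T (lift a) / T (lift b)" "poly b 0 \<noteq> 0" "T (lift b) \<noteq> 0" by (rule VVE)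
    from that(2) obtain c d where t: "t = T (lift c) / T (lift d)" "poly d 0 \<noteq> 0" "T (lift d) \<noteq> 0" by (rule VVE)
    show ?thesis by (rule VVI[of _ "a * c" "b * d"]) (use s t in \<open>simp_all add: T_simps lift_simps\<close>)
  qed
  show "- s \<in> VV" if "s \<in> VV"
  proof -
    from that(1) obtain a b where s: "s = T (lift a) / T (lift b)" "poly b 0 \<noteq> 0" "T (lift b) \<noteq> 0" by (rule VVE)
    show ?thesis by (rule VVI[of _ "- a" b]) (use s in \<open>simp_all add: T_simps lift_simps\<close>)
  qed
qed

lemma (in cring) Idl_pair:
  assumes "f \<in> carrier R" "g \<in> carrier R"
  shows "Idl {f, g} = {f \<otimes> a \<oplus> g \<otimes> b | a b. a \<in> carrier R \<and> b \<in> carrier R}" (is "_ = ?J")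
proof (rule equalityI)
  have JI: "f \<otimes> a \<oplus> g \<otimes> b \<in> ?J" if "a \<in> carrier R" "b \<in> carrier R" for a b using that by blast
  have "ideal ?J R"
  proof (rule idealI)
    show "subgroup ?J (add_monoid R)"
    proof (rule add.subgroupI)
      show "?J \<noteq> {}" using JI[of \<zero> \<zero>] by blast
    next
      fix u assume "u \<in> ?J"
      then obtain a b where u: "u = f \<otimes> a \<oplus> g \<otimes> b" "a \<in> carrier R" "b \<in> carrier R" by blast
      then have "\<ominus> u = f \<otimes> (\<ominus> a) \<oplus> g \<otimes> (\<ominus> b)" using assms by algebra
      then show "\<ominus> u \<in> ?J" using u JI by simp
    next
      fix u v assume "u \<in> ?J" "v \<in> ?J"
      then obtain a b c d where u: "u = f \<otimes> a \<oplus> g \<otimes> b" "a \<in> carrier R" "b \<in> carrier R"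
         "v = f \<otimes> c \<oplus> g \<otimes> d" "c \<in> carrier R" "d \<in> carrier R" by blast
      then have "u \<oplus> v = f \<otimes> (a \<oplus> c) \<oplus> g \<otimes> (b \<oplus> d)" using assms by algebra
      then show "u \<oplus> v \<in> ?J" using u JI by simp
    qed (use assms in auto)
  next
    fix u s assume "u \<in> ?J" and s: "s \<in> carrier R"
    then obtain a b where u: "u = f \<otimes> a \<oplus> g \<otimes> b" "a \<in> carrier R" "b \<in> carrier R" by blast
    then have "s \<otimes> u = f \<otimes> (s \<otimes> a) \<oplus> g \<otimes> (s \<otimes> b)" "u \<otimes> s = f \<otimes> (s \<otimes> a) \<oplus> g \<otimes> (s \<otimes> b)"
      using assms s by algebra+
    then show "s \<otimes> u \<in> ?J" "u \<otimes> s \<in> ?J" using JI[of "s \<otimes> a" "s \<otimes> b"] s u by auto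
  qed (rule ring_axioms)
  moreover have "f \<in> ?J" "g \<in> ?J" using JI[of \<one> \<zero>] JI[of \<zero> \<one>] assms by simp_all
  ultimately show "Idl {f, g} \<subseteq> ?J" by (intro genideal_minimal) auto
  interpret J: ideal "Idl {f, g}" R using assms by (intro genideal_ideal) auto
  have "f \<in> Idl {f, g}" "g \<in> Idl {f, g}" using genideal_self[of "{f, g}"] assms by auto
  then show "?J \<subseteq> Idl {f, g}" by (auto intro!: J.a_closed J.I_r_closed)
qed

lemma ideal_I_eq: "ideal_I k = curve_ideal"
proof -
  let ?S = "ring_S k" and ?f = "T var_x ^ 2 - T var_y ^ 5 :: 'a poly3 fract"
    and ?g = "T var_x * T var_y ^ 2 + T var_y * T var_z ^ 3 - T var_z ^ 5 :: 'a poly3 fract"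
  have fg: "Fraction_Field.Fract (var_x ^ 2 - var_y ^ 5) 1 = ?f"
    "Fraction_Field.Fract (var_x * var_y ^ 2 + var_y * var_z ^ 3 - var_z ^ 5) 1 = ?g"
    by (simp_all only: T_simps flip: T_def)
  have fgS: "?f \<in> SS" "?g \<in> SS" using T_SS[of "var_x ^ 2 - var_y ^ 5"]
      T_SS[of "var_x * var_y ^ 2 + var_y * var_z ^ 3 - var_z ^ 5"] by (simp_all add: T_simps)
  have simps: "carrier ?S = SS" "\<And>a b. a \<otimes>\<^bsub>?S\<^esub> b = a * b" "\<And>a b. a \<oplus>\<^bsub>?S\<^esub> b = a + b"
    by (simp_all add: ring_S_eq)
  interpret S: cring ?S unfolding ring_S_eq by (rule cring_of_subset) (use SS_closed in auto)
  show ?thesis unfolding ideal_I_def fg curve_ideal_def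
    by (subst S.Idl_pair) (use fgS in \<open>simp_all add: simps\<close>)
qed

lemma curve_base_model: "curve_base SS curve_ideal VV (T var_x) (T var_y) (T var_z :: 'k::field poly3 fract)"
proof
  have T1: "T a \<noteq> 0" if "ev0 a \<noteq> 0" for a :: "'k poly3" using that ev0_nz T_nz by blast
  show "VV \<subseteq> (SS :: 'k poly3 fract set)" unfolding VV_def SS_def by (auto simp: ev0_lift[symmetric])
  show "T var_z \<in> (VV :: 'k poly3 fract set)" using T_VV[of "[:0, 1:]"] by simp
  show "T var_z \<noteq> (0 :: 'k poly3 fract)" by (simp add: T_nz var_z_def)
  fix s :: "'k poly3 fract" assume "s \<in> SS"
  then obtain a b where s: "s = T a / T b" "ev0 b \<noteq> 0" "T b \<noteq> 0" by (rule SSE)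
  obtain c a1 a2 a3 where a: "a = [:[:[:c:]:]:] + var_x * a1 + var_y * a2 + var_z * a3"
    by (rule poly3_decomp)
  show "(s \<noteq> 0 \<and> inverse s \<in> SS) \<or>
    (\<exists>a\<in>SS. \<exists>b\<in>SS. \<exists>c\<in>SS. s = T var_x * a + T var_y * b + T var_z * c)"
  proof (cases "ev0 a = 0")
    case False
    then show ?thesis using s T1[of a] by (auto intro!: SSI[of _ b a])
  next
    case True
    then have "c = 0" unfolding a by (simp only: ev0_simps ev0_const ev0_var mult_zero_left add_0_right)
    then have "s = T var_x * (T a1 / T b) + T var_y * (T a2 / T b) + T var_z * (T a3 / T b)"
      unfolding s(1) a by (simp add: T_simps add_divide_distrib)
    moreover have "T d / T b \<in> SS" for d using s(2) by (rule SSI[OF refl])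
    ultimately show ?thesis by blast
  qed
next
  fix a b c :: "'k poly3 fract" assume "a \<in> SS" "b \<in> SS" "c \<in> SS"
  then obtain a1 a2 b1 b2 c1 c2 where s: "a = T a1 / T a2" "ev0 a2 \<noteq> 0" "T a2 \<noteq> 0" "b = T b1 / T b2" "ev0 b2 \<noteq> 0" "T b2 \<noteq> 0"
    "c = T c1 / T c2" "ev0 c2 \<noteq> 0" "T c2 \<noteq> 0" by (meson SSE)
  show "T var_x * a + T var_y * b + T var_z * c \<noteq> 1"
  proof
    assume "T var_x * a + T var_y * b + T var_z * c = 1"
    then have "T var_x * T a1 * T b2 * T c2 + T var_y * T b1 * T a2 * T c2 + T var_z * T c1 * T a2 * T b2 = T a2 * T b2 * T c2"
      using s by (simp add: field_simps)
    then have "T (var_x * a1 * b2 * c2 + var_y * b1 * a2 * c2 + var_z * c1 * a2 * b2) = T (a2 * b2 * c2)" by (simp add: T_simps)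
    then have "ev0 (var_x * a1 * b2 * c2 + var_y * b1 * a2 * c2 + var_z * c1 * a2 * b2) = ev0 (a2 * b2 * c2)" by (simp only: T_inj)
    then show False using s by (simp add: ev0_simps)
  qed
next
  fix c :: "'k poly3 fract" assume "c \<in> VV" "c \<noteq> 0"
  then obtain p q where c: "c = T (lift p) / T (lift q)" "poly q 0 \<noteq> 0" "T (lift q) \<noteq> 0" by (elim VVE)
  with \<open>c \<noteq> 0\<close> have "p \<noteq> 0" by (auto simp: T_nz lift_eq_0)
  then obtain r where r: "p = [:0, 1:] ^ order 0 p * r" "\<not> [:0, 1:] dvd r" using order_decomp[of p 0] by auto
  then have r0: "poly r 0 \<noteq> 0" using poly_eq_0_iff_dvd[of r 0] by simp
  then have rn: "T (lift r) \<noteq> 0" by (auto simp: T_nz lift_eq_0)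
  have "T (lift p) = T var_z ^ order 0 p * T (lift r)" 
    by (subst r(1)) (simp only: lift_simps T_simps lift_var)
  then have "c = T var_z ^ order 0 p * (T (lift r) / T (lift q))" using c by simp
  moreover have "T (lift r) / T (lift q) \<in> VV" by (rule VVI[OF refl c(2)])
  moreover have "inverse (T (lift r) / T (lift q)) \<in> VV" using VVI[OF refl r0, of q] by simp
  moreover have "T (lift r) / T (lift q) \<noteq> 0" using rn c by simp
  ultimately show "\<exists>n u. u \<in> VV \<and> inverse u \<in> VV \<and> u \<noteq> 0 \<and> c = T var_z ^ n * u" by blast
qed (use SS_closed VV_closed T_SS in \<open>auto simp: curve_ideal_def\<close>)


text \<open>For spanning, polynomials enter \<open>M\<close> by induction in each variable and
  fractions by closure under inverses. For independence, denominators are cleared and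
  \<open>psi\<close> is applied: it kills \<open>x^2 - y^5\<close> and leaves a divisibility by
  \<open>branch_poly\<close> that a degree below 9 does not allow.\<close>

lemma curve_model: "curve SS curve_ideal VV (T var_x) (T var_y) (T var_z :: 'k::field poly3 fract)"
proof -
  interpret B: curve_base SS curve_ideal VV "T var_x" "T var_y" "T var_z :: 'k poly3 fract"
    by (rule curve_base_model)
  have MV: "T [:[:[:c:]:]:] \<in> B.M" for c :: 'k
    using B.M_V[OF T_VV[of "[:c:]"]] by (simp add: lift_const)
  have zM: "T var_z \<in> B.M" by simp
  have M1: "T [:[:q:]:] \<in> B.M" for q :: "'k poly"
  proof (induction q)
    case (pCons c q)
    have "[:[:pCons c q:]:] = [:[:[:c:]:]:] + var_x * [:[:q:]:]" by (simp add: var_x_def)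
    then show ?case using pCons(2) MV by (simp only: T_simps B.M_add B.M_mult B.M_xy)
  qed (simp add: T_simps B.M_I)
  have M2: "T [:p:] \<in> B.M" for p :: "'k poly poly"
  proof (induction p)
    case (pCons c q)
    have "[:pCons c q:] = [:[:c:]:] + var_y * [:q:]" by (simp add: var_y_def)
    then show ?case using pCons(2) M1 by (simp only: T_simps B.M_add B.M_mult B.M_xy)
  qed (simp add: T_simps B.M_I)
  have M3: "T a \<in> B.M" for a :: "'k poly3"
  proof (induction a)
    case (pCons c q)
    have "pCons c q = [:c:] + var_z * q" by (simp add: var_z_def)
    then show ?case using pCons(2) M2 zM by (simp only: T_simps B.M_add B.M_mult)
  qed (simp add: T_simps B.M_I)
  show ?thesis
  proof
    fix s :: "'k poly3 fract" assume "s \<in> SS"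
    then obtain a b where s: "s = T a / T b" "ev0 b \<noteq> 0" "T b \<noteq> 0" by (rule SSE)
    have "inverse (T b) \<in> SS" using SSI[of "inverse (T b)" 1 b] s(2) by (simp add: T_simps inverse_eq_divide)
    then have "T a * inverse (T b) \<in> B.M" by (intro B.M_mult B.M_inverse M3 s(3))
    then obtain c e where "s = lin_comb (T var_x) (T var_y) c + e" "\<And>i. c i \<in> VV" "e \<in> curve_ideal"
      unfolding s(1) divide_inverse by (rule B.ME) blast
    then show "\<exists>c. (\<forall>i. c i \<in> VV) \<and> s - lin_comb (T var_x) (T var_y) c \<in> curve_ideal"
      by (intro exI[of _ c]) simp
  next
    fix c :: "nat \<Rightarrow> 'k poly3 fract"
    assume cV: "\<forall>i. c i \<in> VV" and cI: "lin_comb (T var_x) (T var_y) c \<in> curve_ideal"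
    have "\<forall>i. \<exists>p q. c i = T (lift p) / T (lift q) \<and> poly q 0 \<noteq> 0" using cV unfolding VV_def by blast
    then obtain p q where pq: "\<And>i. c i = T (lift (p i)) / T (lift (q i))" "\<And>i. poly (q i) 0 \<noteq> 0" by metis
    \<comment> \<open>Common denominator of the \<open>c i\<close>, which lies in
      \<open>k[z]\<close>. The denominators \<open>b\<close> and \<open>b'\<close> of the ideal
      coefficients involve all variables and remain as a factor next to the remainder.\<close>
    define Q where "Q = (\<Prod>i<9::nat. q i)"
    define P where "P i = p i * (\<Prod>j\<in>{..<9}-{i}. q j)" for i
    have Q0: "poly Q 0 \<noteq> 0" unfolding Q_def poly_prod using pq(2) by simp
    have qn: "T (lift (q i)) \<noteq> 0" for i using pq(2)[of i] by (auto simp: T_nz lift_eq_0)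
    have QP: "T (lift Q) * c i = T (lift (P i))" if "i < 9" for i
    proof -
      have "Q = q i * (\<Prod>j\<in>{..<9}-{i}. q j)" unfolding Q_def using that by (simp add: prod.remove)
      then show ?thesis using qn[of i] unfolding pq(1) P_def by (simp add: lift_simps T_simps)
    qed
    obtain s t where st: "lin_comb (T var_x) (T var_y) c = (T var_x ^ 2 - T var_y ^ 5) * s
        + (T var_x * T var_y ^ 2 + T var_y * T var_z ^ 3 - T var_z ^ 5) * t" "s \<in> SS" "t \<in> SS"
      using cI unfolding curve_ideal_def by blast
    obtain a b where s: "s = T a / T b" "ev0 b \<noteq> 0" "T b \<noteq> 0" using st(2) by (rule SSE)
    obtain a' b' where t: "t = T a' / T b'" "ev0 b' \<noteq> 0" "T b' \<noteq> 0" using st(3) by (rule SSE)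
    have "T (b * b' * lin_comb var_x var_y (\<lambda>i. lift (P i)))
       = T b * T b' * lin_comb (T var_x) (T var_y) (\<lambda>i. T (lift (P i)))"
      by (simp add: lin_comb_def T_simps)
    also have "lin_comb (T var_x) (T var_y) (\<lambda>i. T (lift (P i))) = T (lift Q) * lin_comb (T var_x) (T var_y) c"
      unfolding lin_comb_scale[symmetric] by (simp add: lin_comb_def QP)
    also have "T b * T b' * (T (lift Q) * lin_comb (T var_x) (T var_y) c)
      = T ((var_x ^ 2 - var_y ^ 5) * (lift Q * b' * a) + (var_x * var_y ^ 2 + var_y * var_z ^ 3 - var_z ^ 5) * (lift Q * b * a'))"
      unfolding st(1) s(1) t(1) T_simps using s(3) t(3) by (simp add: field_simps)
    finally have "psi (b * b' * lin_comb var_x var_y (\<lambda>i. lift (P i)))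
      = psi ((var_x ^ 2 - var_y ^ 5) * (lift Q * b' * a) + (var_x * var_y ^ 2 + var_y * var_z ^ 3 - var_z ^ 5) * (lift Q * b * a'))"
      by (simp only: T_inj)
    also have "\<dots> = branch_poly * psi (lift Q * b * a')"
    proof -
      have f: "psi (var_x ^ 2 - var_y ^ 5) = 0" unfolding psi_simps psi_var by (simp flip: power_mult)
      have g: "psi (var_x * var_y ^ 2 + var_y * var_z ^ 3 - var_z ^ 5) = branch_poly"
        unfolding psi_simps psi_var branch_poly_def by (simp add: mult.commute flip: power_mult power_add)
      show ?thesis
        unfolding psi_simps(3)[of "(var_x ^ 2 - var_y ^ 5) * _"] psi_simps(4)[of "var_x ^ 2 - var_y ^ 5"]
          psi_simps(4)[of "var_x * var_y ^ 2 + var_y * var_z ^ 3 - var_z ^ 5"] f g by simp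
    qed
    finally have main: "psi (b * b') * lin_comb (W ^ 5) (W ^ 2) (\<lambda>i. [:P i:]) = branch_poly * psi (lift Q * b * a')"
      by (simp only: psi_simps lin_comb_def psi_lift psi_var)
    \<comment> \<open>The remainder of degree below 9. Its coefficients are triangular in
      \<open>P\<close>: the indices 0, 1, 2, 3, 4, 8 occur alone, \<open>P 5\<close> with a factor
      \<open>z^5\<close>, then \<open>P 6\<close> and \<open>P 7\<close> follow; so
      \<open>r = 0\<close> kills every \<open>P i\<close>.\<close>
    define r :: "'k poly poly" where "r = [:P 0, [:0, 1:] ^ 5 * P 5, P 1, [:0, 1:] ^ 5 * P 6 - [:0, 1:] ^ 3 * P 5, P 2,
      P 7 - [:0, 1:] ^ 3 * P 6, P 3, P 8, P 4:]"
    have r: "r = lin_comb (W ^ 5) (W ^ 2) (\<lambda>i. [:P i:]) - branch_poly * ([:P 5:] * W + [:P 6:] * W ^ 3)"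
    proof -
      have "r = [:P 0:] + W * (Zc ^ 5 * [:P 5:] + W * ([:P 1:] + W * (Zc ^ 5 * [:P 6:] - Zc ^ 3 * [:P 5:]
          + W * ([:P 2:] + W * ([:P 7:] - Zc ^ 3 * [:P 6:] + W * ([:P 3:] + W * ([:P 8:] + W * [:P 4:])))))))"
        by (simp add: r_def poly_const_pow)
      then show ?thesis unfolding branch_poly_def using lin_comb_reduce[of "\<lambda>i. [:P i:]" W Zc] by simp
    qed
    have eq: "psi (b * b') * r = branch_poly * (psi (lift Q * b * a') - psi (b * b') * ([:P 5:] * W + [:P 6:] * W ^ 3))"
      unfolding r right_diff_distrib main by (simp only: mult_ac)
    have "degree r < 9" unfolding r_def by (simp add: degree_pCons_eq_if)
    from branch_poly_dvd[OF eq this] have "r = 0" using s(2) t(2) by (simp add: ev_psi ev0_simps(4))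
    then have "P i = 0" if "i < 9" for i
      using that unfolding r_def by (auto simp: less_Suc_eq eval_nat_numeral)
    then have "c i = 0" if "i < 9" for i
      using QP[OF that] that Q0 by (auto simp: T_simps T_nz lift_eq_0 lift_simps(1))
    then show "\<forall>i<9. c i = 0" by blast
  qed
qed

section \<open>Powers of the maximal ideal\<close>

context curve
begin

text \<open>The preimage in \<open>S\<close> of the principal ideal generated by the class of
  \<open>t\<close>.\<close>

definition princ :: "'f \<Rightarrow> 'f set" where "princ t = {t * s + e | s e. s \<in> S \<and> e \<in> I}"

lemma princI: "u = t * s + e \<Longrightarrow> s \<in> S \<Longrightarrow> e \<in> I \<Longrightarrow> u \<in> princ t"
  unfolding princ_def by blast
lemma princ_I: "e \<in> I \<Longrightarrow> e \<in> princ t" by (rule princI[of _ _ 0 e]) auto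
lemma princ_self: "s \<in> S \<Longrightarrow> t * s \<in> princ t" by (rule princI[of _ _ s 0]) auto
lemma princ_add: "u \<in> princ t \<Longrightarrow> v \<in> princ t \<Longrightarrow> u + v \<in> princ t"
proof -
  assume "u \<in> princ t" "v \<in> princ t"
  then obtain s e s' e' where "u = t * s + e" "v = t * s' + e'" "s \<in> S" "e \<in> I" "s' \<in> S" "e' \<in> I"
    unfolding princ_def by blast
  then show ?thesis by clarify (rule princI[of _ _ "s + s'" "e + e'"], simp_all add: algebra_simps)
qed
lemma princ_mult: "u \<in> princ t \<Longrightarrow> a \<in> S \<Longrightarrow> a * u \<in> princ t"
proof -
  assume "u \<in> princ t" "a \<in> S"
  then obtain s e where "u = t * s + e" "s \<in> S" "e \<in> I" unfolding princ_def by blast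
  then show ?thesis using \<open>a \<in> S\<close>
    by clarify (rule princI[of _ _ "a * s" "a * e"], simp add: algebra_simps, simp_all add: I_mult)
qed
lemma princ_mult2: "u \<in> princ t \<Longrightarrow> a \<in> S \<Longrightarrow> u * a \<in> princ t"
  using princ_mult[of u t a] by (simp add: mult.commute)
lemma princ_uminus: "u \<in> princ t \<Longrightarrow> - u \<in> princ t" using princ_mult[of u t "-1"] by simp
lemma princ_diff: "u \<in> princ t \<Longrightarrow> v \<in> princ t \<Longrightarrow> u - v \<in> princ t"
  using princ_add[OF _ princ_uminus] by fastforce
lemma princ_S: "t \<in> S \<Longrightarrow> princ t \<subseteq> S" unfolding princ_def using I_S by auto
lemma princE: assumes "u \<in> princ t" obtains s where "s \<in> S" "u - t * s \<in> I"
  using assms unfolding princ_def by auto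

lemma sideal_princ: "t \<in> S \<Longrightarrow> sideal (princ t)"
  by (rule sidealI) (use princ_S princ_I princ_add princ_mult in auto)

lemma S_M: "s \<in> S \<Longrightarrow> s \<in> M"
  using span[of s] MI[of s _ "s - lin_comb x y _"] by force

lemma nilpotent_mod_z: assumes "a \<in> nn" shows "\<exists>n. a ^ n \<in> princ z"
proof -
  obtain p q r where a: "a = x * p + y * q + z * r + 0" "p \<in> S" "q \<in> S" "r \<in> S" using assms by (auto elim: nnE)
  obtain n w where w: "w \<in> M" "a ^ n - z * w \<in> I"
    using M_nilpotent_mod_z[OF S_M[OF a(2)] S_M[OF a(3)] S_M[OF a(4)] I_zero] unfolding a(1) by blast
  have "a ^ n = z * w + (a ^ n - z * w)" by simp
  then have "a ^ n \<in> princ z" using w M_S by (intro princI)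
  then show ?thesis by blast
qed

text \<open>The ten powers \<open>1, ..., a^9\<close> are dependent in a \<open>V\<close>-module of
  rank nine, and the lowest nonzero coefficient is a unit times \<open>z^n\<close>. This takes the
  place of integrality over \<open>V\<close>: when \<open>a\<close> is a nonzerodivisor modulo
  \<open>I\<close>, a power of \<open>z\<close> lies in the ideal generated by \<open>a\<close> and
  \<open>I\<close>.\<close>

lemma algebraic: assumes "a \<in> S"
  shows "\<exists>n w j. w \<in> S \<and> a ^ j * (z ^ n + a * w) \<in> I"
proof -
  have "\<exists>d. (\<forall>j\<in>{..<10::nat}. d j \<in> V) \<and> (\<exists>j\<in>{..<10}. d j \<noteq> 0) \<and> (\<forall>i<9. (\<Sum>j\<in>{..<10}. d j * coord (a ^ j) i) = 0)"
    using assms coord(1) by (intro linear_dependence) auto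
  then obtain d where d: "\<And>j. j < 10 \<Longrightarrow> d j \<in> V" "\<exists>j<10. d j \<noteq> 0"
    "\<And>i. i < 9 \<Longrightarrow> (\<Sum>j<10. d j * coord (a ^ j) i) = 0" by auto
  have cs: "coord (\<Sum>j\<in>A. d j * a ^ j) i = (\<Sum>j\<in>A. d j * coord (a ^ j) i)" if "A \<subseteq> {..<10}" "i < 9" for A i
    using finite_subset[OF that(1) finite_lessThan] that
  proof (induction A rule: finite_induct)
    case empty then show ?case using coord_scale[of 0 0 i] by simp
  next
    case (insert j A)
    then have "coord (d j * a ^ j + (\<Sum>j\<in>A. d j * a ^ j)) i = coord (d j * a ^ j) i + coord (\<Sum>j\<in>A. d j * a ^ j) i"
      using d(1) assms by (intro coord_add) (auto intro!: S_sum)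
    then show ?case using insert d(1) assms coord_scale[of "a ^ j" "d j" i] by simp
  qed
  have SI: "(\<Sum>j<10. d j * a ^ j) \<in> I"
    using d cs[of "{..<10}"] assms by (subst coord_I) (auto intro!: S_sum)
  \<comment> \<open>Lowest exponent present in the relation; once \<open>a^l\<close> is taken out,
    all later terms retain a factor \<open>a\<close>.\<close>
  define l where "l = (LEAST j. d j \<noteq> 0)"
  have l: "d l \<noteq> 0" "\<And>j. j < l \<Longrightarrow> d j = 0"
    using d(2) LeastI_ex[of "\<lambda>j. d j \<noteq> 0"] not_less_Least[of _ "\<lambda>j. d j \<noteq> 0"] unfolding l_def by blast+
  have l10: "l < 10" using d(2) l(2) by (meson linorder_not_le order_le_less_trans not_le)
  define w where "w = (\<Sum>j\<in>{Suc l..<10}. d j * a ^ (j - Suc l))"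
  have wS: "w \<in> S" unfolding w_def using d(1) assms by (auto intro!: S_sum)
  have "(\<Sum>j<10. d j * a ^ j) = (\<Sum>j\<in>{l..<10}. d j * a ^ j)"
    using l(2) by (intro sum.mono_neutral_right) auto
  also have "\<dots> = d l * a ^ l + (\<Sum>j\<in>{Suc l..<10}. d j * a ^ j)"
    using l10 by (simp add: sum.atLeast_Suc_lessThan)
  also have "(\<Sum>j\<in>{Suc l..<10}. d j * a ^ j) = a ^ Suc l * w"
    unfolding w_def sum_distrib_left
  proof (rule sum.cong)
    fix j assume "j \<in> {Suc l..<10}"
    then have "a ^ j = a ^ Suc l * a ^ (j - Suc l)" using power_add[of a "Suc l" "j - Suc l"] by simp
    then show "d j * a ^ j = a ^ Suc l * (d j * a ^ (j - Suc l))" by (simp add: mult_ac)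
  qed simp
  finally have *: "a ^ l * (d l + a * w) \<in> I" using SI by (simp add: algebra_simps)
  obtain n u where u: "u \<in> V" "inverse u \<in> V" "u \<noteq> 0" "d l = z ^ n * u" using V_val[OF d(1)[OF l10] l(1)] by blast
  have eq: "inverse u * (a ^ l * (d l + a * w)) = a ^ l * (z ^ n + a * (inverse u * w))"
    using u by (simp add: field_simps)
  then have "a ^ l * (z ^ n + a * (inverse u * w)) \<in> I" using I_mult[OF * VS[OF u(2)]] by (simp only: eq)
  then show ?thesis using wS u by (metis S_mult VS)
qed

text \<open>\<open>x z^3 + y^6\<close> lifts the socle generator \<open>y^6\<close> of the quotient
  by \<open>z\<close>; it is also the element dual to \<open>1\<close> under the coefficient of
  \<open>y^6\<close>. The correction \<open>x z^3\<close> makes its products with \<open>x\<close>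
  and \<open>y\<close> into \<open>z\<close> times a monomial.\<close>

lemma socle_products:
  "x * (x * z^3 + y^6) - z * (y^4 * z^4) \<in> I" "y * (x * z^3 + y^6) - z * (x * z^4) \<in> I"
proof -
  show "x * (x * z^3 + y^6) - z * (y^4 * z^4) \<in> I"
    by (rule II[of _ "z^3" "y^4"]) (simp_all add: algebra_simps eval_nat_numeral)
  show "y * (x * z^3 + y^6) - z * (x * z^4) \<in> I"
    by (rule II[of _ "- (y^2)" "x"]) (simp_all add: algebra_simps eval_nat_numeral)
qed

text \<open>
  For \<open>t = t\<^sub>1 x + t\<^sub>2 y + t\<^sub>3 z\<close>, the element \<open>\<Delta>\<close> below is the determinant that expresses
  \<open>x\<^sup>2 - y\<^sup>5, x y\<^sup>2 + y z\<^sup>3 - z\<^sup>5, t\<close> by \<open>x, y, z\<close>; it generates the socle of \<open>R/t\<close>.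
\<close>
lemma power5_not_in_princ:
  assumes t: "t \<in> nn" and param: "Pw n \<subseteq> princ t"
  shows "\<not> Pw 5 \<subseteq> princ t"
proof
  assume P5: "Pw 5 \<subseteq> princ t"
  obtain t1 t2 t3 where t_eq: "t = x * t1 + y * t2 + z * t3" and tS: "t1 \<in> S" "t2 \<in> S" "t3 \<in> S"
    using t by (elim nnE)
  have mon: "s \<in> princ t" if "s = x^i * y^j * z^l * u" "u \<in> S" "5 \<le> i + j + l" for s i j l u
    using P5 Pw_monom'[OF that] by blast
  let ?C = "x * z^3 + y^6"
  define \<Delta> where "\<Delta> = y^4 * z^4 * t1 + x * z^4 * t2 + ?C * t3"
  \<comment> \<open>Every other term of \<open>\<Delta>\<close> has degree at least 5 and is covered
    by \<open>P5\<close>; only this one has degree 4 when \<open>t3\<close> is a unit.\<close>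
  have xz3: "t3 * (x * z^3) \<in> princ t"
  proof (cases "t3 \<in> nn")
    case True
    then obtain a b c where "t3 = x * a + y * b + z * c" "a \<in> S" "b \<in> S" "c \<in> S" by (elim nnE)
    then have "t3 * (x * z^3) = (x^2 * y^0 * z^3 * a) + (x^1 * y^1 * z^3 * b) + (x^1 * y^0 * z^4 * c)"
      by (simp add: algebra_simps eval_nat_numeral)
    also have "\<dots> \<in> princ t" by (intro princ_add mon[OF refl]) (use \<open>a \<in> S\<close> \<open>b \<in> S\<close> \<open>c \<in> S\<close> in auto)
    finally show ?thesis .
  next
    case False
    from unitI[OF tS(3) False] have u: "t3 \<noteq> 0" "inverse t3 \<in> S" by auto
    have x2: "x^2 * y * z \<in> princ t"
    proof -
      have "x^2 * y * z = (x^2 - y^5) * (y * z) + x^0 * y^6 * z^1 * 1" by (simp add: algebra_simps eval_nat_numeral)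
      also have "\<dots> \<in> princ t" by (intro princ_add mon[OF refl] princ_I II[of _ "y * z" 0]) auto
      finally show ?thesis .
    qed
    have x2': "x^2 * z^2 \<in> princ t"
    proof -
      have "x^2 * z^2 = (x^2 - y^5) * z^2 + x^0 * y^5 * z^2 * 1" by (simp add: algebra_simps eval_nat_numeral)
      also have "\<dots> \<in> princ t" by (intro princ_add mon[OF refl] princ_I II[of _ "z^2" 0]) auto
      finally show ?thesis .
    qed
    have xy2: "x * y^2 * z \<in> princ t"
    proof -
      have "x * y^2 * z = (x * y^2 + y * z^3 - z^5) * z + x^0 * y^0 * z^6 * 1 - x^0 * y^1 * z^4 * 1"
        by (simp add: algebra_simps eval_nat_numeral)
      also have "\<dots> \<in> princ t" by (intro princ_add princ_diff mon[OF refl] princ_I II[of _ 0 z]) auto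
      finally show ?thesis .
    qed
    \<comment> \<open>With \<open>t3\<close> invertible, \<open>t\<close> trades one factor
      \<open>z\<close> for \<open>x\<close> or \<open>y\<close> modulo \<open>t\<close>, after which
      the relations raise the degree. The next trade reduces \<open>x z^3\<close> to
      \<open>x^2 z^2\<close> and \<open>x y z^2\<close> in the same way.\<close>
    have "t3 * (x * y * z^2) = t * (x * y * z) - t1 * (x^2 * y * z) - t2 * (x * y^2 * z)"
      by (simp add: t_eq algebra_simps eval_nat_numeral)
    also have "\<dots> \<in> princ t" by (intro princ_diff princ_self princ_mult x2 xy2) (use tS in auto)
    finally have "t3 * (x * y * z^2) \<in> princ t" .
    from princ_mult[OF this u(2)] have xyz2: "x * y * z^2 \<in> princ t" using u by (simp add: mult.assoc[symmetric])
    have "t3 * (x * z^3) = t * (x * z^2) - t1 * (x^2 * z^2) - t2 * (x * y * z^2)"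
      by (simp add: t_eq algebra_simps eval_nat_numeral)
    also have "\<dots> \<in> princ t" by (intro princ_diff princ_self princ_mult x2' xyz2) (use tS in auto)
    finally show ?thesis .
  qed
  have "\<Delta> = x^0 * y^4 * z^4 * t1 + x^1 * y^0 * z^4 * t2 + (t3 * (x * z^3) + x^0 * y^6 * z^0 * t3)"
    by (simp add: \<Delta>_def algebra_simps)
  also have "\<dots> \<in> princ t" by (intro princ_add mon[OF refl] xz3) (use tS in auto)
  finally obtain r where r: "r \<in> S" "\<Delta> - t * r \<in> I" by (elim princE)
  have "t * (z * r - ?C) = z * \<Delta> - t * ?C - z * (\<Delta> - t * r)" by (simp add: algebra_simps)
  also have "z * \<Delta> - t * ?C = - (t1 * (x * ?C - z * (y^4 * z^4))) - t2 * (y * ?C - z * (x * z^4))"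
    by (simp add: \<Delta>_def t_eq algebra_simps)
  finally have tI: "t * (z * r - ?C) \<in> I"
    using r tS socle_products by (simp add: I_mult)
  have CS: "z * r - ?C \<in> S" using r by simp
  have "x^0 * y^0 * z^n \<in> Pw n" by (rule Pw_monom) simp
  then have "z ^ n \<in> princ t" using param by auto
  then obtain s where s: "s \<in> S" "z ^ n - t * s \<in> I" by (elim princE)
  \<comment> \<open>A power of \<open>z\<close> is a multiple of \<open>t\<close> modulo
    \<open>I\<close> and \<open>z\<close> is a nonzerodivisor there, so \<open>t\<close> can be
    cancelled.\<close>
  have "z ^ n * (z * r - ?C) = (z ^ n - t * s) * (z * r - ?C) + s * (t * (z * r - ?C))"
    by (simp add: algebra_simps)
  also have "\<dots> \<in> I" using s tI CS by (simp add: I_mult I_mult2)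
  finally have "z * r - ?C \<in> I" using z_power_cancel CS by blast
  then have "y^6 - z * (r - x * z^2) \<in> I" 
    using I_uminus[of "z * r - ?C"] by (simp add: algebra_simps eval_nat_numeral)
  then show False using y6_not_zS[of "r - x * z^2"] r by simp
qed

text \<open>Setting \<open>z = y\<close> turns the second relation into
  \<open>x y^2 = y^5 - y^4\<close>. In the quotient the square of the maximal ideal is then
  contained in \<open>(x y, y^2)\<close> and its powers from the third on in \<open>(y^n)\<close>,
  which leaves \<open>y^6 = 0\<close> to be shown. The parameter \<open>z\<close> itself would not
  do, since \<open>y^6\<close> is not a multiple of it.\<close>

lemma power6_in_princ: "Pw 6 \<subseteq> princ (y - z)"
proof -
  let ?J = "princ (y - z)"
  have xy2: "x * y^2 - (y^5 - y^4) \<in> ?J"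
  proof (rule princI)
    show "x * y^2 - (y^5 - y^4) = (y - z) * (y * (y^2 + y * z + z^2) - (y^4 + y^3 * z + y^2 * z^2 + y * z^3 + z^4))
        + (x * y^2 + y * z^3 - z^5)" by (simp add: algebra_simps eval_nat_numeral)
    show "x * y^2 + y * z^3 - z^5 \<in> I" by (rule II[of _ 0 1]) simp_all
  qed simp
  have y6: "y^6 \<in> ?J"
  proof -
    \<comment> \<open>In the quotient \<open>y^7 = (y^5 - y^4) x = (y^3 - y^2) (x y^2) = (y^3 - y^2)
      (y^5 - y^4)\<close>, which rearranges to \<open>y^6 (1 - 3 y + y^2) = 0\<close> with a unit as
      second factor.\<close>
    have "y^6 * (1 - 3 * y + y^2) = (y^3 - y^2) * (- (x * y^2 - (y^5 - y^4))) + ((y^3 - y^2) * (x * y^2) - y^7)"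
      by (simp add: algebra_simps eval_nat_numeral)
    also have "(y^3 - y^2) * (x * y^2) - y^7 = (y - z) * (x * (y^4 + y^3 * z + y^2 * z^2 + y * z^3 + z^4)
        - x * y * (y^2 + y * z + z^2)) - (y^7 - (z^5 * x - z^3 * (x * y)))"
      by (simp add: algebra_simps eval_nat_numeral)
    finally have eq: "y^6 * (1 - 3 * y + y^2) = (y^3 - y^2) * (- (x * y^2 - (y^5 - y^4))) +
      ((y - z) * (x * (y^4 + y^3 * z + y^2 * z^2 + y * z^3 + z^4)
        - x * y * (y^2 + y * z + z^2)) - (y^7 - (z^5 * x - z^3 * (x * y))))" .
    have "y^6 * (1 - 3 * y + y^2) \<in> ?J" unfolding eq
      by (rule princ_add[OF princ_mult[OF princ_uminus[OF xy2]] princ_diff[OF princ_self princ_I[OF y7]]]) simp_all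
    moreover have numS: "3 \<in> S" using S_add[OF S_add[OF S_one S_one] S_one] by simp
    have "1 - 3 * y + y^2 \<notin> nn"
    proof
      assume "1 - 3 * y + y^2 \<in> nn"
      from nn_add[OF this nn_mult[OF xyz_nn(2), of "3 - y"]] have "(1 - 3 * y + y^2) + (3 - y) * y \<in> nn"
        using numS by simp
      then show False using one_nn by (simp add: algebra_simps eval_nat_numeral)
    qed
    then have "1 - 3 * y + y^2 \<noteq> 0" "inverse (1 - 3 * y + y^2) \<in> S"
      using unitI[of "1 - 3 * y + y^2"] numS by auto
    ultimately show ?thesis
      using princ_mult2[of "y^6 * (1 - 3 * y + y^2)" "y - z" "inverse (1 - 3 * y + y^2)"]
      by (simp add: mult.assoc)
  qed
  define L where "L n = {y ^ n * a + e | a e. a \<in> S \<and> e \<in> ?J}" for n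
  have LI: "u \<in> L n" if "u = y ^ n * a + e" "a \<in> S" "e \<in> ?J" for u n a e
    using that unfolding L_def by blast
  have Ladd: "u + v \<in> L n" if uv: "u \<in> L n" "v \<in> L n" for u v n
  proof -
    from uv obtain a e b e' where "u = y ^ n * a + e" "v = y ^ n * b + e'" "a \<in> S" "e \<in> ?J" "b \<in> S" "e' \<in> ?J"
      unfolding L_def by blast
    then show ?thesis
      by clarify (rule LI[of _ _ "a + b" "e + e'"], simp add: algebra_simps, simp_all add: princ_add)
  qed
  have LJ: "e \<in> L n" if "e \<in> ?J" for e n using LI[of e n 0 e] that by simp
  \<comment> \<open>Degree two still needs the generator \<open>x y\<close>; one step later
    \<open>x y^2 = y^5 - y^4\<close> and \<open>x^2 y = y^6\<close> absorb it into the powers of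
    \<open>y\<close>.\<close>
  define Q where "Q n = (if n = 0 then S else if n = 1 then nn else
    if n = 2 then {x * y * a + b | a b. a \<in> S \<and> b \<in> L 2} else L n)" for n :: nat
  have Q2: "x * y * a + b \<in> Q 2" if "a \<in> S" "b \<in> L 2" for a b using that unfolding Q_def by auto
  have Q3: "Q n = L n" if "n \<ge> 3" for n using that unfolding Q_def by auto
  have LS: "u \<in> S" if "u \<in> L n" for u n using that princ_S[of "y - z"] unfolding L_def by auto
  have "Pw 6 \<subseteq> Q 6"
  proof (rule Pw_least[where N = 6])
    show "S \<subseteq> Q 0" by (simp add: Q_def)
    show "I \<subseteq> Q n" for n using I_S I_nn princ_I LJ Q2[of 0] unfolding Q_def by fastforce
    fix n s t assume st: "s \<in> Q n" "t \<in> Q n"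
    show "s + t \<in> Q n"
    proof (cases "n = 2")
      case True
      with st obtain a b a' b' where "s = x * y * a + b" "t = x * y * a' + b'" "a \<in> S" "b \<in> L 2" "a' \<in> S" "b' \<in> L 2"
        unfolding Q_def by auto
      then show ?thesis using Q2[of "a + a'" "b + b'"] Ladd True by (simp add: algebra_simps)
    qed (use st Ladd in \<open>auto simp: Q_def\<close>)
  next
    fix n s assume s: "s \<in> Q n"
    have xyz: "x * s \<in> Q (Suc n) \<and> y * s \<in> Q (Suc n)" 
    proof -
      consider "n = 0" | "n = 1" | "n = 2" | "n \<ge> 3" by linarith
      then show ?thesis
      proof cases
        case 1 then show ?thesis using s nn_mult2[of _ s] by (simp add: Q_def)
      next
        case 2
        with s obtain a b c where s: "s = x * a + y * b + z * c" "a \<in> S" "b \<in> S" "c \<in> S"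
          by (auto simp: Q_def elim: nnE)
        have xs: "x * s = x * y * (b + c) + (y^2 * (y^3 * a) + ((x^2 - y^5) * a - (y - z) * (x * c)))"
          by (simp add: s algebra_simps eval_nat_numeral)
        have ys: "y * s = x * y * a + (y^2 * (b + c) + (y - z) * (- (y * c)))"
          by (simp add: s algebra_simps eval_nat_numeral)
        have "(x^2 - y^5) * a - (y - z) * (x * c) \<in> ?J"
          using s by (intro princ_diff princ_self princ_I II[of _ a 0]) auto
        then have "x * s \<in> Q 2" unfolding xs using s by (intro Q2 LI[OF refl]) auto
        moreover have "y * s \<in> Q 2" unfolding ys using s by (intro Q2 LI[OF refl] princ_self) auto
        ultimately show ?thesis using 2 by (simp add: numeral_2_eq_2)
      next
        case 3
        with s obtain a b e where s: "s = x * y * a + (y^2 * b + e)" "a \<in> S" "b \<in> S" "e \<in> ?J"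
          by (auto simp: Q_def L_def)
        have xs: "x * s = y^3 * (y^3 * a + (y^2 - y) * b) + ((x * y^2 - (y^5 - y^4)) * b + x * e + (x^2 - y^5) * (y * a))"
          by (simp add: s algebra_simps eval_nat_numeral)
        have ys: "y * s = y^3 * ((y^2 - y) * a + b) + ((x * y^2 - (y^5 - y^4)) * a + y * e)"
          by (simp add: s algebra_simps eval_nat_numeral)
        have "(x * y^2 - (y^5 - y^4)) * b + x * e + (x^2 - y^5) * (y * a) \<in> ?J"
          by (rule princ_add[OF princ_add[OF princ_mult2[OF xy2] princ_mult] princ_I[OF II[of _ "y * a" 0]]])
            (use s(2-4) in simp_all)
        then have "x * s \<in> L 3" unfolding xs using s by (intro LI[OF refl]) auto
        moreover have "y * s \<in> L 3" unfolding ys using s xy2 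
          by (intro LI[OF refl] princ_add princ_mult princ_mult2) auto
        ultimately show ?thesis using 3 by (simp add: Q3)
      next
        case 4
        then obtain m where n: "n = Suc (Suc (Suc m))" by (metis Suc_le_D numeral_3_eq_3 Suc_le_mono)
        from s 4 obtain a e where s: "s = y ^ n * a + e" "a \<in> S" "e \<in> ?J" by (auto simp: Q3 L_def)
        have xs: "x * s = y ^ Suc n * ((y^2 - y) * a) + ((x * y^2 - (y^5 - y^4)) * (y ^ Suc m * a) + x * e)"
          by (simp add: s n algebra_simps eval_nat_numeral)
        have ys: "y * s = y ^ Suc n * a + y * e" by (simp add: s algebra_simps)
        have "x * s \<in> L (Suc n)" unfolding xs using s xy2
          by (intro LI[OF refl] princ_add princ_mult princ_mult2) auto
        moreover have "y * s \<in> L (Suc n)" unfolding ys using s by (intro LI[OF refl] princ_mult) auto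
        ultimately show ?thesis using 4 by (simp add: Q3)
      qed
    qed
    have sS: "s \<in> S" using s LS nn_S unfolding Q_def by (auto split: if_splits)
    have "z * s = y * s - (y - z) * s" by (simp add: algebra_simps)
    moreover have "- ((y - z) * s) \<in> L m" for m using sS by (intro LJ princ_uminus princ_self)
    moreover have "z * s \<in> nn" using sS by (simp add: nn_mult2)
    moreover have "u - v \<in> Q m" if "u \<in> Q m" "- v \<in> L m" "m \<ge> 2" for u v m
    proof (cases "m = 2")
      case True
      with that obtain a b where "u = x * y * a + b" "a \<in> S" "b \<in> L 2" unfolding Q_def by auto
      then show ?thesis using Q2[of a "b + - v"] Ladd[of b 2 "- v"] that True by (simp add: algebra_simps)
    next
      case False then show ?thesis using that Ladd[of u m "- v"] by (simp add: Q_def)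
    qed
    ultimately have "z * s \<in> Q (Suc n)" using xyz by (cases "n = 0") (auto simp: Q_def[of "Suc 0"])
    with xyz show "x * s \<in> Q (Suc n) \<and> y * s \<in> Q (Suc n) \<and> z * s \<in> Q (Suc n)" by blast
  qed simp
  also have "Q 6 \<subseteq> ?J" using y6 unfolding Q_def L_def by (auto intro!: princ_add princ_mult2)
  finally show ?thesis .
qed

section \<open>Coefficients of elements of the fifth power\<close>

definition zdvd :: "nat \<Rightarrow> 'f \<Rightarrow> bool" where "zdvd n c \<longleftrightarrow> (\<exists>d\<in>V. c = z ^ n * d)"

lemma zdvd_add: "zdvd n c \<Longrightarrow> zdvd n d \<Longrightarrow> zdvd n (c + d)"
  unfolding zdvd_def by (metis V_add distrib_left)
lemma zdvd_uminus: "zdvd n c \<Longrightarrow> zdvd n (- c)"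
  unfolding zdvd_def by (metis V_uminus mult_minus_right)
lemma zdvd_diff: "zdvd n c \<Longrightarrow> zdvd n d \<Longrightarrow> zdvd n (c - d)"
  using zdvd_add[OF _ zdvd_uminus] by fastforce
lemma zdvd_zero: "zdvd n 0" unfolding zdvd_def by (rule bexI[of _ 0]) auto
lemma zdvd_le: "zdvd n c \<Longrightarrow> m \<le> n \<Longrightarrow> zdvd m c"
  unfolding zdvd_def
proof (elim bexE)
  fix d assume "m \<le> n" "d \<in> V" "c = z ^ n * d"
  then show "\<exists>d\<in>V. c = z ^ m * d" 
    using power_add[of z m "n - m"] by (intro bexI[of _ "z ^ (n - m) * d"]) auto
qed
lemma zdvd_mult: "c \<in> V \<Longrightarrow> n \<le> m \<Longrightarrow> zdvd n (c * z ^ m)"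
  by (rule zdvd_le[of m]) (auto simp: zdvd_def mult.commute)
lemma zdvd_z: "zdvd n c \<Longrightarrow> zdvd (Suc n) (z * c)"
  unfolding zdvd_def by (metis mult.assoc power_Suc)

text \<open>
  The sets \<open>Q j\<close> in the proof are the preimages of the powers of the maximal ideal of
  \<open>k[x,y,z]/(x\<^sup>2, y\<^sup>2, z\<^sup>4, y z\<^sup>3)\<close>, in which \<open>x y z\<^sup>2 \<noteq> 0\<close>.
\<close>
lemma Pw_5_coord: assumes "s \<in> Pw 5" shows "zdvd 4 (coord s 7)" "zdvd 3 (coord s 8)"
proof -
  \<comment> \<open>Conditions on the coordinates of \<open>1\<close>, \<open>y\<close>,
    \<open>x\<close>, \<open>x y\<close>: membership in the \<open>n\<close>-th power forces the
    missing degree into \<open>z\<close>, that is \<open>n\<close>, \<open>n - 1\<close>,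
    \<open>n - 1\<close>, \<open>n - 2\<close>. The caps 4, 3, 4, 3 come from \<open>z^4 = 0\<close>
    and \<open>y z^3 = 0\<close>; truncated subtraction makes the conditions vacuous in low
    degree.\<close>
  define Q where "Q n = {s \<in> S. zdvd (min 4 n) (coord s 0) \<and> zdvd (min 3 (n - 1)) (coord s 1) \<and>
    zdvd (min 4 (n - 1)) (coord s 7) \<and> zdvd (min 3 (n - 2)) (coord s 8)}" for n :: nat
  have zd0: "c \<in> V \<Longrightarrow> zdvd 0 c" for c unfolding zdvd_def by auto
  have cI: "coord e i = 0" if "e \<in> I" "i < 9" for e i using coord_I[OF I_S] that by blast
  have "Pw 5 \<subseteq> Q 5"
  proof (rule Pw_least[where N = 5])
    show "S \<subseteq> Q 0" using coord(1) zd0 by (auto simp: Q_def)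
    show "I \<subseteq> Q n" for n using I_S zdvd_zero by (auto simp: Q_def cI)
    show "s + t \<in> Q n" if "s \<in> Q n" "t \<in> Q n" for s t n
      using that by (auto simp: Q_def coord_add zdvd_add)
    fix n s assume "n < 5" and s: "s \<in> Q n"
    from s have sS: "s \<in> S" and d: "zdvd (min 4 n) (coord s 0)" "zdvd (min 3 (n - 1)) (coord s 1)"
      "zdvd (min 4 (n - 1)) (coord s 7)" "zdvd (min 3 (n - 2)) (coord s 8)" by (auto simp: Q_def)
    have "x * s \<in> Q (Suc n)"
      unfolding Q_def using sS coord(1)[OF sS]
      by (auto simp: coord_x mult_x_def intro!: zdvd_diff zdvd_mult intro: zdvd_le[OF d(1)] zdvd_le[OF d(2)[unfolded One_nat_def]])
    moreover have "y * s \<in> Q (Suc n)"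
      unfolding Q_def using sS coord(1)[OF sS]
      by (auto simp: coord_y mult_y_def intro!: zdvd_diff zdvd_mult intro: zdvd_le[OF d(1)] zdvd_le[OF d(3)])
    moreover have "z * s \<in> Q (Suc n)"
      unfolding Q_def using sS zdvd_z[OF d(1)] zdvd_z[OF d(2)] zdvd_z[OF d(3)] zdvd_z[OF d(4)]
      by (auto simp: coord_scale elim!: zdvd_le)
    ultimately show "x * s \<in> Q (Suc n) \<and> y * s \<in> Q (Suc n) \<and> z * s \<in> Q (Suc n)" by blast
  qed simp
  then show "zdvd 4 (coord s 7)" "zdvd 3 (coord s 8)" using assms by (auto simp: Q_def)
qed

text \<open>The coefficient of \<open>x\<close> in the first element forces \<open>z^3\<close> to
  divide the coefficient of \<open>x\<close> in \<open>r\<close>. The coefficient of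
  \<open>x y\<close> in the second element then makes \<open>z^2\<close> a multiple of
  \<open>z^3\<close>.\<close>

lemma no_lift:
  assumes r: "r \<in> S" and "y^6 - z * r \<in> Pw 5" and "y * r - (x * z^4 - x * y * z^2) \<in> Pw 5"
  shows False
proof -
  have "zdvd 4 (coord (y^6 - z * r) 7)" by (rule Pw_5_coord) fact
  then have "zdvd 4 (- (z * coord r 7))" using r y6_coord[of 7] by (simp add: coord_diff coord_scale)
  then have "zdvd 4 (z * coord r 7)" using zdvd_uminus by fastforce
  then obtain d where d: "d \<in> V" "z * coord r 7 = z ^ 4 * d" unfolding zdvd_def by blast
  then have "coord r 7 = z ^ 3 * d" by (simp add: eval_nat_numeral)
  then have d7: "zdvd 3 (coord r 7)" using d by (auto simp: zdvd_def)
  have c: "coord (x * z^4 - x * y * z^2) 8 = - (z^2)"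
    by (subst coord_eqI[where c = "(\<lambda>_. 0)(7 := z^4, 8 := - (z^2))"]) (auto simp: lin_comb_def algebra_simps)
  have "zdvd 3 (coord (y * r - (x * z^4 - x * y * z^2)) 8)" by (rule Pw_5_coord) fact
  then have "zdvd 3 (coord r 7 - coord r 6 * z^3 + z^2)" using r c by (simp add: coord_diff coord_y mult_y_def)
  then have "zdvd 3 ((coord r 7 - coord r 6 * z^3 + z^2) - (coord r 7 - coord r 6 * z^3))"
    using d7 coord(1)[OF r] by (intro zdvd_diff zdvd_mult) auto
  then obtain d where "d \<in> V" "z^2 = z^3 * d" by (auto simp: zdvd_def)
  then have "z * d = 1" by (simp add: eval_nat_numeral)
  then show False using z_unit_V \<open>d \<in> V\<close> by blast
qed

end

section \<open>The local ring\<close>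

lemma (in module) zero_submodule: "submodule {\<zero>\<^bsub>M\<^esub>} R M"
  by (rule submoduleI) auto

lemma (in module) carrier_submodule: "submodule (carrier M) R M"
  by (rule submoduleI) auto

lemma module_span_superset: "A \<subseteq> module_span R M A"
  unfolding module_span_def by blast
lemma module_span_least: "submodule N R M \<Longrightarrow> A \<subseteq> N \<Longrightarrow> module_span R M A \<subseteq> N"
  unfolding module_span_def by blast

lemma (in module) module_span_submodule:
  assumes "A \<subseteq> carrier M" shows "submodule (module_span R M A) R M"
proof (rule submoduleI)
  note sub = submodule.axioms(1)[THEN subgroup.subset] 
  show "module_span R M A \<subseteq> carrier M" by (rule module_span_least[OF carrier_submodule assms])
  show "\<zero>\<^bsub>M\<^esub> \<in> module_span R M A"
    unfolding module_span_def using submodule.axioms(1)[THEN subgroup.one_closed] by fastforce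
  show "\<ominus>\<^bsub>M\<^esub> a \<in> module_span R M A" if "a \<in> module_span R M A" for a
    unfolding module_span_def
  proof safe
    fix N assume N: "submodule N R M" "A \<subseteq> N"
    then have "a \<in> N" using that unfolding module_span_def by blast
    then show "\<ominus>\<^bsub>M\<^esub> a \<in> N" using N(1) subgroup.m_inv_closed[OF submodule.axioms(1)[OF N(1)]]
      by (simp add: a_inv_def)
  qed
  show "a \<oplus>\<^bsub>M\<^esub> b \<in> module_span R M A" if "a \<in> module_span R M A" "b \<in> module_span R M A" for a b
    unfolding module_span_def
  proof safe
    fix N assume N: "submodule N R M" "A \<subseteq> N"
    then have "a \<in> N" "b \<in> N" using that unfolding module_span_def by blast+
    then show "a \<oplus>\<^bsub>M\<^esub> b \<in> N" using subgroup.m_closed[OF submodule.axioms(1)[OF N(1)]] by simp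
  qed
  show "r \<odot>\<^bsub>M\<^esub> v \<in> module_span R M A" if "r \<in> carrier R" "v \<in> module_span R M A" for r v
    unfolding module_span_def
  proof safe
    fix N assume N: "submodule N R M" "A \<subseteq> N"
    then have "v \<in> N" using that unfolding module_span_def by blast
    then show "r \<odot>\<^bsub>M\<^esub> v \<in> N" using submodule.smult_closed[OF N(1)] that(1) by blast
  qed
qed

lemma (in module) ideal_smult_eq_zero_iff:
  assumes "J \<subseteq> carrier R"
  shows "ideal_smult R J M = {\<zero>\<^bsub>M\<^esub>} \<longleftrightarrow> (\<forall>a\<in>J. \<forall>v\<in>carrier M. a \<odot>\<^bsub>M\<^esub> v = \<zero>\<^bsub>M\<^esub>)"
proof
  let ?A = "{a \<odot>\<^bsub>M\<^esub> v | a v. a \<in> J \<and> v \<in> carrier M}"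
  assume "ideal_smult R J M = {\<zero>\<^bsub>M\<^esub>}"
  then have "?A \<subseteq> {\<zero>\<^bsub>M\<^esub>}"
    using module_span_superset[of ?A R M] unfolding ideal_smult_def by (simp only:)
  then show "\<forall>a\<in>J. \<forall>v\<in>carrier M. a \<odot>\<^bsub>M\<^esub> v = \<zero>\<^bsub>M\<^esub>" by blast
next
  let ?A = "{a \<odot>\<^bsub>M\<^esub> v | a v. a \<in> J \<and> v \<in> carrier M}"
  assume z: "\<forall>a\<in>J. \<forall>v\<in>carrier M. a \<odot>\<^bsub>M\<^esub> v = \<zero>\<^bsub>M\<^esub>"
  have "?A \<subseteq> carrier M" using assms by auto
  then have "\<zero>\<^bsub>M\<^esub> \<in> ideal_smult R J M"
    using subgroup.one_closed[OF submodule.axioms(1)[OF module_span_submodule]] unfolding ideal_smult_def by simp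
  moreover have "ideal_smult R J M \<subseteq> {\<zero>\<^bsub>M\<^esub>}"
    unfolding ideal_smult_def by (rule module_span_least[OF zero_submodule]) (use z in auto)
  ultimately show "ideal_smult R J M = {\<zero>\<^bsub>M\<^esub>}" by blast
qed

lemma (in cring) quot_module_is_module:
  assumes J: "ideal J R" shows "module R (quot_module R J)"
proof -
  interpret J: ideal J R by (rule J)
  interpret Q: cring "R Quot J" by (rule J.quotient_is_cring) (rule is_cring)
  interpret h: ring_hom_ring R "R Quot J" "(+>) J" by (rule J.rcos_ring_hom_ring)
  have simps: "carrier (quot_module R J) = carrier (R Quot J)" "add (quot_module R J) = add (R Quot J)"
    "ring.zero (quot_module R J) = ring.zero (R Quot J)"
    "\<And>r C. r \<odot>\<^bsub>quot_module R J\<^esub> C = (J +> r) \<otimes>\<^bsub>R Quot J\<^esub> C"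
    by (simp_all add: quot_module_def)
  show ?thesis
  proof (rule moduleI)
    show "abelian_group (quot_module R J)"
    proof (rule abelian_groupI)
      fix C assume "C \<in> carrier (quot_module R J)"
      then show "\<exists>D\<in>carrier (quot_module R J). D \<oplus>\<^bsub>quot_module R J\<^esub> C = \<zero>\<^bsub>quot_module R J\<^esub>"
        unfolding simps using Q.a_inv_closed Q.l_neg by blast
    qed (auto simp: simps Q.a_ac)
  qed (auto simp: simps is_cring Q.l_distr Q.r_distr Q.m_assoc)
qed

text \<open>The coset of \<open>1\<close> detects which scalars annihilate the quotient; Loewy
  lengths thereby become containments of ideals.\<close>

lemma (in cring) quot_module_annihilated_iff:
  assumes J: "ideal J R" and A: "A \<subseteq> carrier R"
  shows "ideal_smult R A (quot_module R J) = {\<zero>\<^bsub>quot_module R J\<^esub>} \<longleftrightarrow> A \<subseteq> J"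
proof -
  interpret J: ideal J R by (rule J)
  interpret Q: cring "R Quot J" by (rule J.quotient_is_cring) (rule is_cring)
  interpret h: ring_hom_ring R "R Quot J" "(+>) J" by (rule J.rcos_ring_hom_ring)
  interpret M: module R "quot_module R J" by (rule quot_module_is_module[OF J])
  have simps: "carrier (quot_module R J) = carrier (R Quot J)" 
    "ring.zero (quot_module R J) = ring.zero (R Quot J)"
    "\<And>r C. r \<odot>\<^bsub>quot_module R J\<^esub> C = (J +> r) \<otimes>\<^bsub>R Quot J\<^esub> C"
    by (simp_all add: quot_module_def)
  have zero: "J +> a = \<zero>\<^bsub>R Quot J\<^esub> \<longleftrightarrow> a \<in> J" if "a \<in> carrier R" for a
    using that J.a_rcos_const J.a_rcos_self unfolding FactRing_def by auto
  have "(\<forall>a\<in>A. \<forall>v\<in>carrier (R Quot J). (J +> a) \<otimes>\<^bsub>R Quot J\<^esub> v = \<zero>\<^bsub>R Quot J\<^esub>) \<longleftrightarrow> A \<subseteq> J"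
  proof
    assume "\<forall>a\<in>A. \<forall>v\<in>carrier (R Quot J). (J +> a) \<otimes>\<^bsub>R Quot J\<^esub> v = \<zero>\<^bsub>R Quot J\<^esub>"
    then have "J +> a = \<zero>\<^bsub>R Quot J\<^esub>" if "a \<in> A" for a
      using that A Q.one_closed Q.r_one h.hom_closed by (metis subsetD)
    then show "A \<subseteq> J" using zero A by blast
  next
    assume "A \<subseteq> J"
    then show "\<forall>a\<in>A. \<forall>v\<in>carrier (R Quot J). (J +> a) \<otimes>\<^bsub>R Quot J\<^esub> v = \<zero>\<^bsub>R Quot J\<^esub>"
      using zero A by (metis Q.l_null subsetD)
  qed
  then show ?thesis unfolding M.ideal_smult_eq_zero_iff[OF A] by (simp add: simps)
qed

section \<open>The residue ring R = S/I and its ideals\<close>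

context curve
begin

definition SR :: "'f ring" where
  "SR = \<lparr>carrier = S, monoid.mult = (*), one = 1, ring.zero = 0, add = (+)\<rparr>"

lemma SR_simps [simp]: "carrier SR = S" "s \<otimes>\<^bsub>SR\<^esub> t = s * t" "s \<oplus>\<^bsub>SR\<^esub> t = s + t" "\<zero>\<^bsub>SR\<^esub> = 0" "\<one>\<^bsub>SR\<^esub> = 1"
  by (simp_all add: SR_def)

lemma SR_cring: "cring SR" unfolding SR_def by (rule cring_of_subset) auto

lemma SR_uminus: "s \<in> S \<Longrightarrow> \<ominus>\<^bsub>SR\<^esub> s = - s"
  using abelian_group.minus_equality[of SR "- s" s] cring.axioms(1)[OF SR_cring]
  by (simp add: ring.is_abelian_group)

lemma I_ideal: "ideal I SR"
proof (rule idealI)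
  interpret cring SR by (rule SR_cring)
  show "ring SR" by (rule ring_axioms)
  show "subgroup I (add_monoid SR)"
    by (rule add.subgroupI) (use I_S SR_uminus I_zero in \<open>auto simp del: I_zero\<close>)
qed (auto simp: I_mult I_mult2)

definition R :: "'f set ring" where "R = SR Quot I"
definition res :: "'f \<Rightarrow> 'f set" where "res s = I +>\<^bsub>SR\<^esub> s"

lemma R_cring: "cring R" unfolding R_def by (rule ideal.quotient_is_cring[OF I_ideal SR_cring])

sublocale R: cring R by (rule R_cring)

lemma R_carrier: "carrier R = res ` S"
  unfolding R_def res_def FactRing_def A_RCOSETS_def' by auto

lemma res_closed [simp]: "s \<in> S \<Longrightarrow> res s \<in> carrier R" by (simp add: R_carrier)

lemma res_hom: "res \<in> ring_hom SR R" unfolding res_def[abs_def] R_def by (rule ideal.rcos_ring_hom[OF I_ideal])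

lemma res_add: "s \<in> S \<Longrightarrow> t \<in> S \<Longrightarrow> res (s + t) = res s \<oplus>\<^bsub>R\<^esub> res t"
  using ring_hom_add[OF res_hom, of s t] by simp
lemma res_mult: "s \<in> S \<Longrightarrow> t \<in> S \<Longrightarrow> res (s * t) = res s \<otimes>\<^bsub>R\<^esub> res t"
  using ring_hom_mult[OF res_hom, of s t] by simp
lemma res_one: "res 1 = \<one>\<^bsub>R\<^esub>" using ring_hom_one[OF res_hom] by simp
lemma res_zero: "res 0 = \<zero>\<^bsub>R\<^esub>"
  using ring_hom_zero[OF res_hom] SR_cring R_cring by (simp add: cring.axioms(1))
lemma res_uminus: assumes "s \<in> S" shows "res (- s) = \<ominus>\<^bsub>R\<^esub> res s"
  by (rule R.minus_equality[symmetric]) (use assms res_add[of "- s" s] in \<open>simp_all add: res_zero\<close>)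
lemma res_eq_zero: "s \<in> S \<Longrightarrow> res s = \<zero>\<^bsub>R\<^esub> \<longleftrightarrow> s \<in> I"
proof -
  assume s: "s \<in> S"
  interpret J: ideal I SR by (rule I_ideal)
  have "\<zero>\<^bsub>R\<^esub> = I" by (simp add: R_def FactRing_def)
  then show ?thesis unfolding res_def using J.a_rcos_const[of s] J.a_rcos_self[of s] s by auto
qed
lemma res_eq: "s \<in> S \<Longrightarrow> t \<in> S \<Longrightarrow> res s = res t \<longleftrightarrow> s - t \<in> I"
proof -
  assume st: "s \<in> S" "t \<in> S"
  have "res (s - t) = res s \<ominus>\<^bsub>R\<^esub> res t" using st res_add[of s "- t"] res_uminus[of t] by (simp add: R.minus_eq)
  then show ?thesis using res_eq_zero[of "s - t"] st by simp
qed
lemma ideal_res: assumes A: "sideal A" shows "ideal (res ` A) R"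
proof (rule idealI)
  note D = sidealD[OF A]
  show "ring R" by (rule R.ring_axioms)
  show "subgroup (res ` A) (add_monoid R)"
  proof (rule R.add.subgroupI)
    show "res ` A \<subseteq> carrier R" using D(1) by auto
    show "res ` A \<noteq> {}" using D(2)[OF I_zero] by auto
    fix u assume "u \<in> res ` A"
    then obtain s where s: "s \<in> A" "u = res s" by blast
    then have "\<ominus>\<^bsub>R\<^esub> u = res (- s)" using D(1) by (simp add: res_uminus)
    then show "\<ominus>\<^bsub>R\<^esub> u \<in> res ` A" using D(4)[OF s(1), of "-1"] by simp
  next
    fix u v assume "u \<in> res ` A" "v \<in> res ` A"
    then show "u \<oplus>\<^bsub>R\<^esub> v \<in> res ` A" using D(1,3) by (auto simp flip: res_add)
  qed
next
  note D = sidealD[OF A]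
  fix u r assume "u \<in> res ` A" "r \<in> carrier R"
  then obtain s t where st: "s \<in> A" "u = res s" "t \<in> S" "r = res t" unfolding R_carrier by blast
  then have "r \<otimes>\<^bsub>R\<^esub> u = res (t * s)" using D(1) by (simp add: res_mult)
  then show "r \<otimes>\<^bsub>R\<^esub> u \<in> res ` A" using D(4) st by simp
  then show "u \<otimes>\<^bsub>R\<^esub> r \<in> res ` A" using st D(1) by (simp add: R.m_comm)
qed

lemma res_mem_iff: assumes A: "sideal A" and s: "s \<in> S" shows "res s \<in> res ` A \<longleftrightarrow> s \<in> A"
proof
  note D = sidealD[OF A]
  assume "res s \<in> res ` A"
  then obtain t where t: "t \<in> A" "res s = res t" by blast
  then have "s - t \<in> A" using res_eq[of s t] D(1,2) s by simp
  from D(3)[OF this t(1)] show "s \<in> A" by simp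
qed auto

lemmas nn_ideal = ideal_res[OF sideal_nn] and Pw_ideal = ideal_res[OF sideal_Pw]
lemmas res_nn_iff = res_mem_iff[OF sideal_nn]

lemma ideal_subset_nn:
  assumes J: "ideal J R" "J \<noteq> carrier R" shows "J \<subseteq> res ` nn"
proof
  interpret J: ideal J R by (rule J)
  fix u assume u: "u \<in> J"
  then obtain s where s: "s \<in> S" "u = res s" using J.Icarr R_carrier by blast
  show "u \<in> res ` nn"
  proof (rule ccontr)
    assume "u \<notin> res ` nn"
    then have "s \<notin> nn" using s by blast
    from unitI[OF s(1) this] have i: "s \<noteq> 0" "inverse s \<in> S" by auto
    then have "res (inverse s) \<otimes>\<^bsub>R\<^esub> u = \<one>\<^bsub>R\<^esub>" using s by (simp add: res_one flip: res_mult)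
    then have "\<one>\<^bsub>R\<^esub> \<in> J" using J.I_l_closed[OF u, of "res (inverse s)"] i by simp
    then show False using J.one_imp_carrier J(2) by blast
  qed
qed

lemma nn_proper: "res ` nn \<noteq> carrier R"
  using res_nn_iff[of 1] one_nn res_closed[of 1] by auto

lemma nn_maximal: "maximalideal (res ` nn) R"
proof (rule maximalidealI)
  fix J assume "ideal J R" "res ` nn \<subseteq> J"
  then show "J = res ` nn \<or> J = carrier R" using ideal_subset_nn[of J] by blast
qed (use nn_ideal nn_proper in auto)

lemma max_ideal_R: "max_ideal R = res ` nn"
  unfolding max_ideal_def
proof (rule the_equality)
  fix J assume J: "maximalideal J R"
  then have "ideal J R" "J \<noteq> carrier R" by (auto simp: maximalideal_def maximalideal_axioms_def)
  then have "J \<subseteq> res ` nn" by (rule ideal_subset_nn)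
  then show "J = res ` nn"
    using maximalideal.I_maximal[OF J nn_ideal] ideal.Icarr[OF nn_ideal] nn_proper by blast
qed (rule nn_maximal)

text \<open>Matches ideal powers with the recursion for \<open>Pw\<close>: products of generators
  land in the next level by \<open>Pw_nn\<close>, and conversely the three elements
  \<open>x\<close>, \<open>y\<close>, \<open>z\<close> account for every factor from the maximal
  ideal.\<close>

lemma max_ideal_power_R: "max_ideal_power R n = res ` Pw n"
proof (induction n)
  case 0
  then show ?case by (simp add: max_ideal_power_def ideals_set_def nat_pow_def R_carrier)
next
  case (Suc n)
  have "max_ideal_power R (Suc n) = max_ideal_power R n \<cdot>\<^bsub>R\<^esub> max_ideal R"
    by (simp add: max_ideal_power_def nat_pow_def ideals_set_def)
  also have "\<dots> = res ` Pw n \<cdot>\<^bsub>R\<^esub> res ` nn" by (simp only: Suc max_ideal_R)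
  also have "\<dots> = res ` Pw (Suc n)"
  proof (rule equalityI; rule subsetI)
    fix u assume "u \<in> res ` Pw n \<cdot>\<^bsub>R\<^esub> res ` nn"
    then show "u \<in> res ` Pw (Suc n)"
    proof (induction rule: ideal_prod.induct)
      case (prod i j)
      then obtain s t where "s \<in> Pw n" "t \<in> nn" "i = res s" "j = res t" by blast
      moreover from this have "s \<in> S" "t \<in> S" using Pw_S nn_S by auto
      ultimately have "i \<otimes>\<^bsub>R\<^esub> j = res (s * t)" "s * t \<in> Pw (Suc n)" using Pw_nn by (simp_all only: res_mult)
      then show ?case by blast
    next
      case (sum s1 s2)
      then show ?case using additive_subgroup.a_closed[OF ideal.axioms(1)[OF Pw_ideal]] by blast
    qed
  next
    fix u assume "u \<in> res ` Pw (Suc n)"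
    then obtain a b c e where u: "u = res (x * a + y * b + z * c + e)" and P: "a \<in> Pw n" "b \<in> Pw n" "c \<in> Pw n" "e \<in> I"
      by auto
    then have S: "a \<in> S" "b \<in> S" "c \<in> S" "e \<in> S" using Pw_S I_S by auto
    have "u = res a \<otimes>\<^bsub>R\<^esub> res x \<oplus>\<^bsub>R\<^esub> res b \<otimes>\<^bsub>R\<^esub> res y \<oplus>\<^bsub>R\<^esub> res c \<otimes>\<^bsub>R\<^esub> res z"
      unfolding u using S P(4) res_eq_zero[of e] by (simp add: res_add res_mult R.m_comm)
    also have "\<dots> \<in> res ` Pw n \<cdot>\<^bsub>R\<^esub> res ` nn" using P by (intro ideal_prod.sum ideal_prod.prod) auto
    finally show "u \<in> res ` Pw n \<cdot>\<^bsub>R\<^esub> res ` nn" .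
  qed
  finally show ?case .
qed

lemma Idl_res: assumes "t \<in> S" shows "Idl\<^bsub>R\<^esub> {res t} = res ` princ t"
proof -
  have "Idl\<^bsub>R\<^esub> {res t} = {r \<otimes>\<^bsub>R\<^esub> res t | r. r \<in> carrier R}"
    using R.cgenideal_eq_genideal[of "res t"] assms by (simp add: cgenideal_def)
  also have "\<dots> = res ` princ t"
  proof safe
    fix r assume "r \<in> carrier R"
    then obtain s where "s \<in> S" "r = res s" unfolding R_carrier by blast
    then have "r \<otimes>\<^bsub>R\<^esub> res t = res (t * s)" using assms by (simp add: res_mult R.m_comm)
    then show "r \<otimes>\<^bsub>R\<^esub> res t \<in> res ` princ t" using princ_self[OF \<open>s \<in> S\<close>] by blast
  next
    fix u assume "u \<in> princ t"
    then obtain s where s: "s \<in> S" "u - t * s \<in> I" by (rule princE)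
    have "u \<in> S" using \<open>u \<in> princ t\<close> princ_S[OF assms] by blast
    then have "res u = res s \<otimes>\<^bsub>R\<^esub> res t" using s res_eq[of u "t * s"] assms by (simp add: res_mult R.m_comm)
    then show "\<exists>r. res u = r \<otimes>\<^bsub>R\<^esub> res t \<and> r \<in> carrier R" using s by auto
  qed
  finally show ?thesis .
qed

lemma Pw_subset_princ_iff: "t \<in> S \<Longrightarrow> res ` Pw n \<subseteq> res ` princ t \<longleftrightarrow> Pw n \<subseteq> princ t"
  using res_mem_iff[OF sideal_princ] Pw_S by blast

section \<open>Prime ideals and Krull dimension\<close>

definition prime_preimage :: "'f set set \<Rightarrow> 'f set" where "prime_preimage P = {s \<in> S. res s \<in> P}"

lemma prime_preimage:
  assumes "primeideal P R"
  shows "I \<subseteq> prime_preimage P" "\<And>s t. s \<in> prime_preimage P \<Longrightarrow> t \<in> prime_preimage P \<Longrightarrow> s + t \<in> prime_preimage P"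
    "\<And>s t. s \<in> prime_preimage P \<Longrightarrow> t \<in> S \<Longrightarrow> t * s \<in> prime_preimage P"
    "\<And>s t. s \<in> S \<Longrightarrow> t \<in> S \<Longrightarrow> s * t \<in> prime_preimage P \<Longrightarrow> s \<in> prime_preimage P \<or> t \<in> prime_preimage P"
    "1 \<notin> prime_preimage P"
proof -
  interpret P: primeideal P R by fact
  show "I \<subseteq> prime_preimage P"
  proof
    fix e assume e: "e \<in> I"
    then have "res e = \<zero>\<^bsub>R\<^esub>" using res_eq_zero[OF I_S] by blast
    then show "e \<in> prime_preimage P" using P.zero_closed I_S[OF e] by (simp add: prime_preimage_def)
  qed
  show "s + t \<in> prime_preimage P" if "s \<in> prime_preimage P" "t \<in> prime_preimage P" for s t
    using that by (auto simp: prime_preimage_def res_add)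
  show "t * s \<in> prime_preimage P" if "s \<in> prime_preimage P" "t \<in> S" for s t
    using that P.I_l_closed by (auto simp: prime_preimage_def res_mult)
  show "s \<in> prime_preimage P \<or> t \<in> prime_preimage P" if "s \<in> S" "t \<in> S" "s * t \<in> prime_preimage P" for s t
    using that P.I_prime[of "res s" "res t"] by (auto simp: prime_preimage_def res_mult)
  show "1 \<notin> prime_preimage P" using P.one_imp_carrier P.I_notcarr by (auto simp: prime_preimage_def res_one)
qed

lemma prime_power: 
  assumes "primeideal P R" "s \<in> S" "s ^ n \<in> prime_preimage P" shows "s \<in> prime_preimage P"
  using assms(3)
proof (induction n)
  case 0 then show ?case using prime_preimage(5)[OF assms(1)] by simp
next
  case (Suc n) then show ?case using prime_preimage(4)[OF assms(1), of s "s ^ n"] assms(2) by auto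
qed

text \<open>Modulo \<open>I\<close>, \<open>y^7\<close> is a multiple of \<open>z\<close> and
  \<open>x^2\<close> equals \<open>y^5\<close>, so a prime with \<open>z\<close> also contains
  \<open>y\<close> and then \<open>x\<close>.\<close>

lemma prime_containing_z:
  assumes P: "primeideal P R" "z \<in> prime_preimage P" shows "P = res ` nn"
proof -
  interpret P: primeideal P R by fact
  note pp = prime_preimage[OF P(1)]
  have z: "z * s \<in> prime_preimage P" if "s \<in> S" for s using pp(3)[OF P(2) that] by (simp add: mult.commute)
  have "y ^ 7 = (y^7 - (z^5 * x - z^3 * (x * y))) + z * (z^4 * x - z^2 * (x * y))"
    by (simp add: algebra_simps eval_nat_numeral)
  also have "\<dots> \<in> prime_preimage P" by (rule pp(2)) (use pp(1) y7 z in auto)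
  finally have y: "y \<in> prime_preimage P" by (rule prime_power[OF P(1) yS])
  have "x ^ 2 = (x^2 - y^5) + y^4 * y" by (simp add: algebra_simps eval_nat_numeral)
  also have "\<dots> \<in> prime_preimage P" by (rule pp(2)) (use pp(1) relation_I pp(3)[OF y] in auto)
  finally have x: "x \<in> prime_preimage P" by (rule prime_power[OF P(1) xS])
  have "nn \<subseteq> prime_preimage P"
  proof
    fix s assume "s \<in> nn"
    then obtain a b c where s: "s = x * a + y * b + z * c" "a \<in> S" "b \<in> S" "c \<in> S" by (elim nnE)
    then have "a * x + b * y + c * z \<in> prime_preimage P" using x y P(2) by (intro pp(2) pp(3))
    then show "s \<in> prime_preimage P" using s(1) by (simp add: mult.commute)
  qed
  then have "res ` nn \<subseteq> P" by (auto simp: prime_preimage_def)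
  then show ?thesis using ideal_subset_nn[OF P.is_ideal] P.I_notcarr by blast
qed

lemma prime_subset_nn: assumes "primeideal P R" shows "P \<subseteq> res ` nn"
proof -
  interpret P: primeideal P R by fact
  show ?thesis using ideal_subset_nn[OF P.is_ideal] P.I_notcarr by blast
qed

text \<open>For \<open>a\<close> in \<open>P1\<close> but not in \<open>P0\<close>, the relation
  \<open>a^j (z^n + a w) = 0\<close> puts \<open>z^n + a w\<close> in \<open>P0\<close>, hence
  \<open>z\<close> in \<open>P1\<close>. Then \<open>P1\<close> is already maximal.\<close>

lemma no_prime_chain:
  assumes "primeideal P0 R" "primeideal P1 R" "primeideal P2 R" "P0 \<subset> P1" "P1 \<subset> P2"
  shows False
proof -
  note p0 = prime_preimage[OF assms(1)] and p1 = prime_preimage[OF assms(2)]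
  have z: "z \<notin> prime_preimage P1"
  proof
    assume "z \<in> prime_preimage P1"
    then have "P1 = res ` nn" using prime_containing_z[OF assms(2)] by blast
    moreover have "P2 \<subseteq> res ` nn" by (rule prime_subset_nn[OF assms(3)])
    ultimately show False using assms(5) by blast
  qed
  obtain u where u: "u \<in> P1" "u \<notin> P0" using assms(4) by blast
  have "u \<in> carrier R" using prime_subset_nn[OF assms(2)] u(1) ideal.Icarr[OF nn_ideal] by blast
  then obtain a where a: "a \<in> S" "u = res a" unfolding R_carrier by blast
  then have a1: "a \<in> prime_preimage P1" and a0: "a \<notin> prime_preimage P0" using u by (auto simp: prime_preimage_def)
  obtain n w j where w: "w \<in> S" "a ^ j * (z ^ n + a * w) \<in> I" using algebraic[OF a(1)] by blast
  then have "a ^ j \<in> prime_preimage P0 \<or> z ^ n + a * w \<in> prime_preimage P0"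
    using a(1) p0(1) by (intro p0(4)) auto
  then have "z ^ n + a * w \<in> prime_preimage P0" using prime_power[OF assms(1) a(1)] a0 by blast
  then have "z ^ n + a * w \<in> prime_preimage P1" using assms(4) by (auto simp: prime_preimage_def)
  from p1(2)[OF this p1(3)[OF a1, of "- w"]] have "z ^ n \<in> prime_preimage P1" using w by (simp add: algebra_simps)
  then show False using prime_power[OF assms(2) zS] z by blast
qed

text \<open>An ideal maximal among those without powers of \<open>z\<close> is prime. The collection
  is nonempty because \<open>z\<close> is a nonzerodivisor modulo \<open>I\<close>, which puts
  \<open>I\<close> itself in it.\<close>

lemma ex_prime_without_z: "\<exists>P. primeideal P R \<and> res z \<notin> P"
proof -
  define \<A> where "\<A> = {A. sideal A \<and> (\<forall>n. z ^ n \<notin> A)}"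
  have "sideal I" by (rule sidealI) (auto simp: I_S I_mult)
  then have "I \<in> \<A>" using z_power_cancel[of 1] one_notin_I unfolding \<A>_def by auto
  moreover have "\<Union>C \<in> \<A>" if C: "C \<noteq> {}" "subset.chain \<A> C" for C
  proof -
    have CA: "A \<in> \<A>" if "A \<in> C" for A using C that by (auto simp: subset.chain_def)
    have tot: "A \<subseteq> B \<or> B \<subseteq> A" if "A \<in> C" "B \<in> C" for A B using C that by (auto simp: subset.chain_def)
    have "s + t \<in> \<Union>C" if "s \<in> \<Union>C" "t \<in> \<Union>C" for s t
    proof -
      from that obtain A B where AB: "A \<in> C" "B \<in> C" "s \<in> A" "t \<in> B" by blast
      then obtain D where "D \<in> C" "s \<in> D" "t \<in> D" using tot[of A B] by blast
      then have "sideal D" using CA[of D] unfolding \<A>_def by blast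
      then show ?thesis using \<open>D \<in> C\<close> \<open>s \<in> D\<close> \<open>t \<in> D\<close> by (metis UnionI sidealD(3))
    qed
    moreover have CD: "sideal A" if "A \<in> C" for A using CA[OF that] unfolding \<A>_def by blast
    ultimately have "sideal (\<Union>C)"
      using C(1) sidealD(1,2,4)[OF CD] by (intro sidealI) (blast, blast, blast, blast)
    then show ?thesis using CA unfolding \<A>_def by blast
  qed
  ultimately obtain A where A: "A \<in> \<A>" "\<And>B. B \<in> \<A> \<Longrightarrow> A \<subseteq> B \<Longrightarrow> B = A"
    using subset_Zorn_nonempty[of \<A>] by blast
  have sA: "sideal A" and Az: "\<And>n. z ^ n \<notin> A" using A(1) unfolding \<A>_def by blast+
  note AS = sidealD(1,2)[OF sA] and Aadd = sidealD(3)[OF sA] and Amult = sidealD(4)[OF sA]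
  have A0: "0 \<in> A" by (rule AS(2)[OF I_zero])
  note mem = res_mem_iff[OF sA]
  \<comment> \<open>Maximality of \<open>A\<close>: adjoining any further element produces a power
    of \<open>z\<close>. Multiplying two such expressions gives primality.\<close>
  have extend: "\<exists>n. \<exists>a\<in>A. \<exists>v\<in>S. z ^ n = a + v * s" if s: "s \<in> S" "s \<notin> A" for s
  proof (rule ccontr)
    assume no: "\<not> ?thesis"
    define B where "B = {a + v * s | a v. a \<in> A \<and> v \<in> S}"
    have BI: "a + v * s \<in> B" if "a \<in> A" "v \<in> S" for a v using that unfolding B_def by blast
    have "u + u' \<in> B" if "u \<in> B" "u' \<in> B" for u u'
    proof -
      from that obtain a v a' v' where "u = a + v * s" "u' = a' + v' * s" "a \<in> A" "v \<in> S" "a' \<in> A" "v' \<in> S"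
        unfolding B_def by blast
      then show ?thesis using BI[of "a + a'" "v + v'"] Aadd by (simp add: algebra_simps)
    qed
    moreover have "t * u \<in> B" if "u \<in> B" "t \<in> S" for u t
    proof -
      from that obtain a v where "u = a + v * s" "a \<in> A" "v \<in> S" unfolding B_def by blast
      then show ?thesis using BI[of "t * a" "t * v"] Amult that(2) by (simp add: algebra_simps)
    qed
    moreover have "A \<subseteq> B" using BI[of _ 0] by auto
    moreover have "B \<subseteq> S" using AS s unfolding B_def by auto
    moreover have "z ^ n \<notin> B" for n using no unfolding B_def by blast
    ultimately have "B \<in> \<A>" using AS unfolding \<A>_def sideal_def by blast
    then have "B = A" using A(2) \<open>A \<subseteq> B\<close> by blast
    then show False using BI[OF A0 S_one] s by simp
  qed
  have "primeideal (res ` A) R"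
  proof (rule primeidealI)
    show "ideal (res ` A) R" by (rule ideal_res[OF sA])
    show "carrier R \<noteq> res ` A" using mem[OF S_one] Az[of 0] res_closed[OF S_one] by (metis power_0)
    fix u v assume uv: "u \<in> carrier R" "v \<in> carrier R" "u \<otimes>\<^bsub>R\<^esub> v \<in> res ` A"
    then obtain s t where st: "s \<in> S" "u = res s" "t \<in> S" "v = res t" unfolding R_carrier by blast
    then have stA: "s * t \<in> A" using uv mem[of "s * t"] by (simp add: res_mult)
    show "u \<in> res ` A \<or> v \<in> res ` A"
    proof (rule ccontr)
      assume "\<not> ?thesis"
      then have "s \<notin> A" "t \<notin> A" using st by auto
      then obtain n a p m b q where 1: "z ^ n = a + p * s" "a \<in> A" "p \<in> S" and 2: "z ^ m = b + q * t" "b \<in> A" "q \<in> S"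
        using extend st by meson
      have "z ^ (n + m) = (b + q * t) * a + (p * s) * b + (p * q) * (s * t)"
        by (simp add: power_add 1 2 algebra_simps)
      also have "\<dots> \<in> A"
        by (rule Aadd[OF Aadd[OF Amult[OF 1(2)] Amult[OF 2(2)]] Amult[OF stA]]) (use 1 2 st AS in auto)
      finally show False using Az by blast
    qed
  qed (rule R_cring)
  moreover have "res z \<notin> res ` A" using mem[of z] Az[of 1] by simp
  ultimately show ?thesis by blast
qed

lemma krull_dim_R: "krull_dim R = 1"
proof (rule antisym)
  let ?C = "\<lambda>n P. (\<forall>i\<le>n. primeideal (P i) R) \<and> (\<forall>i<n. P i \<subset> P (Suc i))"
  have "n \<le> 1" if "?C n P" for n and P :: "nat \<Rightarrow> 'f set set"
  proof (rule ccontr)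
    assume "\<not> n \<le> 1"
    then have "primeideal (P 0) R" "primeideal (P 1) R" "primeideal (P 2) R" "P 0 \<subset> P 1" "P 1 \<subset> P 2"
      using that by (auto simp: numeral_2_eq_2)
    then show False by (rule no_prime_chain)
  qed
  then show "krull_dim R \<le> 1" unfolding krull_dim_def
    by (intro Sup_least) (auto simp: one_enat_def)
  obtain P where P: "primeideal P R" "res z \<notin> P" using ex_prime_without_z by blast
  define Q where "Q = (\<lambda>i::nat. if i = 0 then P else res ` nn)"
  have "P \<subseteq> res ` nn" by (rule prime_subset_nn[OF P(1)])
  moreover have "P \<noteq> res ` nn" using P(2) by auto
  moreover have "primeideal (res ` nn) R" by (rule R.maximalideal_prime[OF nn_maximal])
  ultimately have "?C 1 Q" using P(1) by (auto simp: Q_def)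
  then have "enat 1 \<in> {enat n | n. \<exists>P. ?C n P}" by blast
  then show "1 \<le> krull_dim R" unfolding krull_dim_def one_enat_def by (rule Sup_upper)
qed

section \<open>Loewy lengths of quotients by a parameter\<close>

lemma loewy_length_R:
  assumes "t \<in> S"
  shows "loewy_length R (quot_module R (Idl\<^bsub>R\<^esub> {res t})) = Inf {enat n | n. Pw n \<subseteq> princ t}"
proof -
  have "ideal (res ` princ t) R" by (rule ideal_res[OF sideal_princ[OF assms]])
  moreover have "res ` Pw n \<subseteq> carrier R" for n using ideal.Icarr[OF Pw_ideal] by blast
  ultimately have "ideal_smult R (max_ideal_power R n) (quot_module R (Idl\<^bsub>R\<^esub> {res t}))
      = {\<zero>\<^bsub>quot_module R (Idl\<^bsub>R\<^esub> {res t})\<^esub>} \<longleftrightarrow> Pw n \<subseteq> princ t" for n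
    unfolding Idl_res[OF assms] max_ideal_power_R
    by (simp add: R.quot_module_annihilated_iff Pw_subset_princ_iff[OF assms])
  then show ?thesis unfolding loewy_length_def by simp
qed

lemma parameter_iff:
  "t \<in> nn \<Longrightarrow> system_of_parameters R [res t] \<longleftrightarrow> (\<exists>n. Pw n \<subseteq> princ t)"
  using nn_S[of t] by (simp add: system_of_parameters_def krull_dim_R one_enat_def max_ideal_R
      max_ideal_power_R Idl_res Pw_subset_princ_iff)

lemma system_of_parameters_R:
  assumes "system_of_parameters R rs"
  obtains t n where "t \<in> nn" "rs = [res t]" "Pw n \<subseteq> princ t"
proof -
  have "length rs = 1" using assms by (simp add: system_of_parameters_def krull_dim_R one_enat_def)
  then obtain r where rs: "rs = [r]" by (metis One_nat_def length_0_conv length_Suc_conv)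
  with assms obtain t where t: "t \<in> nn" "r = res t" by (auto simp: system_of_parameters_def max_ideal_R)
  with assms rs parameter_iff obtain n where "Pw n \<subseteq> princ t" by blast
  with rs t show ?thesis using that by blast
qed

theorem gen_loewy_length_R: "gen_loewy_length R = 6"
proof (rule antisym)
  have "y - z \<in> nn" using nn_add[OF xyz_nn(2) nn_uminus[OF xyz_nn(3)]] by simp
  then have "system_of_parameters R [res (y - z)]"
    using parameter_iff power6_in_princ by blast
  then have "gen_loewy_length R \<le> loewy_length R (quot_module R (Idl\<^bsub>R\<^esub> (set [res (y - z)])))"
    unfolding gen_loewy_length_def by (intro Inf_lower) blast
  also have "\<dots> \<le> enat 6"
    using power6_in_princ by (simp add: loewy_length_R) (intro Inf_lower, blast)
  finally show "gen_loewy_length R \<le> 6" by (simp add: numeral_eq_enat)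
  show "6 \<le> gen_loewy_length R"
    unfolding gen_loewy_length_def
  proof (rule Inf_greatest)
    fix l assume "l \<in> {loewy_length R (quot_module R (Idl\<^bsub>R\<^esub> (set rs))) | rs. system_of_parameters R rs}"
    then obtain rs where rs: "system_of_parameters R rs" "l = loewy_length R (quot_module R (Idl\<^bsub>R\<^esub> (set rs)))" by blast
    then obtain t m where t: "t \<in> nn" "Pw m \<subseteq> princ t" "l = loewy_length R (quot_module R (Idl\<^bsub>R\<^esub> {res t}))"
      using system_of_parameters_R[OF rs(1)] by (metis empty_set list.simps(15))
    have "n \<ge> 6" if "Pw n \<subseteq> princ t" for n
    proof (rule ccontr)
      assume "\<not> n \<ge> 6"
      then have "Pw 5 \<subseteq> Pw n" by (intro Pw_antimono) simp
      then show False using power5_not_in_princ[OF t(1)] t(2) that by blast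
    qed
    then show "6 \<le> l" unfolding t(3) loewy_length_R[OF nn_S[OF t(1)]]
      by (intro Inf_greatest) (auto simp: numeral_eq_enat)
  qed
qed

end

section \<open>Modules over the local ring\<close>

locale curve_module = curve S I V x y z + M: module "curve.R S I" M
  for S I V :: "'f::field set" and x y z :: 'f and M :: "('f set, 'a, 'd) module_scheme" (structure)
begin

text \<open>Elements of \<open>S\<close> act through their classes, so scalar identities can be
  computed in the field instead of among cosets.\<close>

definition act :: "'f \<Rightarrow> 'a \<Rightarrow> 'a" (infixr "\<bullet>" 75) where "s \<bullet> v = res s \<odot> v"

lemma act_closed [simp]: "s \<in> S \<Longrightarrow> v \<in> carrier M \<Longrightarrow> s \<bullet> v \<in> carrier M"
  by (simp add: act_def)
lemma act_add: "s \<in> S \<Longrightarrow> t \<in> S \<Longrightarrow> v \<in> carrier M \<Longrightarrow> (s + t) \<bullet> v = s \<bullet> v \<oplus> t \<bullet> v"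
  by (simp add: act_def res_add M.smult_l_distr)
lemma act_radd: "s \<in> S \<Longrightarrow> u \<in> carrier M \<Longrightarrow> v \<in> carrier M \<Longrightarrow> s \<bullet> (u \<oplus> v) = s \<bullet> u \<oplus> s \<bullet> v"
  by (simp add: act_def M.smult_r_distr)
lemma act_mult: "s \<in> S \<Longrightarrow> t \<in> S \<Longrightarrow> v \<in> carrier M \<Longrightarrow> (s * t) \<bullet> v = s \<bullet> (t \<bullet> v)"
  by (simp add: act_def res_mult M.smult_assoc1)
lemma act_comm: "s \<in> S \<Longrightarrow> t \<in> S \<Longrightarrow> v \<in> carrier M \<Longrightarrow> s \<bullet> (t \<bullet> v) = t \<bullet> (s \<bullet> v)"
  using act_mult[of s t v] act_mult[of t s v] by (simp add: mult.commute)
lemma act_one [simp]: "v \<in> carrier M \<Longrightarrow> 1 \<bullet> v = v"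
  by (simp add: act_def res_one)
lemma act_zero [simp]: "v \<in> carrier M \<Longrightarrow> 0 \<bullet> v = \<zero>"
  by (simp add: act_def res_zero)
lemma act_rzero [simp]: "s \<in> S \<Longrightarrow> s \<bullet> \<zero> = \<zero>"
  by (simp add: act_def)
lemma act_uminus: "s \<in> S \<Longrightarrow> v \<in> carrier M \<Longrightarrow> (- s) \<bullet> v = \<ominus> (s \<bullet> v)"
  by (simp add: act_def res_uminus M.smult_l_minus)
lemma act_rminus: "s \<in> S \<Longrightarrow> v \<in> carrier M \<Longrightarrow> s \<bullet> (\<ominus> v) = \<ominus> (s \<bullet> v)"
  by (simp add: act_def M.smult_r_minus)
lemma act_diff: "s \<in> S \<Longrightarrow> t \<in> S \<Longrightarrow> v \<in> carrier M \<Longrightarrow> (s - t) \<bullet> v = s \<bullet> v \<ominus> t \<bullet> v"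
  using act_add[of s "- t" v] by (simp add: act_uminus M.minus_eq)
lemma act_rdiff: "s \<in> S \<Longrightarrow> u \<in> carrier M \<Longrightarrow> v \<in> carrier M \<Longrightarrow> s \<bullet> (u \<ominus> v) = s \<bullet> u \<ominus> s \<bullet> v"
  by (simp add: act_radd act_rminus M.minus_eq)
lemma act_I: "e \<in> I \<Longrightarrow> v \<in> carrier M \<Longrightarrow> e \<bullet> v = \<zero>"
  using res_eq_zero[OF I_S, of e] by (simp add: act_def)
lemma act_cong: assumes "s \<in> S" "t \<in> S" "s - t \<in> I" "v \<in> carrier M" shows "s \<bullet> v = t \<bullet> v"
  using res_eq[of s t] assms by (simp add: act_def)

lemma add_diff_cancel: "p \<in> carrier M \<Longrightarrow> q \<in> carrier M \<Longrightarrow> p \<oplus> q \<ominus> p = q"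
  by (simp add: M.minus_eq M.a_comm[of p q] M.a_assoc M.r_neg)

lemma diff_add_cancel: "p \<in> carrier M \<Longrightarrow> q \<in> carrier M \<Longrightarrow> p \<ominus> (p \<oplus> q) = \<ominus> q"
  by (simp add: M.minus_eq M.minus_add M.r_neg2)

definition z_regular :: bool where
  "z_regular \<longleftrightarrow> (\<forall>v\<in>carrier M. z \<bullet> v = \<zero> \<longrightarrow> v = \<zero>)"

lemma z_regular_power:
  "z_regular \<Longrightarrow> v \<in> carrier M \<Longrightarrow> z ^ n \<bullet> v = \<zero> \<Longrightarrow> v = \<zero>"
proof (induction n)
  case (Suc n)
  then show ?case unfolding z_regular_def by (metis act_closed act_mult power_Suc S_power zS)
qed auto

lemma z_regular_V:
  assumes "z_regular" "c \<in> V" "v \<in> carrier M" "c \<bullet> v = \<zero>" "v \<noteq> \<zero>" shows "c = 0"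
proof (rule ccontr)
  assume "c \<noteq> 0"
  then obtain n u where u: "u \<in> V" "inverse u \<in> V" "u \<noteq> 0" "c = z ^ n * u" using V_val assms(2) by blast
  have "inverse u * c = z ^ n" using u by simp
  moreover have "(inverse u * c) \<bullet> v = inverse u \<bullet> (c \<bullet> v)"
    by (rule act_mult[OF VS[OF u(2)] VS[OF assms(2)] assms(3)])
  ultimately have "z ^ n \<bullet> v = inverse u \<bullet> (c \<bullet> v)" by (simp only:)
  also have "\<dots> = \<zero>" by (simp only: assms(4) act_rzero VS[OF u(2)])
  finally show False using z_regular_power assms by blast
qed

lemma V_unit_or_zdvd: assumes "a \<in> V" shows "(a \<noteq> 0 \<and> inverse a \<in> V) \<or> (\<exists>a'\<in>V. a = z * a')"
proof (cases "a = 0")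
  case False
  then obtain n u where u: "u \<in> V" "inverse u \<in> V" "u \<noteq> 0" "a = z ^ n * u" using V_val assms by blast
  show ?thesis
  proof (cases n)
    case (Suc m) then show ?thesis using u by (intro disjI2 bexI[of _ "z ^ m * u"]) (simp_all add: mult.assoc)
  qed (use u in simp)
qed (auto intro: bexI[of _ 0])

text \<open>Divisibility in a valuation ring is total: the exponents of \<open>z\<close> are
  compared. The second alternative records \<open>a \<noteq> 0\<close>, which allows cancellation by
  \<open>a\<close> afterwards.\<close>

lemma V_total: assumes "a \<in> V" "c \<in> V" "c \<noteq> 0" shows "(\<exists>d\<in>V. a = c * d) \<or> (a \<noteq> 0 \<and> (\<exists>d\<in>V. c = a * d))"
proof (cases "a = 0")
  case False
  obtain n u where u: "u \<in> V" "inverse u \<in> V" "u \<noteq> 0" "a = z ^ n * u" using V_val assms False by blast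
  obtain m w where w: "w \<in> V" "inverse w \<in> V" "w \<noteq> 0" "c = z ^ m * w" using V_val assms by blast
  show ?thesis
  proof (cases "m \<le> n")
    case True
    then have "z ^ n = z ^ m * z ^ (n - m)" by (simp flip: power_add)
    then have "a = (z ^ m * z ^ (n - m)) * u * (w * inverse w)"
      by (simp only: u(4) right_inverse[OF w(3)] mult_1_right)
    also have "\<dots> = c * (z ^ (n - m) * (u * inverse w))" by (simp only: w(4) mult_ac)
    finally have "a = c * (z ^ (n - m) * (u * inverse w))" .
    moreover have "z ^ (n - m) * (u * inverse w) \<in> V" using u w by simp
    ultimately show ?thesis by blast
  next
    case F: False
    then have "z ^ m = z ^ n * z ^ (m - n)" by (simp flip: power_add)
    then have "c = (z ^ n * z ^ (m - n)) * w * (u * inverse u)"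
      by (simp only: w(4) right_inverse[OF u(3)] mult_1_right)
    also have "\<dots> = a * (z ^ (m - n) * (w * inverse u))" by (simp only: u(4) mult_ac)
    finally have "c = a * (z ^ (m - n) * (w * inverse u))" .
    moreover have "z ^ (m - n) * (w * inverse u) \<in> V" using u w by simp
    ultimately show ?thesis using False by blast
  qed
qed (auto intro: bexI[of _ 0])

section \<open>Torsion-free finitely generated modules over V are free\<close>

fun comb :: "'a list \<Rightarrow> 'a set" where
  "comb [] = {\<zero>}"
| "comb (g # gs) = {c \<bullet> g \<oplus> w | c w. c \<in> V \<and> w \<in> comb gs}"

definition vsub :: "'a set \<Rightarrow> bool" where
  "vsub N \<longleftrightarrow> N \<subseteq> carrier M \<and> \<zero> \<in> N \<and> (\<forall>u\<in>N. \<forall>v\<in>N. u \<oplus> v \<in> N) \<and> (\<forall>c\<in>V. \<forall>v\<in>N. c \<bullet> v \<in> N)"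

lemma vsubD: assumes "vsub N"
  shows "v \<in> N \<Longrightarrow> v \<in> carrier M" "\<zero> \<in> N" "u \<in> N \<Longrightarrow> v \<in> N \<Longrightarrow> u \<oplus> v \<in> N"
    "c \<in> V \<Longrightarrow> v \<in> N \<Longrightarrow> c \<bullet> v \<in> N" "v \<in> N \<Longrightarrow> \<ominus> v \<in> N" "u \<in> N \<Longrightarrow> v \<in> N \<Longrightarrow> u \<ominus> v \<in> N"
proof -
  show *: "v \<in> N \<Longrightarrow> v \<in> carrier M" "\<zero> \<in> N" "u \<in> N \<Longrightarrow> v \<in> N \<Longrightarrow> u \<oplus> v \<in> N"
    "c \<in> V \<Longrightarrow> v \<in> N \<Longrightarrow> c \<bullet> v \<in> N" for c u v using assms unfolding vsub_def by auto
  show m: "v \<in> N \<Longrightarrow> \<ominus> v \<in> N" for v using *(4)[of "-1" v] *(1)[of v] by (simp add: act_uminus)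
  show "u \<in> N \<Longrightarrow> v \<in> N \<Longrightarrow> u \<ominus> v \<in> N" using *(3) m by (simp add: M.minus_eq)
qed

lemma vsub_comb: "set gs \<subseteq> carrier M \<Longrightarrow> vsub (comb gs)"
proof (induction gs)
  case Nil
  then show ?case by (auto simp: vsub_def)
next
  case (Cons g gs)
  then have IH: "vsub (comb gs)" and g: "g \<in> carrier M" by auto
  note D = vsubD[OF IH]
  have CI: "c \<bullet> g \<oplus> w \<in> comb (g # gs)" if "c \<in> V" "w \<in> comb gs" for c w using that by auto
  have "comb (g # gs) \<subseteq> carrier M" using D(1) g by auto
  moreover have "\<zero> \<in> comb (g # gs)" using CI[of 0 "\<zero>"] D(2) g by simp
  moreover have "u \<oplus> v \<in> comb (g # gs)" if uv: "u \<in> comb (g # gs)" "v \<in> comb (g # gs)" for u v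
  proof -
    from uv obtain c w c' w' where e: "u = c \<bullet> g \<oplus> w" "v = c' \<bullet> g \<oplus> w'" "c \<in> V" "w \<in> comb gs" "c' \<in> V" "w' \<in> comb gs"
      by auto
    then have "u \<oplus> v = (c + c') \<bullet> g \<oplus> (w \<oplus> w')" using g D(1) by (simp add: act_add M.a_ac)
    then show ?thesis using CI[of "c + c'" "w \<oplus> w'"] e D(3) by simp
  qed
  moreover have "d \<bullet> u \<in> comb (g # gs)" if u: "u \<in> comb (g # gs)" "d \<in> V" for u d
  proof -
    from u obtain c w where e: "u = c \<bullet> g \<oplus> w" "c \<in> V" "w \<in> comb gs" by auto
    then have "d \<bullet> u = (d * c) \<bullet> g \<oplus> d \<bullet> w" using g u(2) D(1) by (simp add: act_radd act_mult)
    then show ?thesis using CI[of "d * c" "d \<bullet> w"] e D(4) u(2) by simp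
  qed
  ultimately show ?case unfolding vsub_def by blast
qed

lemma comb_least: "vsub N \<Longrightarrow> set gs \<subseteq> N \<Longrightarrow> comb gs \<subseteq> N"
  by (induction gs) (auto simp: vsubD)

lemma comb_superset: "set gs \<subseteq> carrier M \<Longrightarrow> set gs \<subseteq> comb gs"
proof (induction gs)
  case (Cons g gs)
  have vs: "vsub (comb gs)" using Cons by (intro vsub_comb) simp
  have "g \<in> comb (g # gs)"
    unfolding comb.simps using Cons vsubD(2)[OF vs]
    by (intro CollectI exI[of _ 1] exI[of _ "\<zero>"]) simp
  moreover have "w \<in> comb (g # gs)" if "w \<in> comb gs" for w
    unfolding comb.simps using Cons vsubD(1)[OF vs] that
    by (intro CollectI exI[of _ 0] exI[of _ w]) simp
  ultimately show ?case using Cons by auto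
qed simp

lemma comb_eqI:
  assumes "set gs \<subseteq> carrier M" "set hs \<subseteq> carrier M" "set gs \<subseteq> comb hs" "set hs \<subseteq> comb gs"
  shows "comb gs = comb hs"
  using comb_least[OF vsub_comb[OF assms(1)] assms(4)] comb_least[OF vsub_comb[OF assms(2)] assms(3)] by blast

fun ind :: "'a list \<Rightarrow> bool" where
  "ind [] \<longleftrightarrow> True"
| "ind (h # hs) \<longleftrightarrow> ind hs \<and> (\<forall>c\<in>V. c \<bullet> h \<in> comb hs \<longrightarrow> c = 0)"

lemma comb_Cons_cong: "comb gs = comb hs \<Longrightarrow> comb (g # gs) = comb (g # hs)" by simp

text \<open>If \<open>g\<close> depends on \<open>h # hs\<close>, then \<open>c g = a h + w\<close>
  with \<open>w\<close> in the span of \<open>hs\<close>. Of \<open>a\<close> and \<open>c\<close>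
  one divides the other, so one of \<open>g\<close>, \<open>h\<close> can be corrected by a multiple
  of the other until it depends on \<open>hs\<close> alone. The induction hypothesis absorbs the
  corrected vector, and the untouched one stays at the head.\<close>

lemma basis_extend:
  assumes tf: z_regular and "set hs \<subseteq> carrier M" "ind hs" "g \<in> carrier M"
  shows "\<exists>bs. set bs \<subseteq> carrier M \<and> ind bs \<and> comb bs = comb (g # hs)"
  using assms(2-)
proof (induction hs arbitrary: g)
  case Nil
  show ?case
  proof (cases "g = \<zero>")
    case True
    have "comb [] = comb [g]" using V_zero unfolding True by (auto intro!: exI[of _ 0])
    then show ?thesis by (intro exI[of _ "[]"]) (simp del: comb.simps)
  next
    case False
    then show ?thesis using Nil z_regular_V[OF tf] by (intro exI[of _ "[g]"]) auto
  qed
next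
  case (Cons h hs)
  then have hs: "set hs \<subseteq> carrier M" and h: "h \<in> carrier M" and g: "g \<in> carrier M" and ind: "ind hs"
    and hi: "\<And>c. c \<in> V \<Longrightarrow> c \<bullet> h \<in> comb hs \<Longrightarrow> c = 0" by auto
  note D = vsubD[OF vsub_comb[OF hs]]
  show ?case
  proof (cases "\<forall>c\<in>V. c \<bullet> g \<in> comb (h # hs) \<longrightarrow> c = 0")
    case True
    then show ?thesis using Cons.prems by (intro exI[of _ "g # h # hs"]) simp
  next
    case False
    then obtain c a w where c: "c \<in> V" "c \<noteq> 0" "a \<in> V" "w \<in> comb hs" "c \<bullet> g = a \<bullet> h \<oplus> w" by auto
    have w: "w \<in> carrier M" by (rule D(1)[OF c(4)])
    \<comment> \<open>\<open>k\<close> is the corrected vector, to be absorbed into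
      \<open>hs\<close>; \<open>k'\<close> is the one kept, and \<open>ki\<close> is its
      independence from the rest.\<close>
    have combine: "\<exists>bs. set bs \<subseteq> carrier M \<and> ind bs \<and> comb bs = comb (g # h # hs)"
      if k: "k \<in> carrier M" "k' \<in> carrier M" and eq: "comb (k' # k # hs) = comb (g # h # hs)"
        and ki: "\<And>e b u. e \<in> V \<Longrightarrow> b \<in> V \<Longrightarrow> u \<in> comb hs \<Longrightarrow> e \<bullet> k' = b \<bullet> k \<oplus> u \<Longrightarrow> e = 0" for k k'
    proof -
      obtain bs where bs: "set bs \<subseteq> carrier M" "ind bs" "comb bs = comb (k # hs)"
        using Cons.IH[OF hs ind k(1)] by blast
      have "ind (k' # bs)" using bs(2) ki unfolding ind.simps bs(3) by auto
      then show ?thesis using bs k eq comb_Cons_cong[OF bs(3), of k'] by (intro exI[of _ "k' # bs"]) simp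
    qed
    have in3: "u \<in> comb [p, q]" if "u = d \<bullet> p \<oplus> d' \<bullet> q" "d \<in> V" "d' \<in> V" "p \<in> carrier M" "q \<in> carrier M" for u d d' p q
      unfolding comb.simps using that
      by (intro CollectI exI[of _ d] exI[of _ "d' \<bullet> q"] conjI exI[of _ d'] exI[of _ "\<zero>"]) auto
    have swap: "comb (k' # k # hs) = comb (g # h # hs)"
      if "k \<in> carrier M" "k' \<in> carrier M" "{g, h} \<subseteq> comb [k', k]" "{k', k} \<subseteq> comb [g, h]" for k k'
    proof -
      have mono: "comb [p, q] \<subseteq> comb (p # q # hs)" if "p \<in> carrier M" "q \<in> carrier M" for p q
      proof (rule comb_least)
        show "vsub (comb (p # q # hs))" using that hs by (intro vsub_comb) simp
        show "set [p, q] \<subseteq> comb (p # q # hs)" using comb_superset[of "p # q # hs"] that hs by simp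
      qed
      show ?thesis
      proof (rule comb_eqI)
        show "set (k' # k # hs) \<subseteq> comb (g # h # hs)"
          using mono[of g h] that g h comb_superset[of "g # h # hs"] hs by auto
        show "set (g # h # hs) \<subseteq> comb (k' # k # hs)"
          using mono[of k' k] that g h comb_superset[of "k' # k # hs"] hs by auto
      qed (use that g h hs in auto)
    qed
    from V_total[OF c(3) c(1) c(2)] show ?thesis
    proof
      assume "\<exists>d\<in>V. a = c * d"
      then obtain d where d: "d \<in> V" "a = c * d" by blast
      define k where "k = g \<ominus> d \<bullet> h"
      have kc: "k \<in> carrier M" unfolding k_def using g h d by simp
      have gk: "g = k \<oplus> d \<bullet> h" unfolding k_def using g h d by (simp add: M.minus_eq M.a_assoc M.l_neg)
      have "c \<bullet> k = c \<bullet> g \<ominus> a \<bullet> h"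
        unfolding k_def using c(1) d g h by (simp add: act_rdiff act_mult)
      then have ck: "c \<bullet> k = w" using add_diff_cancel[of "a \<bullet> h" w] c h w by simp
      show ?thesis
      proof (rule combine[of k h])
        have "g \<in> comb [h, k]" by (rule in3[of _ d _ 1]) (use gk d kc h in \<open>auto simp: M.a_comm\<close>)
        moreover have "h \<in> comb [h, k]" by (rule in3[of _ 1 _ 0]) (use kc h in auto)
        moreover have "k \<in> comb [g, h]" 
          by (rule in3[of _ 1 _ "- d"]) (use k_def d g h in \<open>auto simp: act_uminus M.minus_eq\<close>)
        moreover have "h \<in> comb [g, h]" by (rule in3[of _ 0 _ 1]) (use g h in auto)
        ultimately show "comb (h # k # hs) = comb (g # h # hs)" using kc h by (intro swap) auto
        fix e b u assume e: "e \<in> V" "b \<in> V" "u \<in> comb hs" "e \<bullet> h = b \<bullet> k \<oplus> u"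
        \<comment> \<open>Multiplication by \<open>c\<close> replaces \<open>c k\<close> by
          \<open>w\<close> and leaves a relation between \<open>h\<close> and \<open>hs\<close>
          alone.\<close>
        have "(c * e) \<bullet> h = c \<bullet> (b \<bullet> k \<oplus> u)" using c e h by (simp add: act_mult)
        also have "\<dots> = b \<bullet> w \<oplus> c \<bullet> u"
          using c e kc D(1)[OF e(3)] act_comm[of c b k] ck by (simp add: act_radd)
        also have "\<dots> \<in> comb hs" using c e by (intro D(3) D(4))
        finally show "e = 0" using hi[of "c * e"] c e by simp
      qed (use kc h in auto)
    next
      assume "a \<noteq> 0 \<and> (\<exists>d\<in>V. c = a * d)"
      then obtain d where d: "a \<noteq> 0" "d \<in> V" "c = a * d" by blast
      define k where "k = h \<ominus> d \<bullet> g"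
      have kc: "k \<in> carrier M" unfolding k_def using g h d by simp
      have hk: "h = k \<oplus> d \<bullet> g" unfolding k_def using g h d by (simp add: M.minus_eq M.a_assoc M.l_neg)
      have adg: "a \<bullet> (d \<bullet> g) = a \<bullet> h \<oplus> w" using c(5) d c g by (simp add: act_mult)
      have "a \<bullet> k = a \<bullet> h \<ominus> a \<bullet> (d \<bullet> g)"
        unfolding k_def using c(3) d(2) g h by (simp add: act_rdiff)
      then have ak: "a \<bullet> k = \<ominus> w" unfolding adg using diff_add_cancel[of "a \<bullet> h" w] c(3) h w by simp
      show ?thesis
      proof (rule combine[of k g])
        have "h \<in> comb [g, k]" by (rule in3[of _ d _ 1]) (use hk d kc g in \<open>auto simp: M.a_comm\<close>)
        moreover have "g \<in> comb [g, k]" by (rule in3[of _ 1 _ 0]) (use kc g in auto)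
        moreover have "k \<in> comb [g, h]"
          by (rule in3[of _ "- d" _ 1]) (use k_def d g h in \<open>auto simp: act_uminus M.minus_eq M.a_comm\<close>)
        moreover have "g \<in> comb [g, h]" by (rule in3[of _ 1 _ 0]) (use g h in auto)
        ultimately show "comb (g # k # hs) = comb (g # h # hs)" using kc g by (intro swap) auto
        fix e b u assume e: "e \<in> V" "b \<in> V" "u \<in> comb hs" "e \<bullet> g = b \<bullet> k \<oplus> u"
        have uc: "u \<in> carrier M" by (rule D(1)[OF e(3)])
        have "(a * e) \<bullet> g = a \<bullet> (b \<bullet> k \<oplus> u)" using c e g by (simp add: act_mult)
        also have "\<dots> = b \<bullet> (a \<bullet> k) \<oplus> a \<bullet> u"
          using c e kc uc act_comm[of a b k] by (simp add: act_radd)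
        also have "\<dots> \<in> comb hs" unfolding ak using c e by (intro D(3) D(4) D(5))
        finally have 1: "(a * e) \<bullet> g \<in> comb hs" .
        \<comment> \<open>Since \<open>a h = c g - w\<close>, having \<open>(a e) g\<close> in the
          span of \<open>hs\<close> puts \<open>(a e a) h\<close> there as well, where the
          independence of \<open>h\<close> applies.\<close>
        have "(a * e * a) \<bullet> h = (a * e) \<bullet> (c \<bullet> g \<ominus> w)"
          unfolding c(5) using c e h w by (simp add: act_mult M.minus_eq M.a_assoc M.r_neg)
        also have "\<dots> = c \<bullet> ((a * e) \<bullet> g) \<ominus> (a * e) \<bullet> w"
          using act_rdiff[of "a * e" "c \<bullet> g" w] act_comm[of c "a * e" g] c(1,3) e(1) g w by simp
        also have "\<dots> \<in> comb hs" by (rule D(6)[OF D(4)[OF c(1) 1] D(4)[OF _ c(4)]]) (use c e in simp)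
        finally show "e = 0" using hi[of "a * e * a"] c d e by simp
      qed (use kc g in auto)
    qed
  qed
qed

lemma basis_exists:
  assumes z_regular "set gs \<subseteq> carrier M"
  shows "\<exists>bs. set bs \<subseteq> carrier M \<and> ind bs \<and> comb bs = comb gs"
  using assms(2)
proof (induction gs)
  case Nil show ?case by (intro exI[of _ "[]"]) simp
next
  case (Cons g gs)
  then obtain hs where hs: "set hs \<subseteq> carrier M" "ind hs" "comb hs = comb gs" by auto
  from basis_extend[OF assms(1) hs(1,2), of g] Cons.prems comb_Cons_cong[OF hs(3), of g] show ?case by auto
qed

definition functional :: "'a set \<Rightarrow> ('a \<Rightarrow> 'f) \<Rightarrow> bool" where
  "functional N l \<longleftrightarrow> (\<forall>v\<in>N. l v \<in> V) \<and> (\<forall>u\<in>N. \<forall>v\<in>N. l (u \<oplus> v) = l u + l v) \<and>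
     (\<forall>c\<in>V. \<forall>v\<in>N. l (c \<bullet> v) = c * l v)"

text \<open>An element outside \<open>z N\<close> has a unit among its coordinates, and the
  corresponding coordinate function can be rescaled. Along the list: if the head coefficient is
  divisible by \<open>z\<close>, the tail part still lies outside \<open>z\<close> times the span of
  the tail.\<close>

lemma functional_exists:
  assumes "set bs \<subseteq> carrier M" "ind bs" "u \<in> comb bs" "\<forall>v\<in>comb bs. u \<noteq> z \<bullet> v"
  shows "\<exists>l. functional (comb bs) l \<and> l u = 1"
  using assms
proof (induction bs arbitrary: u)
  case Nil
  then show ?case by auto
next
  case (Cons h hs)
  then have hs: "set hs \<subseteq> carrier M" and h: "h \<in> carrier M" and ind: "ind hs"
    and hi: "\<And>c. c \<in> V \<Longrightarrow> c \<bullet> h \<in> comb hs \<Longrightarrow> c = 0" by auto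
  note D = vsubD[OF vsub_comb[OF hs]]
  have uniq: "c = c' \<and> w = w'" if e: "c \<in> V" "c' \<in> V" "w \<in> comb hs" "w' \<in> comb hs"
    "c \<bullet> h \<oplus> w = c' \<bullet> h \<oplus> w'" for c c' w w'
  proof -
    have ww: "w \<in> carrier M" "w' \<in> carrier M" using D(1) e by auto
    have "c \<bullet> h = (c \<bullet> h \<oplus> w) \<ominus> w"
      using e(1) h ww by (simp add: M.minus_eq M.a_assoc M.r_neg)
    also have "\<dots> = c' \<bullet> h \<oplus> (w' \<ominus> w)"
      unfolding e(5) using e(2) h ww by (simp add: M.minus_eq M.a_assoc)
    finally have "(c - c') \<bullet> h = w' \<ominus> w"
      using e(1,2) h ww add_diff_cancel[of "c' \<bullet> h" "w' \<ominus> w"] by (simp add: act_diff)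
    also have "\<dots> \<in> comb hs" using e by (intro D(6))
    finally have "c = c'" using hi[of "c - c'"] e by simp
    with e h ww show ?thesis by (metis M.add.l_cancel VS act_closed)
  qed
  \<comment> \<open>Functions on the span are given through the decomposition into a head multiple
    and a tail part, which \<open>uniq\<close> makes unambiguous.\<close>
  define f where "f F v = (THE r. \<exists>c w. c \<in> V \<and> w \<in> comb hs \<and> v = c \<bullet> h \<oplus> w \<and> r = F c w)"
    for F :: "'f \<Rightarrow> 'a \<Rightarrow> 'f" and v
  have f: "f F (c \<bullet> h \<oplus> w) = F c w" if "c \<in> V" "w \<in> comb hs" for F c w
    unfolding f_def using that uniq by (intro the_equality) blast+
  have is_fun: "functional (comb (h # hs)) (f F)"
    if F: "\<And>c w. c \<in> V \<Longrightarrow> w \<in> comb hs \<Longrightarrow> F c w \<in> V"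
      "\<And>c w c' w'. c \<in> V \<Longrightarrow> w \<in> comb hs \<Longrightarrow> c' \<in> V \<Longrightarrow> w' \<in> comb hs \<Longrightarrow> F (c + c') (w \<oplus> w') = F c w + F c' w'"
      "\<And>c w d. c \<in> V \<Longrightarrow> w \<in> comb hs \<Longrightarrow> d \<in> V \<Longrightarrow> F (d * c) (d \<bullet> w) = d * F c w" for F
    unfolding functional_def
  proof (intro conjI ballI)
    fix v assume "v \<in> comb (h # hs)"
    then obtain c w where v: "v = c \<bullet> h \<oplus> w" "c \<in> V" "w \<in> comb hs" by auto
    then show "f F v \<in> V" using f F by simp
    fix v' assume "v' \<in> comb (h # hs)"
    then obtain c' w' where v': "v' = c' \<bullet> h \<oplus> w'" "c' \<in> V" "w' \<in> comb hs" by auto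
    have "v \<oplus> v' = (c + c') \<bullet> h \<oplus> (w \<oplus> w')"
      using v v' h D(1) by (simp add: act_add M.a_ac)
    then show "f F (v \<oplus> v') = f F v + f F v'"
      using v v' D(3) F(2) by (simp add: f)
  next
    fix d v assume d: "d \<in> V" and "v \<in> comb (h # hs)"
    then obtain c w where v: "v = c \<bullet> h \<oplus> w" "c \<in> V" "w \<in> comb hs" by auto
    have "d \<bullet> v = (d * c) \<bullet> h \<oplus> d \<bullet> w" using v h d D(1) by (simp add: act_radd act_mult)
    then show "f F (d \<bullet> v) = d * f F v" using v d D(4) F(3) by (simp add: f)
  qed
  from Cons.prems(3) obtain a w where u: "u = a \<bullet> h \<oplus> w" "a \<in> V" "w \<in> comb hs" by auto
  from V_unit_or_zdvd[OF u(2)] show ?case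
  proof
    assume a: "a \<noteq> 0 \<and> inverse a \<in> V"
    have "functional (comb (h # hs)) (f (\<lambda>c w. inverse a * c))"
      by (rule is_fun) (use a in \<open>auto simp: algebra_simps\<close>)
    moreover have "f (\<lambda>c w. inverse a * c) u = 1" unfolding u(1) using f u(2,3) a by simp
    ultimately show ?thesis by blast
  next
    assume "\<exists>a'\<in>V. a = z * a'"
    then obtain a' where a': "a' \<in> V" "a = z * a'" by blast
    have "\<forall>v\<in>comb hs. w \<noteq> z \<bullet> v"
    proof (intro ballI notI)
      fix v assume v: "v \<in> comb hs" "w = z \<bullet> v"
      then have "u = z \<bullet> (a' \<bullet> h \<oplus> v)" using u(1) a' h D(1)[OF v(1)] by (simp add: act_radd act_mult)
      moreover have "a' \<bullet> h \<oplus> v \<in> comb (h # hs)" using v a' by auto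
      ultimately show False using Cons.prems(4) by blast
    qed
    then obtain l where l: "functional (comb hs) l" "l w = 1" using Cons.IH[OF hs ind u(3)] by blast
    have "functional (comb (h # hs)) (f (\<lambda>c w. l w))"
      by (rule is_fun) (use l(1) in \<open>auto simp: functional_def\<close>)
    moreover have "f (\<lambda>c w. l w) u = 1" unfolding u(1) using f u(2,3) l(2) by simp
    ultimately show ?thesis by blast
  qed
qed

end

section \<open>Free direct summands\<close>

text \<open>A linear map with \<open>L w = 1\<close> splits off a copy of the ring, via
  \<open>v \<mapsto> (L v, v - L v w)\<close>. The complement is the kernel of \<open>L\<close>,
  carved out of \<open>N\<close> so that its elements keep the type demanded by
  \<open>f_rank\<close>.\<close>

lemma (in cring) f_rank_pos:
  fixes N :: "('a, 'm) module"
  assumes N: "module R N" and L: "\<And>v. v \<in> carrier N \<Longrightarrow> L v \<in> carrier R"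
    "\<And>u v. u \<in> carrier N \<Longrightarrow> v \<in> carrier N \<Longrightarrow> L (u \<oplus>\<^bsub>N\<^esub> v) = L u \<oplus> L v"
    "\<And>r v. r \<in> carrier R \<Longrightarrow> v \<in> carrier N \<Longrightarrow> L (r \<odot>\<^bsub>N\<^esub> v) = r \<otimes> L v"
    and w: "w \<in> carrier N" "L w = \<one>"
  shows "f_rank R N \<ge> 1"
proof -
  interpret N: module R N by (rule N)
  have L0: "L \<zero>\<^bsub>N\<^esub> = \<zero>" using L(3)[of \<zero> "\<zero>\<^bsub>N\<^esub>"] L(1) by simp
  have Lm: "L (\<ominus>\<^bsub>N\<^esub> v) = \<ominus> L v" if "v \<in> carrier N" for v
    using L(3)[of "\<ominus> \<one>" v] L(1)[OF that] that by (simp add: N.smult_l_minus l_minus)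
  define K where "K = N\<lparr>carrier := {v \<in> carrier N. L v = \<zero>}\<rparr>"
  have K_simps: "carrier K = {v \<in> carrier N. L v = \<zero>}" "add K = add N" "ring.zero K = ring.zero N" "module.smult K = module.smult N"
    by (simp_all add: K_def)
  have K: "module R K"
  proof (rule moduleI)
    show "abelian_group K"
    proof (rule abelian_groupI)
      fix v assume "v \<in> carrier K"
      then show "\<exists>u\<in>carrier K. u \<oplus>\<^bsub>K\<^esub> v = \<zero>\<^bsub>K\<^esub>"
        using Lm by (intro bexI[of _ "\<ominus>\<^bsub>N\<^esub> v"]) (auto simp: K_simps N.l_neg)
    qed (auto simp: K_simps L L0 N.a_ac)
  qed (auto simp: K_simps L is_cring N.smult_l_distr N.smult_r_distr N.smult_assoc1)
  define h where "h v = ((\<lambda>i\<in>{..<1::nat}. L v), v \<ominus>\<^bsub>N\<^esub> L v \<odot>\<^bsub>N\<^esub> w)" for v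
  define D where "D = direct_sum_module (free_module R 1) K"
  have D_simps: "carrier D = ({..<1::nat} \<rightarrow>\<^sub>E carrier R) \<times> {v \<in> carrier N. L v = \<zero>}"
    "\<And>p v q u. (p, v) \<oplus>\<^bsub>D\<^esub> (q, u) = ((\<lambda>i\<in>{..<1}. p i \<oplus> q i), v \<oplus>\<^bsub>N\<^esub> u)"
    "\<And>r p v. r \<odot>\<^bsub>D\<^esub> (p, v) = ((\<lambda>i\<in>{..<1}. r \<otimes> p i), r \<odot>\<^bsub>N\<^esub> v)"
    by (simp_all add: D_def direct_sum_module_def free_module_def K_simps)
  have ker: "L (v \<ominus>\<^bsub>N\<^esub> L v \<odot>\<^bsub>N\<^esub> w) = \<zero>" if "v \<in> carrier N" for v
    using that w L(1)[OF that] by (simp add: N.minus_eq L(2,3) Lm r_neg)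
  have hD: "h v \<in> carrier D" if "v \<in> carrier N" for v
    using that w L(1) ker by (auto simp: h_def D_simps)
  have "h \<in> module_hom R N D"
    unfolding module_hom_def
  proof (intro CollectI conjI ballI)
    show "h \<in> carrier N \<rightarrow> carrier D" using hD by blast
    show "h (u \<oplus>\<^bsub>N\<^esub> v) = h u \<oplus>\<^bsub>D\<^esub> h v" if uv: "u \<in> carrier N" "v \<in> carrier N" for u v
      unfolding h_def D_simps using uv w L(1)[OF uv(1)] L(1)[OF uv(2)]
      by (auto simp: L(2) N.smult_l_distr N.minus_eq N.minus_add N.a_ac fun_eq_iff)
    show "h (r \<odot>\<^bsub>N\<^esub> v) = r \<odot>\<^bsub>D\<^esub> h v" if r: "r \<in> carrier R" and v: "v \<in> carrier N" for r v
      unfolding h_def D_simps using r v w L(1)[OF v]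
      by (auto simp: L(3) N.smult_assoc1 N.minus_eq N.smult_r_distr N.smult_r_minus fun_eq_iff)
  qed
  moreover have "bij_betw h (carrier N) (carrier D)"
    unfolding bij_betw_def
  proof (intro conjI inj_onI equalityI subsetI)
    fix u v assume uv: "u \<in> carrier N" "v \<in> carrier N" "h u = h v"
    have "(\<lambda>i\<in>{..<1::nat}. L u) = (\<lambda>i\<in>{..<1}. L v)" using uv(3) unfolding h_def by blast
    from fun_cong[OF this, of 0] have "L u = L v" by simp
    moreover have "u \<ominus>\<^bsub>N\<^esub> L u \<odot>\<^bsub>N\<^esub> w = v \<ominus>\<^bsub>N\<^esub> L v \<odot>\<^bsub>N\<^esub> w" using uv(3) by (simp add: h_def)
    ultimately show "u = v" using uv(1,2) w L(1) by (simp add: N.minus_eq)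
  next
    fix d assume "d \<in> h ` carrier N"
    then show "d \<in> carrier D" using hD by blast
  next
    fix d assume "d \<in> carrier D"
    then obtain p k where d: "d = (p, k)" "p \<in> {..<1} \<rightarrow>\<^sub>E carrier R" "k \<in> carrier N" "L k = \<zero>"
      unfolding D_simps by auto
    have p0: "p 0 \<in> carrier R" using d(2) by (auto simp: PiE_def)
    define v where "v = k \<oplus>\<^bsub>N\<^esub> p 0 \<odot>\<^bsub>N\<^esub> w"
    have v: "v \<in> carrier N" unfolding v_def using d p0 w by simp
    have Lv: "L v = p 0" unfolding v_def using d p0 w by (simp add: L(2,3))
    have "(\<lambda>i\<in>{..<1::nat}. L v) = p"
      unfolding Lv using d(2) by (auto simp: PiE_def extensional_def fun_eq_iff)
    moreover have "v \<ominus>\<^bsub>N\<^esub> p 0 \<odot>\<^bsub>N\<^esub> w = k"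
      unfolding v_def using d p0 w by (simp add: N.minus_eq N.a_assoc N.r_neg)
    then have "v \<ominus>\<^bsub>N\<^esub> L v \<odot>\<^bsub>N\<^esub> w = k" by (simp only: Lv)
    ultimately have "d = h v" unfolding h_def d(1) by simp
    then show "d \<in> h ` carrier N" using v by blast
  qed
  ultimately have "module_isomorphic R N (direct_sum_module (free_module R 1) K)"
    unfolding module_isomorphic_def D_def by blast
  then have "enat 1 \<in> {enat m | m. \<exists>Y' :: ('a, 'm) module. module R Y' \<and> module_isomorphic R N (direct_sum_module (free_module R m) Y')}"
    using K by blast
  then show ?thesis unfolding f_rank_def one_enat_def by (rule Sup_upper)
qed

section \<open>Duality: from functionals over V to linear maps into R\<close>

context curve_module
begin

lemma functionalD:
  assumes "functional N l"
  shows "v \<in> N \<Longrightarrow> l v \<in> V" "u \<in> N \<Longrightarrow> v \<in> N \<Longrightarrow> l (u \<oplus> v) = l u + l v"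
    "c \<in> V \<Longrightarrow> v \<in> N \<Longrightarrow> l (c \<bullet> v) = c * l v"
  using assms unfolding functional_def by auto

lemma lin_comb_act_eq:
  assumes "\<And>i. c i \<in> V" "v \<in> carrier M"
  shows "lin_comb x y c \<bullet> v = c 0 \<bullet> v \<oplus> c 1 \<bullet> (y \<bullet> v) \<oplus> c 2 \<bullet> (y^2 \<bullet> v) \<oplus> c 3 \<bullet> (y^3 \<bullet> v) \<oplus>
    c 4 \<bullet> (y^4 \<bullet> v) \<oplus> c 5 \<bullet> (y^5 \<bullet> v) \<oplus> c 6 \<bullet> (y^6 \<bullet> v) \<oplus> c 7 \<bullet> (x \<bullet> v) \<oplus> c 8 \<bullet> ((x * y) \<bullet> v)"
  using assms unfolding lin_comb_def by (simp add: act_add act_mult[symmetric])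

lemma lin_comb_act:
  assumes N: "vsub N" and c: "\<And>i. c i \<in> V" and v: "v \<in> carrier M"
    and b: "v \<in> N" "y \<bullet> v \<in> N" "y^2 \<bullet> v \<in> N" "y^3 \<bullet> v \<in> N" "y^4 \<bullet> v \<in> N" "y^5 \<bullet> v \<in> N" "y^6 \<bullet> v \<in> N"
      "x \<bullet> v \<in> N" "(x * y) \<bullet> v \<in> N"
  shows "lin_comb x y c \<bullet> v \<in> N"
  unfolding lin_comb_act_eq[OF c v] using b c by (simp add: vsubD(3,4)[OF N])

lemma act_lin_comb_coord: "s \<in> S \<Longrightarrow> v \<in> carrier M \<Longrightarrow> s \<bullet> v = lin_comb x y (coord s) \<bullet> v"
  using coord by (intro act_cong) (simp_all add: lin_comb_def)

lemma fg_over_V: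
  assumes "fg_module R M" shows "\<exists>gs. set gs \<subseteq> carrier M \<and> comb gs = carrier M"
proof -
  obtain A where A: "finite A" "A \<subseteq> carrier M" "module_span R M A = carrier M"
    using assms unfolding fg_module_def by blast
  obtain as where as: "set as = A" using finite_list[OF A(1)] by blast
  define bas where "bas = [1, y, y^2, y^3, y^4, y^5, y^6, x, x * y]"
  define gs where "gs = concat (map (\<lambda>a. map (\<lambda>b. b \<bullet> a) bas) as)"
  have gs: "set gs \<subseteq> carrier M" using A(2) by (auto simp: gs_def bas_def as)
  have mem: "b \<bullet> a \<in> comb gs" if "a \<in> A" "b \<in> set bas" for a b
    using comb_superset[OF gs] that by (auto simp: gs_def as)
  \<comment> \<open>The largest \<open>R\<close>-submodule inside the \<open>V\<close>-span of
    \<open>gs\<close>; it contains the generators \<open>A\<close>, hence everything.\<close>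
  define N where "N = {v \<in> carrier M. \<forall>s\<in>S. s \<bullet> v \<in> comb gs}"
  note D = vsubD[OF vsub_comb[OF gs]]
  have "submodule N R M"
  proof (rule M.submoduleI)
    show "\<ominus> v \<in> N" if "v \<in> N" for v using that D(5) by (auto simp: N_def act_rminus)
    show "u \<oplus> v \<in> N" if "u \<in> N" "v \<in> N" for u v using that D(3) by (auto simp: N_def act_radd)
    fix r v assume "r \<in> carrier R" and v: "v \<in> N"
    then obtain t where t: "t \<in> S" "r = res t" unfolding R_carrier by blast
    have "s \<bullet> (t \<bullet> v) \<in> comb gs" if "s \<in> S" for s
      using v t that by (simp add: N_def flip: act_mult)
    then show "r \<odot> v \<in> N" using v t by (auto simp: N_def act_def)
  qed (auto simp: N_def D)
  moreover have "A \<subseteq> N"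
  proof
    fix a assume a: "a \<in> A"
    have bm: "b \<bullet> a \<in> comb gs" if "b \<in> {1, y, y^2, y^3, y^4, y^5, y^6, x, x * y}" for b
      using mem[OF a, of b] that by (simp add: bas_def)
    have aM: "a \<in> carrier M" using a A(2) by blast
    have "s \<bullet> a \<in> comb gs" if "s \<in> S" for s
      unfolding act_lin_comb_coord[OF that aM]
    proof (rule lin_comb_act[OF vsub_comb[OF gs] coord(1)[OF that] aM])
      show "a \<in> comb gs" using bm[of 1] aM by simp
    qed (rule bm; simp)+
    then show "a \<in> N" using a A(2) by (auto simp: N_def)
  qed
  ultimately have "carrier M \<subseteq> N" using module_span_least A(3) by metis
  have "v \<in> comb gs" if v: "v \<in> carrier M" for v
  proof -
    have "v \<in> N" using \<open>carrier M \<subseteq> N\<close> v by blast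
    then have "1 \<bullet> v \<in> comb gs" using S_one unfolding N_def by blast
    then show ?thesis using act_one[OF v] by simp
  qed
  then show ?thesis using gs D(1) by blast
qed

lemma functional_on_carrier:
  assumes "fg_module R M" z_regular "u \<in> carrier M" "\<forall>v\<in>carrier M. u \<noteq> z \<bullet> v"
  shows "\<exists>l. functional (carrier M) l \<and> l u = 1"
proof -
  obtain gs where gs: "set gs \<subseteq> carrier M" "comb gs = carrier M" using fg_over_V assms(1) by blast
  obtain bs where bs: "set bs \<subseteq> carrier M" "ind bs" "comb bs = carrier M"
    using basis_exists[OF assms(2) gs(1)] unfolding gs(2) by (elim exE conjE)
  show ?thesis by (rule functional_exists[OF bs(1,2), unfolded bs(3), OF assms(3,4)])
qed

text \<open>The coefficients of the values \<open>l (b \<bullet> v)\<close> form the basis dual to \<open>b\<close> under the coefficient of \<open>y\<^sup>6\<close>.\<close>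
definition dual_map :: "('a \<Rightarrow> 'f) \<Rightarrow> 'a \<Rightarrow> 'f" where
  "dual_map l v = l v * (y^6 + z^3 * x) + l (y \<bullet> v) * y^5 + l (y^2 \<bullet> v) * y^4 + l (y^3 \<bullet> v) * y^3
     + l (y^4 \<bullet> v) * y^2 + l (y^5 \<bullet> v) * y + l (y^6 \<bullet> v) + l (x \<bullet> v) * (x * y + z^3) + l ((x * y) \<bullet> v) * x"

context
  fixes l assumes l: "functional (carrier M) l"
begin

definition dot :: "(nat \<Rightarrow> 'f) \<Rightarrow> 'a \<Rightarrow> 'f" where
  "dot c v = c 0 * l v + c 1 * l (y \<bullet> v) + c 2 * l (y^2 \<bullet> v) + c 3 * l (y^3 \<bullet> v) + c 4 * l (y^4 \<bullet> v)
     + c 5 * l (y^5 \<bullet> v) + c 6 * l (y^6 \<bullet> v) + c 7 * l (x \<bullet> v) + c 8 * l ((x * y) \<bullet> v)"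

lemma functional_lin_comb:
  assumes c: "\<And>i. c i \<in> V" and v: "v \<in> carrier M" shows "l (lin_comb x y c \<bullet> v) = dot c v"
  unfolding lin_comb_act_eq[OF c v] dot_def using c v by (simp add: functionalD(2,3)[OF l])

lemma functional_basis_y:
  assumes "t = lin_comb x y (\<lambda>j. if j = i then 1 else 0)" "v \<in> carrier M"
  shows "l (t \<bullet> (y \<bullet> v)) = dot (mult_y z (\<lambda>j. if j = i then 1 else 0)) v"
proof -
  let ?d = "\<lambda>j. if j = i then 1 else 0"
  have tS: "t \<in> S" unfolding assms(1) by (rule lin_comb_S) simp
  have V: "?d j \<in> V" for j by simp
  have "t \<bullet> (y \<bullet> v) = (y * t) \<bullet> v"
    by (simp only: act_mult[OF yS tS assms(2)] act_comm[OF tS yS assms(2)])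
  also have "\<dots> = lin_comb x y (mult_y z ?d) \<bullet> v"
  proof (rule act_cong[OF _ _ _ assms(2)])
    show "y * t - lin_comb x y (mult_y z ?d) \<in> I" unfolding assms(1) by (rule mult_y_I[OF V])
    show "lin_comb x y (mult_y z ?d) \<in> S" by (rule lin_comb_S[OF mult_y_V[OF V]])
  qed (use tS in simp)
  finally show ?thesis using functional_lin_comb[OF mult_y_V[OF V] assms(2)] by simp
qed

lemma functional_basis_x:
  assumes "t = lin_comb x y (\<lambda>j. if j = i then 1 else 0)" "v \<in> carrier M"
  shows "l (t \<bullet> (x \<bullet> v)) = dot (mult_x z (\<lambda>j. if j = i then 1 else 0)) v"
proof -
  let ?d = "\<lambda>j. if j = i then 1 else 0"
  have tS: "t \<in> S" unfolding assms(1) by (rule lin_comb_S) simp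
  have V: "?d j \<in> V" for j by simp
  have "t \<bullet> (x \<bullet> v) = (x * t) \<bullet> v"
    by (simp only: act_mult[OF xS tS assms(2)] act_comm[OF tS xS assms(2)])
  also have "\<dots> = lin_comb x y (mult_x z ?d) \<bullet> v"
  proof (rule act_cong[OF _ _ _ assms(2)])
    show "x * t - lin_comb x y (mult_x z ?d) \<in> I" unfolding assms(1) by (rule mult_x_I[OF V])
    show "lin_comb x y (mult_x z ?d) \<in> S" by (rule lin_comb_S[OF mult_x_V[OF V]])
  qed (use tS in simp)
  finally show ?thesis using functional_lin_comb[OF mult_x_V[OF V] assms(2)] by simp
qed

lemma dual_map_S: assumes "v \<in> carrier M" shows "dual_map l v \<in> S"
  unfolding dual_map_def using functionalD(1)[OF l] assms by simp

lemma dual_map_add: assumes "u \<in> carrier M" "v \<in> carrier M"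
  shows "dual_map l (u \<oplus> v) = dual_map l u + dual_map l v"
  unfolding dual_map_def using assms by (simp add: act_radd functionalD(2)[OF l] algebra_simps)

lemma dual_map_V: assumes "c \<in> V" "v \<in> carrier M" shows "dual_map l (c \<bullet> v) = c * dual_map l v"
  unfolding dual_map_def using assms by (simp add: act_comm[of _ c] functionalD(3)[OF l] algebra_simps)

text \<open>A dual basis transforms under \<open>y\<close> by the transpose of the multiplication
  table, so all terms cancel except explicit multiples of the relations. The same happens for
  \<open>x\<close>.\<close>

lemma dual_map_y: assumes v: "v \<in> carrier M" shows "dual_map l (y \<bullet> v) - y * dual_map l v \<in> I"
proof -
  note b = functional_basis_y[OF _ v]
  have 1: "l (y \<bullet> v) = dot (mult_y z (\<lambda>j. if j = 0 then 1 else 0)) v" using b[of 1 0] v by (simp add: lin_comb_def)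
  have "dual_map l (y \<bullet> v) - y * dual_map l v =
    - (l v * (y^7 - (z^5 * x - z^3 * (x * y))) + l (x \<bullet> v) * (x * y^2 + y * z^3 - z^5))"
    unfolding dual_map_def b[of y 1, unfolded lin_comb_def, simplified] b[of "y^2" 2, unfolded lin_comb_def, simplified]
      b[of "y^3" 3, unfolded lin_comb_def, simplified] b[of "y^4" 4, unfolded lin_comb_def, simplified]
      b[of "y^5" 5, unfolded lin_comb_def, simplified] b[of "y^6" 6, unfolded lin_comb_def, simplified]
      b[of x 7, unfolded lin_comb_def, simplified] b[of "x * y" 8, unfolded lin_comb_def, simplified]
    by (simp add: dot_def mult_y_def) (simp add: algebra_simps eval_nat_numeral)
  also have "\<dots> \<in> I" using functionalD(1)[OF l] v
    by (intro I_uminus I_add I_mult y7 relation_I) simp_all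
  finally show ?thesis .
qed

lemma dual_map_x: assumes v: "v \<in> carrier M" shows "dual_map l (x \<bullet> v) - x * dual_map l v \<in> I"
proof -
  note b = functional_basis_x[OF _ v]
  have "dual_map l (x \<bullet> v) - x * dual_map l v =
    - ((l v * y^4 + l (y \<bullet> v) * y^3 + l (y^2 \<bullet> v) * y^2 + l (y^3 \<bullet> v) * y + l (y^4 \<bullet> v)) * (x * y^2 + y * z^3 - z^5)
      + (l v * z^3 + l (x \<bullet> v) * y + l ((x * y) \<bullet> v)) * (x^2 - y^5))"
    unfolding dual_map_def b[of y 1, unfolded lin_comb_def, simplified] b[of "y^2" 2, unfolded lin_comb_def, simplified]
      b[of "y^3" 3, unfolded lin_comb_def, simplified] b[of "y^4" 4, unfolded lin_comb_def, simplified]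
      b[of "y^5" 5, unfolded lin_comb_def, simplified] b[of "y^6" 6, unfolded lin_comb_def, simplified]
      b[of x 7, unfolded lin_comb_def, simplified] b[of "x * y" 8, unfolded lin_comb_def, simplified]
    by (simp add: dot_def mult_x_def) (simp add: algebra_simps eval_nat_numeral)
  also have "\<dots> \<in> I" using functionalD(1)[OF l] v
    by (intro I_uminus I_add I_mult relation_I) simp_all
  finally show ?thesis .
qed

text \<open>The scalars that commute with \<open>dual_map\<close> up to \<open>I\<close> are closed
  under sums and products and contain \<open>V\<close>, \<open>x\<close>, \<open>y\<close>;
  coordinates then reach every element of \<open>S\<close>.\<close>

lemma dual_map_linear: assumes "s \<in> S" "v \<in> carrier M" shows "dual_map l (s \<bullet> v) - s * dual_map l v \<in> I"
proof -
  define G where "G = {s \<in> S. \<forall>v\<in>carrier M. dual_map l (s \<bullet> v) - s * dual_map l v \<in> I}"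
  have GS: "s \<in> S" if "s \<in> G" for s using that by (simp add: G_def)
  have V: "c \<in> G" if "c \<in> V" for c using that dual_map_V by (simp add: G_def)
  have add: "s + t \<in> G" if st: "s \<in> G" "t \<in> G" for s t
  proof -
    have "dual_map l ((s + t) \<bullet> v) - (s + t) * dual_map l v
      = (dual_map l (s \<bullet> v) - s * dual_map l v) + (dual_map l (t \<bullet> v) - t * dual_map l v)" if "v \<in> carrier M" for v
      using that GS[OF st(1)] GS[OF st(2)] by (simp add: act_add dual_map_add algebra_simps)
    moreover have "(dual_map l (s \<bullet> v) - s * dual_map l v) + (dual_map l (t \<bullet> v) - t * dual_map l v) \<in> I" if "v \<in> carrier M" for v
      by (rule I_add) (use st that in \<open>auto simp: G_def\<close>)
    ultimately show ?thesis using GS[OF st(1)] GS[OF st(2)] by (simp add: G_def)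
  qed
  have mult: "s * t \<in> G" if st: "s \<in> G" "t \<in> G" for s t
  proof -
    have "dual_map l ((s * t) \<bullet> v) - (s * t) * dual_map l v
      = (dual_map l (s \<bullet> (t \<bullet> v)) - s * dual_map l (t \<bullet> v)) + s * (dual_map l (t \<bullet> v) - t * dual_map l v)" if "v \<in> carrier M" for v
      using that GS[OF st(1)] GS[OF st(2)] by (simp add: act_mult algebra_simps)
    moreover have "(dual_map l (s \<bullet> (t \<bullet> v)) - s * dual_map l (t \<bullet> v)) + s * (dual_map l (t \<bullet> v) - t * dual_map l v) \<in> I"
      if "v \<in> carrier M" for v
      by (intro I_add I_mult) (use st that in \<open>auto simp: G_def\<close>)
    ultimately show ?thesis using GS[OF st(1)] GS[OF st(2)] by (simp add: G_def)
  qed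
  have yG: "y \<in> G" and xG: "x \<in> G" using dual_map_x dual_map_y by (auto simp: G_def)
  have pow: "y ^ n \<in> G" for n by (induction n) (use V yG mult in auto)
  let ?c = "coord s"
  have cG: "?c i \<in> G" for i using V coord(1)[OF assms(1)] by blast
  have "lin_comb x y ?c \<in> G" unfolding lin_comb_def by (intro add mult cG pow xG yG)
  then have "dual_map l (lin_comb x y ?c \<bullet> v) - lin_comb x y ?c * dual_map l v \<in> I"
    using assms(2) by (simp add: G_def)
  from I_diff[OF this I_mult2[OF coord(2)[OF assms(1)] dual_map_S[OF assms(2)]]]
  show ?thesis using act_lin_comb_coord[OF assms] by (simp add: algebra_simps)
qed

text \<open>All members of the dual basis lie in the maximal ideal except \<open>1\<close>, the one
  paired with \<open>y^6\<close>; modulo that ideal only \<open>l (y^6 \<bullet> v)\<close> is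
  left.\<close>

lemma dual_map_unit: assumes "v \<in> carrier M" "l (y^6 \<bullet> v) = 1" shows "dual_map l v \<notin> nn"
proof
  assume nn: "dual_map l v \<in> nn"
  define r where "r = l v * (y^6 + z^3 * x) + l (y \<bullet> v) * y^5 + l (y^2 \<bullet> v) * y^4 + l (y^3 \<bullet> v) * y^3
     + l (y^4 \<bullet> v) * y^2 + l (y^5 \<bullet> v) * y + l (x \<bullet> v) * (x * y + z^3) + l ((x * y) \<bullet> v) * x"
  have lS: "l w \<in> S" if "w \<in> carrier M" for w using functionalD(1)[OF l that] by simp
  have p: "w ^ n \<in> nn" if w: "w \<in> nn" and n: "n \<noteq> 0" for w n
  proof -
    obtain m where "n = Suc m" using n not0_implies_Suc by blast
    then show ?thesis using nn_mult2[OF w, of "w ^ m"] nn_S[OF w] by simp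
  qed
  have yp: "y ^ 2 \<in> nn" "y ^ 3 \<in> nn" "y ^ 4 \<in> nn" "y ^ 5 \<in> nn" "y ^ 6 \<in> nn" "z ^ 3 \<in> nn"
    by (simp_all add: p)
  have "r \<in> nn" unfolding r_def
    using assms by (intro nn_add nn_mult[OF nn_add[OF yp(5) nn_mult2[OF yp(6)]]] nn_mult[OF nn_add[OF nn_mult2[OF xyz_nn(1)] yp(6)]]
        nn_mult yp xyz_nn lS) auto
  then have "dual_map l v - r \<in> nn" using nn nn_add[OF nn nn_uminus[OF \<open>r \<in> nn\<close>]] by simp
  moreover have "dual_map l v - r = 1" unfolding dual_map_def r_def assms(2) by simp
  ultimately show False using one_nn by simp
qed

end

end

text \<open>A functional over \<open>V\<close> with value 1 on \<open>y^6 v\<close> yields an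
  \<open>R\<close>-linear map into \<open>R\<close> whose value at \<open>v\<close> is a unit;
  rescaling \<open>v\<close> by its inverse gives the splitting.\<close>

theorem (in curve) f_rank_pos_R:
  fixes N :: "('f set, 'a) module"
  assumes fg: "fg_module R N" and reg: "\<And>v. v \<in> carrier N \<Longrightarrow> res z \<odot>\<^bsub>N\<^esub> v = \<zero>\<^bsub>N\<^esub> \<Longrightarrow> v = \<zero>\<^bsub>N\<^esub>"
    and v: "v \<in> carrier N" "\<And>w. w \<in> carrier N \<Longrightarrow> res (y^6) \<odot>\<^bsub>N\<^esub> v \<noteq> res z \<odot>\<^bsub>N\<^esub> w"
  shows "f_rank R N \<ge> 1"
proof -
  interpret N: module R N using fg by (simp add: fg_module_def)
  interpret N: curve_module S I V x y z N by unfold_locales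
  have "N.z_regular" using reg by (simp add: N.z_regular_def N.act_def)
  moreover have "N.act (y^6) v \<in> carrier N" using v(1) by simp
  ultimately obtain l where l: "N.functional (carrier N) l" "l (N.act (y^6) v) = 1"
    using N.functional_on_carrier[OF fg, of "N.act (y^6) v"] v(2) by (auto simp: N.act_def)
  have u: "N.dual_map l v \<noteq> 0" "inverse (N.dual_map l v) \<in> S"
    using unitI[OF N.dual_map_S[OF l(1) v(1)] N.dual_map_unit[OF l(1) v(1) l(2)]] by auto
  define w where "w = N.act (inverse (N.dual_map l v)) v"
  show ?thesis
  proof (rule R.f_rank_pos[of N "\<lambda>u. res (N.dual_map l u)" w])
    show "module R N" by (rule N.module_axioms)
    show "res (N.dual_map l u) \<in> carrier R" if "u \<in> carrier N" for u using N.dual_map_S[OF l(1) that] by simp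
    show "res (N.dual_map l (u \<oplus>\<^bsub>N\<^esub> v)) = res (N.dual_map l u) \<oplus>\<^bsub>R\<^esub> res (N.dual_map l v)"
      if "u \<in> carrier N" "v \<in> carrier N" for u v
      using N.dual_map_S[OF l(1) that(1)] N.dual_map_S[OF l(1) that(2)] N.dual_map_add[OF l(1) that] by (simp add: res_add)
    fix r u assume r: "r \<in> carrier R" and u: "u \<in> carrier N"
    obtain s where s: "s \<in> S" "r = res s" using r unfolding R_carrier by blast
    show "res (N.dual_map l (r \<odot>\<^bsub>N\<^esub> u)) = r \<otimes>\<^bsub>R\<^esub> res (N.dual_map l u)"
      using N.dual_map_linear[OF l(1) s(1) u] N.dual_map_S[OF l(1) u] N.dual_map_S[OF l(1), of "N.act s u"] s u
        res_eq[of "N.dual_map l (N.act s u)" "s * N.dual_map l u"]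
      by (simp add: res_mult N.act_def)
  next
    show wc: "w \<in> carrier N" unfolding w_def using u(2) v(1) by simp
    have "N.dual_map l w - inverse (N.dual_map l v) * N.dual_map l v \<in> I"
      unfolding w_def by (rule N.dual_map_linear[OF l(1) u(2) v(1)])
    then show "res (N.dual_map l w) = \<one>\<^bsub>R\<^esub>"
      using u(1) res_eq[of "N.dual_map l w" 1] N.dual_map_S[OF l(1) wc] by (simp add: res_one)
  qed
qed

section \<open>Depth one\<close>

lemma (in cring) genideal_empty: "Idl {} = {\<zero>}"
proof (rule equalityI)
  show "Idl {} \<subseteq> {\<zero>}" by (rule genideal_minimal[OF zeroideal]) simp
  show "{\<zero>} \<subseteq> Idl {}"
    using additive_subgroup.zero_closed[OF ideal.axioms(1)[OF genideal_ideal[of "{}"]]] by simp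
qed

lemma (in module) ideal_smult_principal:
  assumes r: "r \<in> carrier R"
  shows "ideal_smult R (Idl {r}) M = {r \<odot>\<^bsub>M\<^esub> v | v. v \<in> carrier M}" (is "_ = ?N")
proof (rule equalityI)
  have NI: "r \<odot>\<^bsub>M\<^esub> v \<in> ?N" if "v \<in> carrier M" for v using that by blast
  have "submodule ?N R M"
  proof (rule submoduleI)
    show "?N \<subseteq> carrier M" using r by auto
    show "\<zero>\<^bsub>M\<^esub> \<in> ?N" using NI[of "\<zero>\<^bsub>M\<^esub>"] r by simp
    show "\<ominus>\<^bsub>M\<^esub> u \<in> ?N" if u: "u \<in> ?N" for u
    proof -
      obtain v where "u = r \<odot>\<^bsub>M\<^esub> v" "v \<in> carrier M" using u by blast
      then show ?thesis using NI[of "\<ominus>\<^bsub>M\<^esub> v"] r by (simp add: smult_r_minus)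
    qed
    show "u \<oplus>\<^bsub>M\<^esub> v \<in> ?N" if uv: "u \<in> ?N" "v \<in> ?N" for u v
    proof -
      obtain u' v' where "u = r \<odot>\<^bsub>M\<^esub> u'" "u' \<in> carrier M" "v = r \<odot>\<^bsub>M\<^esub> v'" "v' \<in> carrier M" using uv by blast
      then show ?thesis using NI[of "u' \<oplus>\<^bsub>M\<^esub> v'"] r by (simp add: smult_r_distr)
    qed
    show "s \<odot>\<^bsub>M\<^esub> u \<in> ?N" if s: "s \<in> carrier R" and u: "u \<in> ?N" for s u
    proof -
      obtain v where v: "u = r \<odot>\<^bsub>M\<^esub> v" "v \<in> carrier M" using u by blast
      then have "s \<odot>\<^bsub>M\<^esub> u = r \<odot>\<^bsub>M\<^esub> (s \<odot>\<^bsub>M\<^esub> v)"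
        using smult_assoc1[of s r v] smult_assoc1[of r s v] r s by (simp add: R.m_comm)
      then show ?thesis using NI[of "s \<odot>\<^bsub>M\<^esub> v"] v s by simp
    qed
  qed
  then show "ideal_smult R (Idl {r}) M \<subseteq> ?N"
    unfolding ideal_smult_def
  proof (rule module_span_least)
    show "{a \<odot>\<^bsub>M\<^esub> v | a v. a \<in> Idl {r} \<and> v \<in> carrier M} \<subseteq> ?N"
    proof safe
      fix a v assume a: "a \<in> Idl {r}" and v: "v \<in> carrier M"
      obtain s where s: "s \<in> carrier R" "a = s \<otimes> r"
        using a R.cgenideal_eq_genideal[OF r] by (auto simp: cgenideal_def)
      then have "a \<odot>\<^bsub>M\<^esub> v = r \<odot>\<^bsub>M\<^esub> (s \<odot>\<^bsub>M\<^esub> v)" using r v by (simp add: R.m_comm[of s r] smult_assoc1)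
      then show "\<exists>va. a \<odot>\<^bsub>M\<^esub> v = r \<odot>\<^bsub>M\<^esub> va \<and> va \<in> carrier M" using s v by blast
    qed
  qed
  show "?N \<subseteq> ideal_smult R (Idl {r}) M"
  proof
    fix u assume "u \<in> ?N"
    then have "u \<in> {a \<odot>\<^bsub>M\<^esub> v | a v. a \<in> Idl {r} \<and> v \<in> carrier M}" using R.genideal_self'[OF r] by blast
    then show "u \<in> ideal_smult R (Idl {r}) M"
      unfolding ideal_smult_def by (rule subsetD[OF module_span_superset])
  qed
qed

lemma (in module) ideal_smult_empty: "ideal_smult R (Idl {}) M = {\<zero>\<^bsub>M\<^esub>}"
  unfolding R.genideal_empty by (subst ideal_smult_eq_zero_iff) auto

lemma ideal_smult_mono:
  assumes "J \<subseteq> J'" shows "ideal_smult R J M \<subseteq> ideal_smult R J' M"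
  unfolding ideal_smult_def module_span_def using assms by blast

lemma (in module) regular_sequence_hd:
  assumes "regular_sequence R M (a # as)"
  shows "a \<in> carrier R" "\<And>v. v \<in> carrier M \<Longrightarrow> a \<odot>\<^bsub>M\<^esub> v = \<zero>\<^bsub>M\<^esub> \<Longrightarrow> v = \<zero>\<^bsub>M\<^esub>"
proof -
  show "a \<in> carrier R" using assms by (simp add: regular_sequence_def)
  fix v assume "v \<in> carrier M" "a \<odot>\<^bsub>M\<^esub> v = \<zero>\<^bsub>M\<^esub>"
  moreover have "\<forall>i<length (a # as). \<forall>v\<in>carrier M.
       (a # as) ! i \<odot>\<^bsub>M\<^esub> v \<in> ideal_smult R (Idl (set (take i (a # as)))) M \<longrightarrow>
       v \<in> ideal_smult R (Idl (set (take i (a # as)))) M"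
    using assms unfolding regular_sequence_def by blast
  from this[rule_format, of 0 v] have "v \<in> carrier M \<Longrightarrow> a \<odot>\<^bsub>M\<^esub> v \<in> {\<zero>\<^bsub>M\<^esub>} \<Longrightarrow> v \<in> {\<zero>\<^bsub>M\<^esub>}"
    by (simp add: ideal_smult_empty)
  ultimately show "v = \<zero>\<^bsub>M\<^esub>" by simp
qed

context curve_module
begin

lemma act_power_cancel:
  assumes p: "p \<in> S" "\<And>v. v \<in> carrier M \<Longrightarrow> p \<bullet> v = \<zero> \<Longrightarrow> v = \<zero>"
    and v: "v \<in> carrier M" "p ^ j \<bullet> v = \<zero>"
  shows "v = \<zero>"
  using v
proof (induction j arbitrary: v)
  case (Suc j)
  then have "p \<bullet> (p ^ j \<bullet> v) = \<zero>" using p(1) by (simp add: act_mult)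
  with Suc.prems(1) p(1) have "p ^ j \<bullet> v = \<zero>" using p(2)[of "p ^ j \<bullet> v"] by simp
  with Suc show ?case by blast
qed simp

text \<open>For a regular pair \<open>p, q\<close>, powers of \<open>p\<close> cancel in the
  relation of \<open>algebraic\<close>, so \<open>z^n M\<close> lies in \<open>p M\<close>, while a
  power of \<open>q\<close> is a multiple of \<open>z\<close>. Hence a power of \<open>q\<close>
  maps \<open>M\<close> into \<open>p M\<close>; regularity of \<open>q\<close> modulo
  \<open>p M\<close> forces \<open>M = p M\<close>, against the properness clause of a regular
  sequence.\<close>

lemma regular_sequence_length:
  assumes rs: "regular_sequence R M rs" and m: "set rs \<subseteq> max_ideal R"
  shows "length rs \<le> 1"
proof (rule ccontr)
  assume "\<not> length rs \<le> 1"
  then obtain a b bs where rs_eq: "rs = a # b # bs"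
    by (cases rs; cases "tl rs") auto
  obtain p q where p: "p \<in> nn" "a = res p" and q: "q \<in> nn" "b = res q"
    using m unfolding rs_eq max_ideal_R by auto
  have pS: "p \<in> S" and qS: "q \<in> S" using p q nn_S by auto
  have a_reg: "v = \<zero>" if "v \<in> carrier M" "p \<bullet> v = \<zero>" for v
    using M.regular_sequence_hd(2)[of a "b # bs" v] rs that unfolding rs_eq p(2) act_def by blast
  have aM: "ideal_smult R (Idl\<^bsub>R\<^esub> {a}) M = {p \<bullet> v | v. v \<in> carrier M}"
    unfolding act_def p(2)[symmetric] using M.ideal_smult_principal[of a] pS p(2) by simp
  have all: "\<forall>i<length rs. \<forall>v\<in>carrier M.
       rs ! i \<odot> v \<in> ideal_smult R (Idl\<^bsub>R\<^esub> (set (take i rs))) M \<longrightarrow>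
       v \<in> ideal_smult R (Idl\<^bsub>R\<^esub> (set (take i rs))) M"
    using rs unfolding regular_sequence_def by blast
  have b_reg: "\<exists>w\<in>carrier M. v = p \<bullet> w" if "v \<in> carrier M" "w \<in> carrier M" "q \<bullet> v = p \<bullet> w" for v w
  proof -
    have "rs ! 1 \<odot> v \<in> ideal_smult R (Idl\<^bsub>R\<^esub> (set (take 1 rs))) M"
      using that by (auto simp: rs_eq aM q(2) act_def)
    then have "v \<in> ideal_smult R (Idl\<^bsub>R\<^esub> (set (take 1 rs))) M" using all[rule_format, of 1 v] that(1) by (simp add: rs_eq)
    then show ?thesis by (auto simp: rs_eq aM)
  qed
  have bn_reg: "\<exists>w\<in>carrier M. v = p \<bullet> w" if "v \<in> carrier M" "\<exists>w\<in>carrier M. q ^ n \<bullet> v = p \<bullet> w" for v n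
    using that
  proof (induction n arbitrary: v)
    case 0 then show ?case by simp
  next
    case (Suc n)
    then have "q \<bullet> v \<in> carrier M" "\<exists>w\<in>carrier M. q ^ n \<bullet> (q \<bullet> v) = p \<bullet> w"
      using qS by (auto simp: mult.commute simp flip: act_mult)
    from Suc.IH[OF this] show ?case using b_reg Suc.prems(1) by blast
  qed
  obtain n w j where w: "w \<in> S" "p ^ j * (z ^ n + p * w) \<in> I" using algebraic[OF pS] by blast
  have pj: "v = \<zero>" if "v \<in> carrier M" "p ^ j \<bullet> v = \<zero>" for v j
    by (rule act_power_cancel[OF pS _ that]) (rule a_reg)
  have zn: "z ^ n \<bullet> v = p \<bullet> ((- w) \<bullet> v)" if v: "v \<in> carrier M" for v
  proof -
    have "p ^ j \<bullet> ((z ^ n + p * w) \<bullet> v) = \<zero>"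
      using act_I[OF w(2) v] pS w v act_mult[of "p ^ j" "z ^ n + p * w" v] by simp
    then have "(z ^ n + p * w) \<bullet> v = \<zero>" using pS w v pj[of "(z ^ n + p * w) \<bullet> v" j] by simp
    moreover have "z ^ n = (z ^ n + p * w) + p * (- w)" by simp
    then have "z ^ n \<bullet> v = ((z ^ n + p * w) + p * (- w)) \<bullet> v" by (simp only:)
    then have "z ^ n \<bullet> v = (z ^ n + p * w) \<bullet> v \<oplus> p \<bullet> ((- w) \<bullet> v)"
      using act_add[of "z ^ n + p * w" "p * (- w)" v] act_mult[of p "- w" v] pS w v by simp
    ultimately show ?thesis using pS w v by simp
  qed
  obtain N where "q ^ N \<in> princ z" using nilpotent_mod_z[OF q(1)] by blast
  then obtain s where s: "s \<in> S" "q ^ N - z * s \<in> I" by (rule princE)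
  have qN: "q ^ N \<bullet> v = z \<bullet> (s \<bullet> v)" if "v \<in> carrier M" for v
    using act_cong[OF _ _ s(2) that] qS s that by (simp add: act_mult)
  have qNk: "\<exists>u\<in>carrier M. (q ^ N) ^ k \<bullet> v = z ^ k \<bullet> u" if "v \<in> carrier M" for v k
    using that
  proof (induction k arbitrary: v)
    case 0 then show ?case by auto
  next
    case (Suc k)
    then obtain u where u: "u \<in> carrier M" "(q ^ N) ^ k \<bullet> (s \<bullet> v) = z ^ k \<bullet> u" using s by (metis act_closed)
    have "(q ^ N) ^ Suc k \<bullet> v = (q ^ N) ^ k \<bullet> (z \<bullet> (s \<bullet> v))"
      using Suc.prems qS qN[OF Suc.prems] act_mult[of "(q ^ N) ^ k" "q ^ N" v] by (simp add: mult.commute)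
    also have "\<dots> = z \<bullet> (z ^ k \<bullet> u)" using act_comm[of "(q ^ N) ^ k" z "s \<bullet> v"] Suc.prems qS s u by simp
    finally show ?case using u by (intro bexI[of _ u]) (simp_all add: act_mult)
  qed
  have in_aM: "v \<in> ideal_smult R (Idl\<^bsub>R\<^esub> {a}) M" if v: "v \<in> carrier M" for v
  proof -
    obtain u where u: "u \<in> carrier M" "(q ^ N) ^ n \<bullet> v = z ^ n \<bullet> u" using qNk[OF v] by blast
    then have "\<exists>w\<in>carrier M. q ^ (N * n) \<bullet> v = p \<bullet> w" using zn[OF u(1)] w by (auto simp: power_mult)
    from bn_reg[OF v this] show ?thesis unfolding aM by blast
  qed
  have Idl: "Idl\<^bsub>R\<^esub> {a} \<subseteq> Idl\<^bsub>R\<^esub> (set rs)"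
    using pS qS rs by (intro R.subset_Idl_subset) (auto simp: rs_eq regular_sequence_def)
  have "carrier M \<subseteq> ideal_smult R (Idl\<^bsub>R\<^esub> (set rs)) M"
    by (rule subsetI, rule subsetD[OF ideal_smult_mono[OF Idl]], rule in_aM)
  moreover have "ideal_smult R (Idl\<^bsub>R\<^esub> (set rs)) M \<subseteq> carrier M"
    unfolding ideal_smult_def
  proof (rule module_span_least[OF M.carrier_submodule])
    have "Idl\<^bsub>R\<^esub> (set rs) \<subseteq> carrier R"
      using rs ideal.Icarr[OF R.genideal_ideal] by (auto simp: regular_sequence_def)
    then show "{a \<odot> v | a v. a \<in> Idl\<^bsub>R\<^esub> (set rs) \<and> v \<in> carrier M} \<subseteq> carrier M" by auto
  qed
  ultimately show False using rs by (auto simp: regular_sequence_def)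
qed

text \<open>Some \<open>p\<close> in the maximal ideal is regular on \<open>M\<close>, and a power
  of \<open>p\<close> is a multiple of \<open>z\<close>; whatever \<open>z\<close> kills is killed
  by that power.\<close>

lemma MCM_z_regular: assumes "MCM R M" shows z_regular
proof -
  let ?A = "{enat (length rs) | rs. set rs \<subseteq> max_ideal R \<and> regular_sequence R M rs}"
  have d: "depth R M = 1" using assms by (simp add: MCM_def krull_dim_R)
  then have ne: "carrier M \<noteq> {\<zero>}" by (auto simp: depth_def)
  have "\<exists>rs. set rs \<subseteq> max_ideal R \<and> regular_sequence R M rs \<and> rs \<noteq> []"
  proof (rule ccontr)
    assume "\<not> ?thesis"
    then have "Sup ?A \<le> 0" by (intro Sup_least) (auto simp: zero_enat_def)
    then show False using d ne by (simp add: depth_def)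
  qed
  then obtain a as where rs: "a \<in> max_ideal R" "regular_sequence R M (a # as)" 
    by (metis list.exhaust list.set_intros(1) subsetD)
  then obtain p where p: "p \<in> nn" "a = res p" unfolding max_ideal_R by blast
  have pS: "p \<in> S" using p nn_S by blast
  obtain N where "p ^ N \<in> princ z" using nilpotent_mod_z[OF p(1)] by blast
  then obtain s where s: "s \<in> S" "p ^ N - z * s \<in> I" by (rule princE)
  have a_reg: "v = \<zero>" if "v \<in> carrier M" "p \<bullet> v = \<zero>" for v
    using M.regular_sequence_hd(2)[OF rs(2)] that unfolding p(2) act_def by blast
  have pj: "v = \<zero>" if "v \<in> carrier M" "p ^ j \<bullet> v = \<zero>" for v j
    by (rule act_power_cancel[OF pS _ that]) (rule a_reg)
  show ?thesis
    unfolding z_regular_def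
  proof (intro ballI impI)
    fix v assume v: "v \<in> carrier M" "z \<bullet> v = \<zero>"
    have "p ^ N \<bullet> v = (z * s) \<bullet> v" using act_cong[OF _ _ s(2) v(1)] pS s by simp
    also have "\<dots> = s \<bullet> (z \<bullet> v)" using act_mult[of s z v] s v by (simp add: mult.commute)
    also have "\<dots> = \<zero>" using s v by simp
    finally show "v = \<zero>" by (rule pj[OF v(1)])
  qed
qed

text \<open>The element \<open>w\<close> certifies that \<open>z M\<close> is proper, so
  \<open>z\<close> alone is a regular sequence; longer ones are excluded by
  \<open>regular_sequence_length\<close>.\<close>

lemma MCM_I:
  assumes "fg_module R M" z_regular "w \<in> carrier M" "\<And>v. v \<in> carrier M \<Longrightarrow> w \<noteq> z \<bullet> v"
  shows "MCM R M"
proof -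
  let ?A = "{enat (length rs) | rs. set rs \<subseteq> max_ideal R \<and> regular_sequence R M rs}"
  have zM: "ideal_smult R (Idl\<^bsub>R\<^esub> {res z}) M = {z \<bullet> v | v. v \<in> carrier M}"
    unfolding act_def using M.ideal_smult_principal[of "res z"] by simp
  have wn: "w \<notin> ideal_smult R (Idl\<^bsub>R\<^esub> {res z}) M" unfolding zM using assms(4) by blast
  have "carrier M \<noteq> {\<zero>}" using assms(3) assms(4)[of "\<zero>"] by auto
  then have "depth R M = Sup ?A" by (simp add: depth_def)
  also have "\<dots> = 1"
  proof (rule antisym)
    show "Sup ?A \<le> 1" using regular_sequence_length by (intro Sup_least) (auto simp: one_enat_def)
    have "regular_sequence R M [res z]"
      unfolding regular_sequence_def
      using assms(2,3) wn by (auto simp: M.ideal_smult_empty z_regular_def act_def)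
    then have "enat (length [res z]) \<in> ?A" unfolding max_ideal_R by (intro CollectI exI[of _ "[res z]"]) simp
    then show "1 \<le> Sup ?A" unfolding one_enat_def by (intro Sup_upper) simp
  qed
  finally show ?thesis using assms(1) by (simp add: MCM_def krull_dim_R)
qed

end

section \<open>Ideals as modules\<close>

text \<open>
  The modules in the definition of \<open>delta\<close> have elements of type \<open>(nat \<Rightarrow> 'r) set\<close>, into which an ideal
  has to be transported.
\<close>
definition code :: "'r \<Rightarrow> (nat \<Rightarrow> 'r) set" where "code r = {\<lambda>_. r}"
definition decode :: "(nat \<Rightarrow> 'r) set \<Rightarrow> 'r" where "decode C = the_elem C 0"

lemma decode_code [simp]: "decode (code r) = r" by (simp add: code_def decode_def)
lemma code_inject [simp]: "code r = code s \<longleftrightarrow> r = s" by (metis decode_code)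

definition coded_ideal :: "('r, 'c) ring_scheme \<Rightarrow> 'r set \<Rightarrow> ('r, (nat \<Rightarrow> 'r) set) module" where
  "coded_ideal R J = \<lparr>carrier = code ` J, monoid.mult = undefined, one = undefined, ring.zero = code \<zero>\<^bsub>R\<^esub>,
     add = (\<lambda>C D. code (decode C \<oplus>\<^bsub>R\<^esub> decode D)), module.smult = (\<lambda>r C. code (r \<otimes>\<^bsub>R\<^esub> decode C))\<rparr>"

lemma coded_ideal_simps [simp]:
  "carrier (coded_ideal R J) = code ` J" "\<zero>\<^bsub>coded_ideal R J\<^esub> = code \<zero>\<^bsub>R\<^esub>"
  "code r \<oplus>\<^bsub>coded_ideal R J\<^esub> code s = code (r \<oplus>\<^bsub>R\<^esub> s)" "t \<odot>\<^bsub>coded_ideal R J\<^esub> code r = code (t \<otimes>\<^bsub>R\<^esub> r)"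
  by (simp_all add: coded_ideal_def)

lemma (in cring) coded_ideal_module:
  assumes J: "ideal J R" shows "module R (coded_ideal R J)"
proof -
  interpret J: ideal J R by (rule J)
  show ?thesis
  proof (rule moduleI)
    show "abelian_group (coded_ideal R J)"
    proof (rule abelian_groupI)
      fix C assume "C \<in> carrier (coded_ideal R J)"
      then obtain r where "r \<in> J" "C = code r" by auto
      then show "\<exists>D\<in>carrier (coded_ideal R J). D \<oplus>\<^bsub>coded_ideal R J\<^esub> C = \<zero>\<^bsub>coded_ideal R J\<^esub>"
        using J.a_inv_closed J.Icarr by (intro bexI[of _ "code (\<ominus> r)"]) (auto simp: l_neg)
    qed (auto simp: J.Icarr J.a_closed a_ac)
  qed (auto simp: is_cring J.Icarr J.I_l_closed l_distr r_distr m_assoc)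
qed

section \<open>Delta invariants\<close>

context curve
begin

text \<open>The condition that \<open>y^6\<close> maps \<open>N\<close> into \<open>z N\<close>
  passes to direct summands. On a summand \<open>R^m\<close> with \<open>m > 0\<close>, the first
  coordinate of \<open>y^6 (1, ..., 1)\<close> would make \<open>y^6\<close> a multiple of
  \<open>z\<close> in \<open>R\<close>.\<close>

lemma f_rank_zero:
  fixes N :: "('f set, 'a) module"
  assumes "module R N" and div: "\<And>v. v \<in> carrier N \<Longrightarrow> \<exists>w\<in>carrier N. res (y^6) \<odot>\<^bsub>N\<^esub> v = res z \<odot>\<^bsub>N\<^esub> w"
  shows "f_rank R N = 0"
proof -
  interpret N: module R N by fact
  have "m = 0" if Y: "module R Y'" and iso: "module_isomorphic R N (direct_sum_module (free_module R m) Y')"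
    for m and Y' :: "('f set, 'a) module"
  proof (rule ccontr)
    assume m: "m \<noteq> 0"
    interpret Y: module R Y' by (rule Y)
    let ?D = "direct_sum_module (free_module R m) Y'"
    obtain h where h: "h \<in> module_hom R N ?D" "bij_betw h (carrier N) (carrier ?D)"
      using iso unfolding module_isomorphic_def by blast
    define e where "e = ((\<lambda>i\<in>{..<m}. \<one>\<^bsub>R\<^esub>), \<zero>\<^bsub>Y'\<^esub>)"
    have "e \<in> carrier ?D" by (simp add: e_def direct_sum_module_def free_module_def)
    then have "e \<in> h ` carrier N" unfolding bij_betw_imp_surj_on[OF h(2)] .
    then obtain v where v: "v \<in> carrier N" "h v = e" by blast
    obtain w where w: "w \<in> carrier N" "res (y^6) \<odot>\<^bsub>N\<^esub> v = res z \<odot>\<^bsub>N\<^esub> w" using div[OF v(1)] by blast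
    have "h w \<in> carrier ?D" using h(1) w unfolding module_hom_def by blast
    then obtain p k where hw: "h w = (p, k)" "p \<in> {..<m} \<rightarrow>\<^sub>E carrier R" by (auto simp: direct_sum_module_def free_module_def)
    have sm: "h (r \<odot>\<^bsub>N\<^esub> u) = r \<odot>\<^bsub>?D\<^esub> h u" if "r \<in> carrier R" "u \<in> carrier N" for r u
      using h(1) that unfolding module_hom_def by blast
    have "res (y^6) \<odot>\<^bsub>?D\<^esub> e = res z \<odot>\<^bsub>?D\<^esub> (p, k)"
      using sm[of "res (y^6)" v] sm[of "res z" w] v w hw by simp
    then have "(\<lambda>i\<in>{..<m}. res (y^6) \<otimes>\<^bsub>R\<^esub> (\<lambda>i\<in>{..<m}. \<one>\<^bsub>R\<^esub>) i) = (\<lambda>i\<in>{..<m}. res z \<otimes>\<^bsub>R\<^esub> p i)"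
      by (simp add: e_def direct_sum_module_def free_module_def)
    from fun_cong[OF this, of 0] have eq: "res (y^6) = res z \<otimes>\<^bsub>R\<^esub> p 0" using m by simp
    have "p 0 \<in> carrier R" using hw(2) m by (auto simp: PiE_def)
    then obtain s where s: "s \<in> S" "p 0 = res s" unfolding R_carrier by blast
    then have "res (y^6) = res (z * s)" using eq by (simp add: res_mult)
    then show False using res_eq[of "y^6" "z * s"] y6_not_zS s by simp
  qed
  then have "f_rank R N \<le> 0" unfolding f_rank_def by (intro Sup_least) (auto simp: zero_enat_def)
  then show ?thesis by simp
qed

text \<open>If the generator had two free coordinates \<open>p 0\<close>, \<open>p 1\<close>, there
  would be \<open>r\<close>, \<open>s\<close> with \<open>r p 0 = 1\<close>,
  \<open>r p 1 = 0\<close>, \<open>s p 1 = 1\<close>, and then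
  \<open>1 = (s p 1) (r p 0) = (s p 0) (r p 1) = 0\<close>.\<close>

lemma f_rank_cyclic:
  fixes N :: "('f set, 'a) module"
  assumes "module R N" and g: "g \<in> carrier N" "\<And>v. v \<in> carrier N \<Longrightarrow> \<exists>r\<in>carrier R. v = r \<odot>\<^bsub>N\<^esub> g"
  shows "f_rank R N \<le> 1"
proof -
  interpret N: module R N by fact
  have "m \<le> 1" if Y: "module R Y'" and iso: "module_isomorphic R N (direct_sum_module (free_module R m) Y')"
    for m and Y' :: "('f set, 'a) module"
  proof (rule ccontr)
    assume m: "\<not> m \<le> 1"
    interpret Y: module R Y' by (rule Y)
    let ?D = "direct_sum_module (free_module R m) Y'"
    obtain h where h: "h \<in> module_hom R N ?D" "bij_betw h (carrier N) (carrier ?D)"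
      using iso unfolding module_isomorphic_def by blast
    have "h g \<in> carrier ?D" using h(1) g unfolding module_hom_def by blast
    then obtain p k where hg: "h g = (p, k)" "p \<in> {..<m} \<rightarrow>\<^sub>E carrier R" by (auto simp: direct_sum_module_def free_module_def)
    have pc: "p 0 \<in> carrier R" "p 1 \<in> carrier R" using hg(2) m by (auto simp: PiE_def)
    have unit: "\<exists>r\<in>carrier R. \<forall>i<m. r \<otimes>\<^bsub>R\<^esub> p i = (if i = j then \<one>\<^bsub>R\<^esub> else \<zero>\<^bsub>R\<^esub>)" for j :: nat
    proof -
      define e where "e = ((\<lambda>i\<in>{..<m}. if i = j then \<one>\<^bsub>R\<^esub> else \<zero>\<^bsub>R\<^esub>), \<zero>\<^bsub>Y'\<^esub>)"
      have "e \<in> carrier ?D" by (auto simp: e_def direct_sum_module_def free_module_def)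
      then have "e \<in> h ` carrier N" unfolding bij_betw_imp_surj_on[OF h(2)] .
    then obtain v where v: "v \<in> carrier N" "h v = e" by blast
      obtain r where r: "r \<in> carrier R" "v = r \<odot>\<^bsub>N\<^esub> g" using g(2)[OF v(1)] by blast
      have "e = r \<odot>\<^bsub>?D\<^esub> (p, k)" using h(1) r g(1) v hg unfolding module_hom_def by auto
      then have eq: "(\<lambda>i\<in>{..<m}. if i = j then \<one>\<^bsub>R\<^esub> else \<zero>\<^bsub>R\<^esub>) = (\<lambda>i\<in>{..<m}. r \<otimes>\<^bsub>R\<^esub> p i)"
        by (simp add: e_def direct_sum_module_def free_module_def)
      have "r \<otimes>\<^bsub>R\<^esub> p i = (if i = j then \<one>\<^bsub>R\<^esub> else \<zero>\<^bsub>R\<^esub>)" if "i < m" for i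
        using fun_cong[OF eq, of i] that by simp
      then show ?thesis using r by blast
    qed
    obtain r where r: "r \<in> carrier R" "r \<otimes>\<^bsub>R\<^esub> p 0 = \<one>\<^bsub>R\<^esub>" "r \<otimes>\<^bsub>R\<^esub> p 1 = \<zero>\<^bsub>R\<^esub>" using unit[of 0] m by fastforce
    obtain s where s: "s \<in> carrier R" "s \<otimes>\<^bsub>R\<^esub> p 1 = \<one>\<^bsub>R\<^esub>" using unit[of 1] m by fastforce
    have "\<one>\<^bsub>R\<^esub> = (s \<otimes>\<^bsub>R\<^esub> p 1) \<otimes>\<^bsub>R\<^esub> (r \<otimes>\<^bsub>R\<^esub> p 0)" using r s by simp
    also have "\<dots> = (s \<otimes>\<^bsub>R\<^esub> p 0) \<otimes>\<^bsub>R\<^esub> (r \<otimes>\<^bsub>R\<^esub> p 1)" using r(1) s(1) pc by (simp add: R.m_ac)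
    also have "\<dots> = \<zero>\<^bsub>R\<^esub>" using r s pc by simp
    finally show False using res_eq_zero[of 1] one_notin_I by (simp add: res_one)
  qed
  then show ?thesis unfolding f_rank_def by (intro Sup_least) (auto simp: one_enat_def)
qed

lemma coded_res_module: "sideal A \<Longrightarrow> module R (coded_ideal R (res ` A))"
  by (rule R.coded_ideal_module[OF ideal_res])

text \<open>An ideal inherits regularity of \<open>z\<close> from \<open>R\<close>, so only finite
  generation and an element \<open>w\<close> outside \<open>z\<close> times the ideal have to be
  supplied.\<close>

lemma coded_MCM:
  assumes sA: "sideal A"
    and gen: "G \<subseteq> A" "finite G"
      "\<And>N. submodule N R (coded_ideal R (res ` A)) \<Longrightarrow> code ` res ` G \<subseteq> N \<Longrightarrow> code ` res ` A \<subseteq> N"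
    and w: "w \<in> A" "\<And>s. s \<in> A \<Longrightarrow> w - z * s \<notin> I"
  shows "MCM R (coded_ideal R (res ` A))"
proof -
  let ?N = "coded_ideal R (res ` A)"
  have A: "A \<subseteq> S" using sidealD(1)[OF sA] by blast
  interpret N: module R ?N by (rule coded_res_module[OF sA])
  interpret N: curve_module S I V x y z ?N by unfold_locales
  have act: "N.act s (code (res t)) = code (res (s * t))" if "s \<in> S" "t \<in> A" for s t
    using that A by (auto simp: N.act_def res_mult)
  show ?thesis
  proof (rule N.MCM_I)
    have span: "module_span R ?N (code ` res ` G) = carrier ?N"
    proof (rule equalityI)
      show "module_span R ?N (code ` res ` G) \<subseteq> carrier ?N"
        by (rule module_span_least[OF N.carrier_submodule]) (use gen(1) in auto)
      show "carrier ?N \<subseteq> module_span R ?N (code ` res ` G)"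
        unfolding module_span_def using gen(3) by auto
    qed
    have "code ` res ` G \<subseteq> carrier ?N" using gen(1) by auto
    with span show "fg_module R ?N" unfolding fg_module_def
      by (intro conjI N.module_axioms exI[of _ "code ` res ` G"] finite_imageI gen(2))
    show "N.z_regular"
      unfolding N.z_regular_def
    proof (intro ballI impI)
      fix v assume "v \<in> carrier ?N" and z0: "N.act z v = \<zero>\<^bsub>?N\<^esub>"
      then obtain t where t: "t \<in> A" "v = code (res t)" by auto
      have tS: "t \<in> S" using t(1) A by blast
      have "res (z * t) = \<zero>\<^bsub>R\<^esub>" using z0 act[OF zS t(1)] t(2) by simp
      then have "z * t \<in> I" using res_eq_zero[of "z * t"] tS by simp
      then have "t \<in> I" by (rule z_cancel[OF tS])
      then show "v = \<zero>\<^bsub>?N\<^esub>" using t(2) res_eq_zero[OF tS] by simp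
    qed
    show "code (res w) \<in> carrier ?N" using w(1) by simp
    fix v assume "v \<in> carrier ?N"
    then obtain t where t: "t \<in> A" "v = code (res t)" by auto
    have "res w \<noteq> res (z * t)" using w(2)[OF t(1)] res_eq[of w "z * t"] subsetD[OF A] w(1) t(1) by simp
    then show "code (res w) \<noteq> N.act z v" using act[OF zS t(1)] t(2) by simp
  qed
qed

section \<open>The quotients by powers of the maximal ideal\<close>

abbreviation quot_power :: "nat \<Rightarrow> ('f set, 'f set set) module" where
  "quot_power n \<equiv> quot_module R (max_ideal_power R n)"

abbreviation proj :: "nat \<Rightarrow> 'f \<Rightarrow> 'f set set" where "proj n s \<equiv> max_ideal_power R n +>\<^bsub>R\<^esub> res s"

lemma power_ideal: "ideal (max_ideal_power R n) R"
  unfolding max_ideal_power_R by (rule Pw_ideal)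

lemma proj_eq: assumes st: "s \<in> S" "t \<in> S" shows "proj n s = proj n t \<longleftrightarrow> s - t \<in> Pw n"
proof -
  have "res s \<ominus>\<^bsub>R\<^esub> res t = res (s - t)"
    using st res_add[of s "- t"] res_uminus[of t] by (simp add: R.minus_eq)
  then have "proj n s = proj n t \<longleftrightarrow> res (s - t) \<in> max_ideal_power R n"
    using R.quotient_eq_iff_same_a_r_cos[OF power_ideal, of "res s" "res t"] st by simp
  also have "\<dots> \<longleftrightarrow> s - t \<in> Pw n"
    unfolding max_ideal_power_R by (rule res_mem_iff[OF sideal_Pw]) (use st in simp)
  finally show ?thesis .
qed

lemma quot_power_carrier: "carrier (quot_power n) = proj n ` S"
  by (auto simp: quot_module_def FactRing_def A_RCOSETS_def' R_carrier)

lemma quot_power_add: "s \<in> S \<Longrightarrow> t \<in> S \<Longrightarrow> proj n s \<oplus>\<^bsub>quot_power n\<^esub> proj n t = proj n (s + t)"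
  using ring_hom_add[OF ideal.rcos_ring_hom[OF power_ideal[of n]], of "res s" "res t"]
  by (simp add: quot_module_def res_add)

lemma quot_power_smult: "s \<in> S \<Longrightarrow> t \<in> S \<Longrightarrow> res s \<odot>\<^bsub>quot_power n\<^esub> proj n t = proj n (s * t)"
  using ring_hom_mult[OF ideal.rcos_ring_hom[OF power_ideal[of n]], of "res s" "res t"]
  by (simp add: quot_module_def res_mult)

lemma f_rank_of_cover:
  fixes Y :: "('f set, 'a) module"
  assumes Y: "MCM R Y" and f: "f \<in> module_hom R Y (quot_power 5)" "f ` carrier Y = carrier (quot_power 5)"
  shows "f_rank R Y \<ge> 1"
proof -
  interpret Y: module R Y using Y by (simp add: MCM_def fg_module_def)
  interpret Y: curve_module S I V x y z Y by unfold_locales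
  have reg: "Y.z_regular" by (rule Y.MCM_z_regular[OF Y])
  have fsm: "f (Y.act s v) = res s \<odot>\<^bsub>quot_power 5\<^esub> f v" if "s \<in> S" "v \<in> carrier Y" for s v
    using f(1) that unfolding module_hom_def Y.act_def by auto
  have "proj 5 1 \<in> carrier (quot_power 5)" unfolding quot_power_carrier by simp
  then obtain v where v: "v \<in> carrier Y" "f v = proj 5 1" using f(2) by (metis imageE)
  have fv: "f (Y.act s v) = proj 5 s" if "s \<in> S" for s
    using fsm[OF that v(1)] quot_power_smult[OF that S_one] v(2) by simp
  have "\<forall>w\<in>carrier Y. Y.act (y^6) v \<noteq> Y.act z w"
  proof (intro ballI notI)
    fix w assume w: "w \<in> carrier Y" "Y.act (y^6) v = Y.act z w"
    have "f w \<in> carrier (quot_power 5)" using f(2) w(1) by blast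
    then obtain r where r: "r \<in> S" "f w = proj 5 r" unfolding quot_power_carrier by blast
    have fw: "f (Y.act s w) = proj 5 (s * r)" if "s \<in> S" for s
      using fsm[OF that w(1)] quot_power_smult[OF that r(1)] r(2) by simp
    have "proj 5 (y^6) = proj 5 (z * r)" using fv[of "y^6"] fw[of z] w(2) by simp
    then have 1: "y^6 - z * r \<in> Pw 5" using proj_eq r(1) by simp
    \<comment> \<open>This is \<open>y^7\<close> divided by \<open>z\<close>. Multiplying
      \<open>y^6 v = z w\<close> by \<open>y\<close> gives \<open>z (y w) = z (?q v)\<close>, and
      regularity of \<open>z\<close> on the module cancels \<open>z\<close>.\<close>
    let ?q = "x * z^4 - x * y * z^2"
    have "Y.act z (Y.act y w) = Y.act y (Y.act (y^6) v)"
      using w Y.act_comm[of z y w] by simp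
    also have "\<dots> = Y.act (y * y^6) v" using v by (simp add: Y.act_mult)
    also have "\<dots> = Y.act (z * ?q) v"
    proof (rule Y.act_cong)
      have "y * y^6 - z * ?q = y^7 - (z^5 * x - z^3 * (x * y))" by (simp add: algebra_simps eval_nat_numeral)
      then show "y * y^6 - z * ?q \<in> I" using y7 by simp
    qed (use v in simp_all)
    also have "\<dots> = Y.act z (Y.act ?q v)" by (rule Y.act_mult) (use v in simp_all)
    finally have eq: "Y.act z (Y.act y w) = Y.act z (Y.act ?q v)" .
    have "Y.act z (Y.act y w \<ominus>\<^bsub>Y\<^esub> Y.act ?q v) = Y.act z (Y.act y w) \<ominus>\<^bsub>Y\<^esub> Y.act z (Y.act ?q v)"
      by (rule Y.act_rdiff) (use w v in simp_all)
    then have "Y.act z (Y.act y w \<ominus>\<^bsub>Y\<^esub> Y.act ?q v) = \<zero>\<^bsub>Y\<^esub>"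
      unfolding eq using v by (simp add: Y.minus_eq Y.r_neg)
    then have "Y.act y w \<ominus>\<^bsub>Y\<^esub> Y.act ?q v = \<zero>\<^bsub>Y\<^esub>"
      using reg w v unfolding Y.z_regular_def by simp
    moreover have "Y.act y w = (Y.act y w \<ominus>\<^bsub>Y\<^esub> Y.act ?q v) \<oplus>\<^bsub>Y\<^esub> Y.act ?q v"
      using w(1) v(1) by (simp add: Y.minus_eq Y.a_assoc Y.l_neg)
    ultimately have "Y.act y w = Y.act ?q v" using v(1) by simp
    then have "proj 5 (y * r) = proj 5 ?q" using fw[of y] fv[of ?q] by simp
    then have "y * r - ?q \<in> Pw 5" using proj_eq[of "y * r" ?q 5] r(1) by simp
    with 1 show False by (rule no_lift[OF r(1)])
  qed
  then show ?thesis
    using Y reg v(1) by (intro f_rank_pos_R[where v = v]) (auto simp: MCM_def Y.z_regular_def Y.act_def)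
qed

text \<open>The upper bound is witnessed by \<open>R\<close> itself, which is cyclic; the lower
  bound is \<open>f_rank_of_cover\<close>.\<close>

lemma delta_power_5: "delta R (quot_power 5) = 1"
proof (rule antisym)
  show "1 \<le> delta R (quot_power 5)"
    unfolding delta_def by (intro Inf_greatest) (auto intro: f_rank_of_cover)
  let ?Y = "coded_ideal R (res ` S)"
  interpret Y: module R ?Y by (rule coded_res_module[OF sideal_S])
  have gen: "code (res s) = res s \<odot>\<^bsub>?Y\<^esub> code (res 1)" if "s \<in> S" for s
    using that by (simp flip: res_mult)
  have "MCM R ?Y"
  proof (rule coded_MCM[OF sideal_S, where G = "{1}" and w = 1])
    fix N assume N: "submodule N R ?Y" "code ` res ` {1} \<subseteq> N"
    have "code (res s) \<in> N" if "s \<in> S" for s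
      using submodule.smult_closed[OF N(1), of "res s" "code (res 1)"] N(2) gen[OF that] that by simp
    then show "code ` res ` S \<subseteq> N" by blast
  next
    show "1 - z * s \<notin> I" if "s \<in> S" for s
    proof
      assume "1 - z * s \<in> I"
      from nn_add[OF I_nn[OF this] nn_mult2[OF xyz_nn(3) that]] have "(1 - z * s) + z * s \<in> nn" .
      then show False using one_nn by simp
    qed
  qed (auto simp: I_S)
  moreover have "(\<lambda>C. max_ideal_power R 5 +>\<^bsub>R\<^esub> decode C) \<in> module_hom R ?Y (quot_power 5)"
    unfolding module_hom_def R_carrier
    by (auto simp: quot_power_carrier quot_power_add quot_power_smult simp flip: res_add res_mult)
  moreover have "(\<lambda>C. max_ideal_power R 5 +>\<^bsub>R\<^esub> decode C) ` carrier ?Y = carrier (quot_power 5)"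
    by (auto simp: quot_power_carrier image_image)
  ultimately have "delta R (quot_power 5) \<le> f_rank R ?Y"
    unfolding delta_def by (intro Inf_lower) blast
  also have "\<dots> \<le> 1"
  proof (rule f_rank_cyclic[OF Y.module_axioms])
    show "code (res 1) \<in> carrier ?Y" by simp
    fix v assume "v \<in> carrier ?Y"
    then obtain s where "s \<in> S" "v = code (res s)" by auto
    then show "\<exists>r\<in>carrier R. v = r \<odot>\<^bsub>?Y\<^esub> code (res 1)" using gen res_closed by metis
  qed
  finally show "delta R (quot_power 5) \<le> 1" .
qed

text \<open>The ideal \<open>(z, y\<^sup>6)\<close>, mapped to \<open>R/\<mm>\<^sup>4\<close> by \<open>z a + y\<^sup>6 b \<mapsto> a\<close>.\<close>
definition KK :: "'f set" where "KK = {z * a + y^6 * b + e | a b e. a \<in> S \<and> b \<in> S \<and> e \<in> I}"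

lemma KKI: "s = z * a + y^6 * b + e \<Longrightarrow> a \<in> S \<Longrightarrow> b \<in> S \<Longrightarrow> e \<in> I \<Longrightarrow> s \<in> KK"
  unfolding KK_def by blast

lemma sideal_KK: "sideal KK"
proof (rule sidealI)
  show "KK \<subseteq> S" using I_S by (auto simp: KK_def)
  show "I \<subseteq> KK" using KKI[of _ 0 0] by auto
  fix s assume "s \<in> KK"
  then obtain a b e where s: "s = z * a + y^6 * b + e" "a \<in> S" "b \<in> S" "e \<in> I" unfolding KK_def by blast
  show "s + t \<in> KK" if tK: "t \<in> KK" for t
  proof -
    obtain a' b' e' where t: "t = z * a' + y^6 * b' + e'" "a' \<in> S" "b' \<in> S" "e' \<in> I" using tK unfolding KK_def by blast
    show ?thesis by (rule KKI[of _ "a + a'" "b + b'" "e + e'"]) (use s t in \<open>simp_all add: algebra_simps\<close>)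
  qed
  show "t * s \<in> KK" if "t \<in> S" for t
    by (rule KKI[of _ "t * a" "t * b" "t * e"]) (use s that in \<open>simp_all add: algebra_simps I_mult2\<close>)
qed

text \<open>If \<open>z d = y^6 c\<close>, then \<open>c\<close> is no unit, since
  \<open>y^6\<close> is not a multiple of \<open>z\<close>. Writing \<open>c\<close> in terms of
  \<open>x\<close>, \<open>y\<close>, \<open>z\<close> allows division of \<open>y^6 c\<close> by
  \<open>z\<close>, which shows the degree of \<open>d\<close>.\<close>

lemma KK_quotient_well_defined:
  assumes d: "d \<in> S" "c \<in> S" "z * d - y^6 * c \<in> I" shows "d \<in> Pw 4"
proof -
  have "c \<in> nn"
  proof (rule ccontr)
    assume "c \<notin> nn"
    from unitI[OF d(2) this] have c: "c \<noteq> 0" "inverse c \<in> S" by auto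
    have "(- inverse c) * (z * d - y^6 * c) = y^6 * (inverse c * c) - z * (inverse c * d)"
      by (simp add: algebra_simps)
    then have "y^6 - z * (inverse c * d) \<in> I"
      using I_mult[OF d(3), of "- inverse c"] c by simp
    then show False using y6_not_zS c d by simp
  qed
  then obtain p q r where c: "c = x * p + y * q + z * r" "p \<in> S" "q \<in> S" "r \<in> S" by (elim nnE)
  \<comment> \<open>\<open>E\<close> is \<open>y^6 c\<close> divided by \<open>z\<close>, from
    \<open>y^6 x = z (y^4 z^4 - y^5 z^2)\<close> and \<open>y^6 y = z (x z^4 - x y z^2)\<close>
    modulo \<open>I\<close>. Its monomial of least degree is \<open>x y z^2\<close>, whence the
    exponent 4.\<close>
  define E where "E = (y^4 * z^4 - y^5 * z^2) * p + (x * z^4 - x * y * z^2) * q + y^6 * r"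
  have ES: "E \<in> S" unfolding E_def using c by simp
  have "z * (d - E) = (z * d - y^6 * c) + (x * y^2 + y * z^3 - z^5) * (y^4 * p) + (y^7 - (z^5 * x - z^3 * (x * y))) * q"
    unfolding E_def c(1) by (simp add: algebra_simps eval_nat_numeral)
  also have "\<dots> \<in> I" using c d by (intro I_add I_mult2 relation_I y7) simp_all
  finally have "d - E \<in> I" using z_cancel d ES by simp
  moreover have "E = x^0 * y^4 * z^4 * p - x^0 * y^5 * z^2 * p + (x^1 * y^0 * z^4 * q - x^1 * y^1 * z^2 * q) + x^0 * y^6 * z^0 * r"
    unfolding E_def by (simp add: algebra_simps)
  then have "E \<in> Pw 4"
    by (simp only:) (intro Pw_add Pw_diff Pw_monom'[OF refl], use c in simp_all)
  ultimately have "(d - E) + E \<in> Pw 4" using Pw_add[OF Pw_I] by blast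
  then show ?thesis by simp
qed

lemma delta_small_power: assumes "n \<le> 4" shows "delta R (quot_power n) = 0"
proof -
  let ?Y = "coded_ideal R (res ` KK)"
  interpret Y: module R ?Y by (rule coded_res_module[OF sideal_KK])
  have elt: "\<exists>a\<in>S. \<exists>b\<in>S. C = code (res (z * a + y^6 * b))" if CY: "C \<in> carrier ?Y" for C
  proof -
    obtain t where t: "t \<in> KK" "C = code (res t)" using CY by auto
    then obtain a b e where ab: "C = code (res (z * a + y^6 * b + e))" "a \<in> S" "b \<in> S" "e \<in> I"
      unfolding KK_def by blast
    then have "res (z * a + y^6 * b + e) = res (z * a + y^6 * b)"
      using res_eq[of "z * a + y^6 * b + e" "z * a + y^6 * b"] I_S by simp
    then show ?thesis using ab by metis
  qed
  have mem: "code (res (z * a + y^6 * b)) \<in> carrier ?Y" if "a \<in> S" "b \<in> S" for a b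
    using KKI[OF refl that I_zero] by simp
  \<comment> \<open>The coefficient \<open>a\<close> is determined by \<open>z a + y^6 b\<close>
    only modulo the fourth power; \<open>n \<le> 4\<close> makes its class unique, as the definite
    description requires.\<close>
  define \<phi> where "\<phi> C = (THE D. \<exists>a\<in>S. \<exists>b\<in>S. C = code (res (z * a + y^6 * b)) \<and> D = proj n a)" for C
  have \<phi>: "\<phi> (code (res (z * a + y^6 * b))) = proj n a" if ab: "a \<in> S" "b \<in> S" for a b
    unfolding \<phi>_def
  proof (rule the_equality)
    fix D assume "\<exists>a'\<in>S. \<exists>b'\<in>S. code (res (z * a + y^6 * b)) = code (res (z * a' + y^6 * b')) \<and> D = proj n a'"
    then obtain a' b' where ab': "a' \<in> S" "b' \<in> S" "res (z * a + y^6 * b) = res (z * a' + y^6 * b')" "D = proj n a'" by auto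
    then have "(z * a + y^6 * b) - (z * a' + y^6 * b') \<in> I" using ab by (simp add: res_eq)
    then have "z * (a - a') - y^6 * (b' - b) \<in> I" by (simp add: algebra_simps)
    then have "a - a' \<in> Pw 4" using ab ab' by (intro KK_quotient_well_defined) auto
    then have "a - a' \<in> Pw n" using Pw_antimono[OF assms] by blast
    then show "D = proj n a" using proj_eq[of a a' n] ab ab' by simp
  qed (use ab in blast)
  have "\<phi> \<in> module_hom R ?Y (quot_power n)"
    unfolding module_hom_def
  proof (intro CollectI conjI ballI)
    show "\<phi> \<in> carrier ?Y \<rightarrow> carrier (quot_power n)"
    proof
      fix C assume "C \<in> carrier ?Y"
      then obtain a b where "a \<in> S" "b \<in> S" "C = code (res (z * a + y^6 * b))" using elt by blast
      then show "\<phi> C \<in> carrier (quot_power n)" unfolding quot_power_carrier using \<phi> by simp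
    qed
    fix C assume "C \<in> carrier ?Y"
    then obtain a b where C: "a \<in> S" "b \<in> S" "C = code (res (z * a + y^6 * b))" using elt by blast
    show "\<phi> (C \<oplus>\<^bsub>?Y\<^esub> C') = \<phi> C \<oplus>\<^bsub>quot_power n\<^esub> \<phi> C'" if CY': "C' \<in> carrier ?Y" for C'
    proof -
      obtain a' b' where C': "a' \<in> S" "b' \<in> S" "C' = code (res (z * a' + y^6 * b'))" using elt[OF CY'] by blast
      have "C \<oplus>\<^bsub>?Y\<^esub> C' = code (res ((z * a + y^6 * b) + (z * a' + y^6 * b')))"
        unfolding C(3) C'(3) using C C' by (simp add: res_add[of "z * a + y^6 * b"])
      also have "(z * a + y^6 * b) + (z * a' + y^6 * b') = z * (a + a') + y^6 * (b + b')" by (simp add: algebra_simps)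
      finally have "\<phi> (C \<oplus>\<^bsub>?Y\<^esub> C') = proj n (a + a')"
        using \<phi>[of "a + a'" "b + b'"] C(1,2) C'(1,2) by simp
      then show ?thesis unfolding C(3) C'(3) using \<phi> C(1,2) C'(1,2) by (simp only: quot_power_add)
    qed
  next
    fix r C assume "r \<in> carrier R" "C \<in> carrier ?Y"
    then obtain a b where C: "a \<in> S" "b \<in> S" "C = code (res (z * a + y^6 * b))" using elt by blast
    obtain s where s: "s \<in> S" "r = res s" using \<open>r \<in> carrier R\<close> unfolding R_carrier by blast
    have "r \<odot>\<^bsub>?Y\<^esub> C = code (res (s * (z * a + y^6 * b)))"
      unfolding C(3) s(2) using C s by (simp add: res_mult[of s])
    also have "s * (z * a + y^6 * b) = z * (s * a) + y^6 * (s * b)" by (simp add: algebra_simps)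
    finally have "\<phi> (r \<odot>\<^bsub>?Y\<^esub> C) = proj n (s * a)"
      using \<phi>[of "s * a" "s * b"] C(1,2) s(1) by simp
    then show "\<phi> (r \<odot>\<^bsub>?Y\<^esub> C) = r \<odot>\<^bsub>quot_power n\<^esub> \<phi> C"
      unfolding C(3) s(2) using \<phi> C(1,2) s(1) by (simp only: quot_power_smult)
  qed
  moreover have "\<phi> ` carrier ?Y = carrier (quot_power n)"
  proof (rule equalityI)
    show "\<phi> ` carrier ?Y \<subseteq> carrier (quot_power n)"
      using \<open>\<phi> \<in> module_hom R ?Y (quot_power n)\<close> unfolding module_hom_def by blast
    show "carrier (quot_power n) \<subseteq> \<phi> ` carrier ?Y"
    proof
      fix D assume "D \<in> carrier (quot_power n)"
      then obtain a where "a \<in> S" "D = proj n a" unfolding quot_power_carrier by blast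
      then have "D = \<phi> (code (res (z * a + y^6 * 0)))" "code (res (z * a + y^6 * 0)) \<in> carrier ?Y"
        using \<phi>[of a 0] mem[of a 0] by simp_all
      then show "D \<in> \<phi> ` carrier ?Y" by blast
    qed
  qed
  moreover have "MCM R ?Y"
  proof (rule coded_MCM[OF sideal_KK, where G = "{z, y^6}" and w = z])
    show "{z, y^6} \<subseteq> KK" using KKI[of z 1 0 0] KKI[of "y^6" 0 1 0] by simp
    show "z \<in> KK" using KKI[of z 1 0 0] by simp
    fix N assume N: "submodule N R ?Y" "code ` res ` {z, y^6} \<subseteq> N"
    have gen_mem: "code (res (z * a + y^6 * b)) \<in> N" if "a \<in> S" "b \<in> S" for a b
    proof -
      have "res a \<odot>\<^bsub>?Y\<^esub> code (res z) \<in> N" "res b \<odot>\<^bsub>?Y\<^esub> code (res (y^6)) \<in> N"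
        using submodule.smult_closed[OF N(1), of "res a" "code (res z)"]
          submodule.smult_closed[OF N(1), of "res b" "code (res (y^6))"] N(2) that by simp_all
      moreover have "u \<oplus>\<^bsub>?Y\<^esub> v \<in> N" if "u \<in> N" "v \<in> N" for u v
        using subgroup.m_closed[OF submodule.axioms(1)[OF N(1)], of u v] that by simp
      ultimately have "res a \<odot>\<^bsub>?Y\<^esub> code (res z) \<oplus>\<^bsub>?Y\<^esub> res b \<odot>\<^bsub>?Y\<^esub> code (res (y^6)) \<in> N"
        by (simp only:)
      then show ?thesis using that by (simp add: mult.commute flip: res_add res_mult)
    qed
    show "code ` res ` KK \<subseteq> N"
    proof
      fix C assume "C \<in> code ` res ` KK"
      then obtain a b where "a \<in> S" "b \<in> S" "C = code (res (z * a + y^6 * b))" using elt[of C] by auto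
      then show "C \<in> N" using gen_mem by simp
    qed
  next
    fix s assume s: "s \<in> KK"
    show "z - z * s \<notin> I"
    proof
      assume "z - z * s \<in> I"
      then have "z * (1 - s) \<in> I" by (simp add: algebra_simps)
      then have "1 - s \<in> nn" using z_cancel[of "1 - s"] s sidealD(1)[OF sideal_KK] I_nn by auto
      moreover have "s \<in> nn"
      proof -
        obtain a b e where "s = z * a + (y * (y^5 * b)) + e" "a \<in> S" "b \<in> S" "e \<in> I"
          using s unfolding KK_def by (auto simp: eval_nat_numeral mult.assoc)
        then show ?thesis using nn_mult2[of z a] nn_mult2[of y "y^5 * b"] I_nn by simp
      qed
      ultimately have "(1 - s) + s \<in> nn" by (rule nn_add)
      then show False using one_nn by simp
    qed
  qed simp_all
  ultimately have "delta R (quot_power n) \<le> f_rank R ?Y"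
    unfolding delta_def by (intro Inf_lower) blast
  also have "f_rank R ?Y = 0"
  proof (rule f_rank_zero[OF Y.module_axioms])
    fix C assume "C \<in> carrier ?Y"
    then obtain a b where C: "a \<in> S" "b \<in> S" "C = code (res (z * a + y^6 * b))" using elt by blast
    \<comment> \<open>\<open>y^7 = z^2 (z^3 x - z (x y))\<close> modulo \<open>I\<close> is
      divisible by \<open>z\<close> twice. So \<open>y^6 (z a + y^6 b)\<close>, which contains
      \<open>y^5 y^7 b\<close>, still lies in the ideal \<open>(z, y^6)\<close> after division by
      \<open>z\<close>.\<close>
    define w where "w = z * ((z^3 * x - z * (x * y)) * (y^5 * b)) + y^6 * a"
    have wS: "w \<in> S" unfolding w_def using C by simp
    have wY: "code (res w) \<in> carrier ?Y" unfolding w_def using C by (intro mem) simp_all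
    have "y^6 * (z * a + y^6 * b) - z * w = (y^7 - (z^5 * x - z^3 * (x * y))) * (y^5 * b)"
      by (simp add: w_def algebra_simps eval_nat_numeral)
    also have "\<dots> \<in> I" using C by (intro I_mult2 y7) simp
    finally have "res (y^6 * (z * a + y^6 * b)) = res (z * w)" using C wS by (simp add: res_eq)
    then have "res (y^6) \<odot>\<^bsub>?Y\<^esub> C = res z \<odot>\<^bsub>?Y\<^esub> code (res w)"
      unfolding C(3) using C wS by (simp add: res_mult[of "y^6"] res_mult[of z w])
    then show "\<exists>w\<in>carrier ?Y. res (y^6) \<odot>\<^bsub>?Y\<^esub> C = res z \<odot>\<^bsub>?Y\<^esub> w" using wY by blast
  qed
  finally show ?thesis by simp
qed

theorem index_R: "index R = 5"
proof (rule antisym)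
  show "index R \<le> 5"
    unfolding index_def using delta_power_5
    by (intro Inf_lower CollectI exI[of _ 5]) (simp add: numeral_eq_enat)
  show "5 \<le> index R"
    unfolding index_def
  proof (rule Inf_greatest)
    fix m assume "m \<in> {enat n | n. 1 \<le> n \<and> delta R (quot_power n) = 1}"
    then obtain n where n: "m = enat n" "delta R (quot_power n) = 1" by blast
    then have "\<not> n \<le> 4" using delta_small_power[of n] by auto
    then show "5 \<le> m" using n by (simp add: numeral_eq_enat)
  qed
qed

end

theorem theorem3p2:
  fixes k :: "'k::field itself"
  shows "index (ring_R k) = 5 \<and> index (ring_R k) < gen_loewy_length (ring_R k) \<and>
         gen_loewy_length (ring_R k) = 6"
proof -
  interpret C: curve SS curve_ideal VV "T var_x" "T var_y" "T var_z :: 'k poly3 fract"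
    by (rule curve_model)
  have "ring_R k = C.R"
    by (simp add: ring_R_def C.R_def C.SR_def ring_S_eq ideal_I_eq)
  then show ?thesis using C.index_R C.gen_loewy_length_R by simp
qed

end
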